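(* Let $p$ be a prime, and let $K_1$ and $K_2$ be complete discrete valued fields of mixed characteristic $(0,p)$ with perfect residue fields and ramification indices $e_1$ and $e_2$. Let $n,m\ge1$ be integers with $m>M(K_1)e_1e_2$. Then there is a unique lifting map $\mathrm L:\mathrm{Hom}_{\mathbb Z}(\mathcal H_n(K_1),\mathcal H_m(K_2))\to \mathrm{Hom}(K_1,K_2)$, i.e. a unique map such that for every $\phi$ in the source, $\mathrm L(\phi)$ is an $(n,m)$-lifting of $\phi$.
   Context: All complete discrete valued fields of mixed characteristic $(0,p)$ carry the normalized valuation, with values in $\mathbb R\cup\{\infty\}$ and $\nu(p)=1$; it is extended uniquely to an algebraic closure. The ramification index is the integer $e$ with $\nu(\pi)=1/e$ for a uniformizer $\pi$. For such $(K,\nu)$ with maximal ideal $\mathfrak m$, $\mathcal H_n(K)=K/(1+\mathfrak m^n)$ is the set of classes $[x]_n=x(1+\mathfrak m^n)$, with $[x]_n[y]_n=[xy]_n$, $[x]_n+[y]_n=\{[x'+y']_n: x'\in[x]_n,y'\in[y]_n\}$ and $\nu([x]_n)=\nu(x)$. A representative of a class is an element of that coset. A homomorphism $f:\mathcal H_n(K_1)\to\mathcal H_m(K_2)$ is a map with $f(0)=0$, $f(1)=1$, $f(\alpha\beta)=f(\alpha)f(\beta)$, $f(\alpha+\beta)\subseteq f(\alpha)+f(\beta)$, and $\nu_1(\alpha)\le\nu_1(\beta)\Leftrightarrow \nu_2(f(\alpha))\le\nu_2(f(\beta))$. It is over $p$ if $f([p]_n)=[p]_m$; $\mathrm{Hom}_{\mathbb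 Z}(\mathcal H_n(K_1),\mathcal H_m(K_2))$ is the set of homomorphisms over $p$. $\mathrm{Hom}(K_1,K_2)$ is the set of field homomorphisms $g$ with $\nu_1(a)<\nu_1(b)\Leftrightarrow\nu_2(g(a))<\nu_2(g(b))$. The Witt ring $W(k)$ of the residue field $k$ of $K$ embeds canonically in the valuation ring of $K$. Let $F$ be the fraction field of $W(k)$ and $\pi$ a uniformizer of $K$. Define $M(K)=\max\{\nu(\pi-\sigma(\pi)):\sigma\in \mathrm{Hom}_F(K,K^{alg}),\ \sigma(\pi)\ne\pi\}$ (independent of $\pi$), with the convention $M(K)=0$ if $K=F$. A homomorphism $\phi:\mathcal H_n(K_1)\to\mathcal H_m(K_2)$ induces a well-defined reduction $\phi_{red,1}:\mathcal H_1(K_1)\to\mathcal H_1(K_2)$, $[x]_1\mapsto[y]_1$ where $y$ is a representative of $\phi([x]_n)$. A homomorphism $g\in\mathrm{Hom}(K_1,K_2)$ is an $(n,m)$-lifting of $\phi$ if, for a uniformizer $\pi_1$ of $K_1$ (the notion does not depend on which one), there is a representative $b$ of $\phi([\pi_1]_n)$ with $\nu_2(g(\pi_1)-b)>M(K_1)$, and $\phi_{red,1}([x]_1)=[g(x)]_1$ for all $x\in K_1$. *)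

theory Defs
  imports
    "HOL-Library.Extended_Real"
    "HOL-Computational_Algebra.Primes"
    "HOL-Algebra.Algebraic_Closure_Type"
    "HOL-Algebra.QuotRing"
    "HOL-Algebra.Ideal_Product"
begin

section \<open>Valued fields\<close>

locale valued_field =
  fixes \<nu> :: "'a::field \<Rightarrow> ereal"
  assumes not_MInfty: "\<nu> x \<noteq> - \<infinity>"
    and infinity_iff: "\<nu> x = \<infinity> \<longleftrightarrow> x = 0"
    and mult: "\<nu> (x * y) = \<nu> x + \<nu> y"
    and add: "min (\<nu> x) (\<nu> y) \<le> \<nu> (x + y)"

text \<open>A uniformizer is a nonzero element of positive valuation that generates the value group.\<close>

definition uniformizer :: "('a::field \<Rightarrow> ereal) \<Rightarrow> 'a \<Rightarrow> bool" where
  "uniformizer \<nu> \<pi> \<longleftrightarrow> 0 < \<nu> \<pi> \<and> \<pi> \<noteq> 0 \<and>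
     (\<forall>x. x \<noteq> 0 \<longrightarrow> (\<exists>k::int. \<nu> x = ereal (of_int k) * \<nu> \<pi>))"

definition val_converges :: "('a::field \<Rightarrow> ereal) \<Rightarrow> (nat \<Rightarrow> 'a) \<Rightarrow> 'a \<Rightarrow> bool" where
  "val_converges \<nu> s x \<longleftrightarrow> (\<lambda>i. \<nu> (s i - x)) \<longlonglongrightarrow> \<infinity>"

definition val_Cauchy :: "('a::field \<Rightarrow> ereal) \<Rightarrow> (nat \<Rightarrow> 'a) \<Rightarrow> bool" where
  "val_Cauchy \<nu> s \<longleftrightarrow> (\<forall>C::real. \<exists>N. \<forall>i\<ge>N. \<forall>j\<ge>N. ereal C < \<nu> (s i - s j))"

text \<open>
  Complete discrete valued fields of mixed characteristic \<open>(0,p)\<close>, with the normalized valuation.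
  Characteristic \<open>0\<close> is the sort constraint; residue characteristic \<open>p\<close> is contained in
  \<open>\<nu> p = 1 > 0\<close>.
\<close>

locale mixed_char_cdvf = valued_field \<nu> for \<nu> :: "'a::field_char_0 \<Rightarrow> ereal" +
  fixes p :: nat
  assumes prime: "prime p"
    and normalized: "\<nu> (of_nat p) = 1"
    and discrete: "\<exists>\<pi>. uniformizer \<nu> \<pi>"
    and complete: "val_Cauchy \<nu> s \<Longrightarrow> \<exists>x. val_converges \<nu> s x"

definition ramification_index :: "('a::field \<Rightarrow> ereal) \<Rightarrow> nat" where
  "ramification_index \<nu> = (THE e. \<exists>\<pi>. uniformizer \<nu> \<pi> \<and> \<nu> \<pi> = ereal (1 / real e))"

definition valuation_ring :: "('a::field \<Rightarrow> ereal) \<Rightarrow> 'a ring" where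
  "valuation_ring \<nu> = ring_of_type_algebra\<lparr>carrier := {x. 0 \<le> \<nu> x}\<rparr>"

definition max_ideal :: "('a::field \<Rightarrow> ereal) \<Rightarrow> 'a set" where
  "max_ideal \<nu> = {x. 0 < \<nu> x}"

definition residue_field :: "('a::field \<Rightarrow> ereal) \<Rightarrow> 'a set ring" where
  "residue_field \<nu> = valuation_ring \<nu> Quot max_ideal \<nu>"

text \<open>Perfectness of the residue field, whose characteristic is \<open>p\<close>: the Frobenius is onto.\<close>

definition perfect_residue_field :: "nat \<Rightarrow> ('a::field \<Rightarrow> ereal) \<Rightarrow> bool" where
  "perfect_residue_field p \<nu> \<longleftrightarrow>
     (\<forall>a \<in> carrier (residue_field \<nu>). \<exists>b \<in> carrier (residue_field \<nu>).
        b [^]\<^bsub>residue_field \<nu>\<^esub> p = a)"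


section \<open>The hyperfields \<open>K / (1 + \<mm>\<^sup>n)\<close>\<close>

definition max_ideal_power :: "('a::field \<Rightarrow> ereal) \<Rightarrow> nat \<Rightarrow> 'a set" where
  "max_ideal_power \<nu> n =
     (ideal_prod (valuation_ring \<nu>) (max_ideal \<nu>) ^^ n) (carrier (valuation_ring \<nu>))"

definition hclass :: "('a::field \<Rightarrow> ereal) \<Rightarrow> nat \<Rightarrow> 'a \<Rightarrow> 'a set" where
  "hclass \<nu> n x = {x * (1 + u) | u. u \<in> max_ideal_power \<nu> n}"

definition hyperfield :: "('a::field \<Rightarrow> ereal) \<Rightarrow> nat \<Rightarrow> 'a set set" where
  "hyperfield \<nu> n = range (hclass \<nu> n)"

definition hmult :: "('a::field \<Rightarrow> ereal) \<Rightarrow> nat \<Rightarrow> 'a set \<Rightarrow> 'a set \<Rightarrow> 'a set" where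
  "hmult \<nu> n \<alpha> \<beta> =
     (THE \<gamma>. \<exists>x y. \<alpha> = hclass \<nu> n x \<and> \<beta> = hclass \<nu> n y \<and> \<gamma> = hclass \<nu> n (x * y))"

definition hadd :: "('a::field \<Rightarrow> ereal) \<Rightarrow> nat \<Rightarrow> 'a set \<Rightarrow> 'a set \<Rightarrow> 'a set set" where
  "hadd \<nu> n \<alpha> \<beta> = {hclass \<nu> n (x + y) | x y. x \<in> \<alpha> \<and> y \<in> \<beta>}"

definition hval :: "('a::field \<Rightarrow> ereal) \<Rightarrow> nat \<Rightarrow> 'a set \<Rightarrow> ereal" where
  "hval \<nu> n \<alpha> = (THE v. \<exists>x. \<alpha> = hclass \<nu> n x \<and> v = \<nu> x)"

text \<open>
  Maps between hyperfields are extensional (\<open>\<rightarrow>\<^sub>E\<close>), so that a map is determined by its values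
  on the hyperfield.
\<close>

definition hyperfield_hom ::
  "('a::field \<Rightarrow> ereal) \<Rightarrow> nat \<Rightarrow> ('b::field \<Rightarrow> ereal) \<Rightarrow> nat \<Rightarrow> ('a set \<Rightarrow> 'b set) set" where
  "hyperfield_hom \<nu>\<^sub>1 n \<nu>\<^sub>2 m =
     {f \<in> hyperfield \<nu>\<^sub>1 n \<rightarrow>\<^sub>E hyperfield \<nu>\<^sub>2 m.
        f (hclass \<nu>\<^sub>1 n 0) = hclass \<nu>\<^sub>2 m 0 \<and>
        f (hclass \<nu>\<^sub>1 n 1) = hclass \<nu>\<^sub>2 m 1 \<and>
        (\<forall>\<alpha> \<in> hyperfield \<nu>\<^sub>1 n. \<forall>\<beta> \<in> hyperfield \<nu>\<^sub>1 n.
           f (hmult \<nu>\<^sub>1 n \<alpha> \<beta>) = hmult \<nu>\<^sub>2 m (f \<alpha>) (f \<beta>) \<and>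
           f ` hadd \<nu>\<^sub>1 n \<alpha> \<beta> \<subseteq> hadd \<nu>\<^sub>2 m (f \<alpha>) (f \<beta>) \<and>
           (hval \<nu>\<^sub>1 n \<alpha> \<le> hval \<nu>\<^sub>1 n \<beta> \<longleftrightarrow> hval \<nu>\<^sub>2 m (f \<alpha>) \<le> hval \<nu>\<^sub>2 m (f \<beta>)))}"

definition hyperfield_hom_over_p ::
  "nat \<Rightarrow> ('a::field \<Rightarrow> ereal) \<Rightarrow> nat \<Rightarrow> ('b::field \<Rightarrow> ereal) \<Rightarrow> nat \<Rightarrow> ('a set \<Rightarrow> 'b set) set" where
  "hyperfield_hom_over_p p \<nu>\<^sub>1 n \<nu>\<^sub>2 m =
     {f \<in> hyperfield_hom \<nu>\<^sub>1 n \<nu>\<^sub>2 m. f (hclass \<nu>\<^sub>1 n (of_nat p)) = hclass \<nu>\<^sub>2 m (of_nat p)}"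


section \<open>Homomorphisms of valued fields\<close>

definition field_homs :: "('a::field \<Rightarrow> 'b::field) set" where
  "field_homs = Ring.ring_hom ring_of_type_algebra ring_of_type_algebra"

definition valued_field_hom ::
  "('a::field \<Rightarrow> ereal) \<Rightarrow> ('b::field \<Rightarrow> ereal) \<Rightarrow> ('a \<Rightarrow> 'b) set" where
  "valued_field_hom \<nu>\<^sub>1 \<nu>\<^sub>2 =
     {g \<in> field_homs. \<forall>a b. \<nu>\<^sub>1 a < \<nu>\<^sub>1 b \<longleftrightarrow> \<nu>\<^sub>2 (g a) < \<nu>\<^sub>2 (g b)}"

definition extended_valuation :: "('a::field \<Rightarrow> ereal) \<Rightarrow> 'a alg_closure \<Rightarrow> ereal" where
  "extended_valuation \<nu> = (THE w. valued_field w \<and> (\<forall>x. w (to_ac x) = \<nu> x))"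


section \<open>The Witt ring of the residue field inside \<open>K\<close> and the invariant \<open>M(K)\<close>\<close>

text \<open>The Teichmueller map: the unique multiplicative section of the residue map.\<close>

definition teichmuller :: "('a::field \<Rightarrow> ereal) \<Rightarrow> 'a set \<Rightarrow> 'a" where
  "teichmuller \<nu> = (THE t. t \<in> extensional (carrier (residue_field \<nu>)) \<and>
     (\<forall>a \<in> carrier (residue_field \<nu>). t a \<in> a) \<and>
     (\<forall>a \<in> carrier (residue_field \<nu>). \<forall>b \<in> carrier (residue_field \<nu>).
        t (a \<otimes>\<^bsub>residue_field \<nu>\<^esub> b) = t a * t b))"

definition residue_root :: "nat \<Rightarrow> ('a::field \<Rightarrow> ereal) \<Rightarrow> nat \<Rightarrow> 'a set \<Rightarrow> 'a set" where
  "residue_root p \<nu> i a =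
     (THE b. b \<in> carrier (residue_field \<nu>) \<and> b [^]\<^bsub>residue_field \<nu>\<^esub> (p ^ i) = a)"

text \<open>
  The canonical embedding \<open>W(k) \<rightarrow> O\<^sub>K\<close> for perfect \<open>k\<close> sends the Witt vector
  \<open>(a\<^sub>0, a\<^sub>1, \<dots>)\<close> to \<open>\<Sum>i. p\<^sup>i \<tau>(a\<^sub>i\<^bsup>1/p^i\<^esup>)\<close>, where \<open>\<tau>\<close> is the Teichmueller map
  (Serre, Local Fields, II.5 and II.6). The following set is its image.
\<close>

definition witt_ring :: "nat \<Rightarrow> ('a::field \<Rightarrow> ereal) \<Rightarrow> 'a set" where
  "witt_ring p \<nu> =
     {x. \<exists>a. (\<forall>i::nat. a i \<in> carrier (residue_field \<nu>)) \<and>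
       val_converges \<nu> (\<lambda>N. \<Sum>i<N. of_nat p ^ i * teichmuller \<nu> (residue_root p \<nu> i (a i))) x}"

definition witt_field :: "nat \<Rightarrow> ('a::field \<Rightarrow> ereal) \<Rightarrow> 'a set" where
  "witt_field p \<nu> = {x / y | x y. x \<in> witt_ring p \<nu> \<and> y \<in> witt_ring p \<nu> \<and> y \<noteq> 0}"

definition homs_to_closure_over :: "'a::field set \<Rightarrow> ('a \<Rightarrow> 'a alg_closure) set" where
  "homs_to_closure_over F = {\<sigma> \<in> field_homs. \<forall>x\<in>F. \<sigma> x = to_ac x}"

text \<open>The value does not depend on the uniformizer chosen.\<close>

definition M_inv :: "nat \<Rightarrow> ('a::field \<Rightarrow> ereal) \<Rightarrow> ereal" where
  "M_inv p \<nu> =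
     (if witt_field p \<nu> = UNIV then 0
      else let \<pi> = (SOME \<pi>. uniformizer \<nu> \<pi>) in
        Max {extended_valuation \<nu> (to_ac \<pi> - \<sigma> \<pi>) | \<sigma>.
               \<sigma> \<in> homs_to_closure_over (witt_field p \<nu>) \<and> \<sigma> \<pi> \<noteq> to_ac \<pi>})"


section \<open>Liftings\<close>

definition reduction ::
  "('a::field \<Rightarrow> ereal) \<Rightarrow> nat \<Rightarrow> ('b::field \<Rightarrow> ereal) \<Rightarrow> ('a set \<Rightarrow> 'b set) \<Rightarrow> 'a set \<Rightarrow> 'b set" where
  "reduction \<nu>\<^sub>1 n \<nu>\<^sub>2 \<phi> \<alpha> =
     (THE \<beta>. \<exists>x y. \<alpha> = hclass \<nu>\<^sub>1 1 x \<and> y \<in> \<phi> (hclass \<nu>\<^sub>1 n x) \<and> \<beta> = hclass \<nu>\<^sub>2 1 y)"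

text \<open>
  The lifting condition at \<open>\<pi>\<^sub>1\<close> does not depend on the choice, so it is required for some uniformizer.
  The target level \<open>m\<close> is implicit in \<open>\<phi>\<close>, whose values are cosets of \<open>1 + \<mm>\<^sup>m\<close>.
\<close>

definition is_lifting ::
  "nat \<Rightarrow> ('a::field \<Rightarrow> ereal) \<Rightarrow> nat \<Rightarrow> ('b::field \<Rightarrow> ereal) \<Rightarrow> ('a set \<Rightarrow> 'b set) \<Rightarrow> ('a \<Rightarrow> 'b) \<Rightarrow> bool"
where
  "is_lifting p \<nu>\<^sub>1 n \<nu>\<^sub>2 \<phi> g \<longleftrightarrow> g \<in> valued_field_hom \<nu>\<^sub>1 \<nu>\<^sub>2 \<and>
     (\<exists>\<pi>\<^sub>1. uniformizer \<nu>\<^sub>1 \<pi>\<^sub>1 \<and>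
        (\<exists>b \<in> \<phi> (hclass \<nu>\<^sub>1 n \<pi>\<^sub>1). M_inv p \<nu>\<^sub>1 < \<nu>\<^sub>2 (g \<pi>\<^sub>1 - b))) \<and>
     (\<forall>x. reduction \<nu>\<^sub>1 n \<nu>\<^sub>2 \<phi> (hclass \<nu>\<^sub>1 1 x) = hclass \<nu>\<^sub>2 1 (g x))"

end

theory Submission imports Defs "Jordan_Normal_Form.Char_Poly" begin

text \<open>
  Let \<open>O\<close> be the valuation ring of \<open>K\<^sub>1\<close>, let \<open>W \<subseteq> O\<close> be the Witt ring of the residue field, and fix a uniformizer
  \<open>\<pi>\<close>. The powers \<open>1, \<pi>, \<dots>, \<pi>\<^sup>e\<^sup>-\<^sup>1\<close> with \<open>e = e\<^sub>1\<close> form a basis of \<open>O\<close> over \<open>W\<close> (\<open>ex_coords\<close>,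
  \<open>combination_eq_0\<close>), and \<open>\<pi>\<close> is a root of an Eisenstein polynomial
  \<open>P = X\<^sup>e - \<Sum>i<e. a\<^sub>i X\<^sup>i\<close> with \<open>a\<^sub>i \<in> p W\<close>. So a valuation preserving homomorphism from \<open>K\<^sub>1\<close> to a valued field, in
  which \<open>p\<close> has valuation \<open>1\<close>, amounts to a homomorphism on \<open>W\<close> with integral values
  together with a root of the transported polynomial (\<open>extend_witt_hom\<close>). A homomorphism
  \<open>\<phi>\<close> of hyperfields over \<open>p\<close> determines both data.

  \<^item> The map \<open>\<phi>\<close> preserves valuations (\<open>rep_val\<close>). The residue fields are perfect, so a Teichmueller element \<open>t\<close> has \<open>p\<^sup>i\<close>-th roots
    for all \<open>i\<close>. Since taking \<open>p\<close>-th powers contracts congruences, \<open>\<phi>\<close> maps the class of \<open>t\<close> to the class of a unique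
    Teichmueller element \<open>\<kappa> t\<close> (\<open>ex_teich_rep\<close>). The map \<open>\<kappa>\<close> is multiplicative, and additive modulo the maximal
    ideals. The closure of the additive group spanned by the pairs \<open>(t, \<kappa> t)\<close> is the graph of a ring
    homomorphism on \<open>W\<close>, here called \<open>witt_map\<close>. This rests on the first order addition law \<open>graph_teich_add\<close> of Witt vectors.

  \<^item> Let \<open>b\<close> be a representative of the image of the class of \<open>\<pi>\<close>, and let \<open>Q\<close> be the polynomial \<open>P\<close> transported to \<open>K\<^sub>2\<close>. The
    relation \<open>P(\<pi>) = 0\<close> is a hyperfield sum of monomials with known images, all of valuation at least \<open>1\<close>, so
    \<open>\<nu>\<^sub>2(Q(b)) \<ge> 1 + m/e\<^sub>2 > 1 + M e\<^sub>1\<close> (\<open>eis_relation_approx\<close>). The value \<open>Q(b)\<close> is the product of the differences of \<open>b\<close> and the \<open>e\<^sub>1\<close>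
    roots of \<open>Q\<close>, so \<open>\<nu>\<^sub>2(b - \<beta>) > M + 1/e\<^sub>1\<close> for some root \<open>\<beta>\<close>.

  \<^item> The difference of distinct roots of \<open>Q\<close> has valuation at most \<open>M\<close> (\<open>conjugates_separated\<close>). This holds for \<open>P\<close> by the definition of \<open>M\<close>, and it is
    a statement on the valuations of coefficients of a polynomial over \<open>K\<^sub>1\<close>, which every embedding of \<open>K\<^sub>1\<close> preserves. Hence \<open>\<beta>\<close>
    is the only root with \<open>\<nu>\<^sub>2(b - \<beta>) > M\<close>, and by Krasner's argument it lies in \<open>K\<^sub>2\<close> (\<open>ex_root_near_rep\<close>). This
    gives the lifting. Its uniqueness follows since any lifting maps \<open>t\<close> to \<open>\<kappa> t\<close> and \<open>\<pi>\<close> to a root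
    \<open>\<beta>\<close> of \<open>Q\<close> with \<open>\<nu>\<^sub>2(b - \<beta>) > M\<close>.

  The definition of \<open>M\<close> and Krasner's argument need the unique extension of the valuation to the algebraic
  closure (\<open>extended_valuation_eq\<close>). It is obtained from a Weierstrass factorization over the
  complete field: the elements integral over the valuation ring form a valuation ring of the closure.
\<close>

section \<open>Valuations of fields\<close>

context valued_field
begin

lemma val_0 [simp]: "\<nu> 0 = \<infinity>"
  using infinity_iff by simp

lemma val_real:
  assumes "x \<noteq> 0"
  obtains r where "\<nu> x = ereal r"
  using assms infinity_iff[of x] not_MInfty[of x] by (cases "\<nu> x") auto

lemma val_1 [simp]: "\<nu> 1 = 0"
proof -
  obtain r where r: "\<nu> 1 = ereal r" using val_real[of 1] by auto
  then show ?thesis using mult[of 1 1] by (simp add: zero_ereal_def)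
qed

lemma val_power: "\<nu> (x ^ k) = ereal (real k) * \<nu> x"
proof (induction k)
  case 0
  then show ?case by (simp flip: zero_ereal_def)
next
  case (Suc k)
  show ?case
  proof (cases "x = 0")
    case False
    then obtain r where "\<nu> x = ereal r" by (rule val_real)
    then show ?thesis using Suc by (simp add: mult algebra_simps)
  qed simp
qed

lemma val_minus_1: "\<nu> (-1) = 0"
proof -
  obtain r where r: "\<nu> (-1) = ereal r" using val_real[of "-1"] by auto
  then show ?thesis using mult[of "-1" "-1"] by (simp add: zero_ereal_def)
qed

lemma val_uminus [simp]: "\<nu> (- x) = \<nu> x"
  using mult[of "-1" x] val_minus_1 by simp

lemma val_minus_commute: "\<nu> (x - y) = \<nu> (y - x)"
  by (metis minus_diff_eq val_uminus)

lemma val_inverse: "x \<noteq> 0 \<Longrightarrow> \<nu> (inverse x) = - \<nu> x"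
proof -
  assume x: "x \<noteq> 0"
  obtain r where r: "\<nu> x = ereal r" using val_real[OF x] .
  obtain s where s: "\<nu> (inverse x) = ereal s" using val_real[of "inverse x"] x by auto
  have "\<nu> (x * inverse x) = 0" using x by simp
  then show ?thesis unfolding mult r s by (simp add: zero_ereal_def)
qed

lemma val_divide: "y \<noteq> 0 \<Longrightarrow> \<nu> (x / y) = \<nu> x - \<nu> y"
  by (simp add: divide_inverse mult val_inverse minus_ereal_def)

lemma ge_add: "c \<le> \<nu> x \<Longrightarrow> c \<le> \<nu> y \<Longrightarrow> c \<le> \<nu> (x + y)"
  using add[of x y] by (meson min.boundedI order_trans)

lemma gt_add: "c < \<nu> x \<Longrightarrow> c < \<nu> y \<Longrightarrow> c < \<nu> (x + y)"
  using add[of x y] by (meson min_less_iff_conj less_le_trans)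

lemma ge_diff: "c \<le> \<nu> x \<Longrightarrow> c \<le> \<nu> y \<Longrightarrow> c \<le> \<nu> (x - y)"
  using ge_add[of c x "- y"] by simp

lemma gt_diff: "c < \<nu> x \<Longrightarrow> c < \<nu> y \<Longrightarrow> c < \<nu> (x - y)"
  using gt_add[of c x "- y"] by simp

lemma ge_trans: "c \<le> \<nu> (x - y) \<Longrightarrow> c \<le> \<nu> (y - z) \<Longrightarrow> c \<le> \<nu> (x - z)"
  using ge_add[of c "x - y" "y - z"] by simp

lemma gt_trans: "c < \<nu> (x - y) \<Longrightarrow> c < \<nu> (y - z) \<Longrightarrow> c < \<nu> (x - z)"
  using gt_add[of c "x - y" "y - z"] by simp

lemma ge_mult: "ereal c \<le> \<nu> x \<Longrightarrow> ereal d \<le> \<nu> y \<Longrightarrow> ereal (c + d) \<le> \<nu> (x * y)"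
  unfolding mult by (metis add_mono plus_ereal.simps(1))

lemma ge_mult_int: "c \<le> \<nu> x \<Longrightarrow> 0 \<le> \<nu> y \<Longrightarrow> c \<le> \<nu> (x * y)"
  unfolding mult by (metis add.right_neutral add_mono)

lemma gt_mult_int: "c < \<nu> x \<Longrightarrow> 0 \<le> \<nu> y \<Longrightarrow> c < \<nu> (x * y)"
  unfolding mult using ereal_le_add_self order_less_le_trans by blast

lemma ge_mult_int': "0 \<le> \<nu> x \<Longrightarrow> c \<le> \<nu> y \<Longrightarrow> c \<le> \<nu> (x * y)"
  using ge_mult_int[of c y x] by (simp add: mult.commute)

lemma int_mult: "0 \<le> \<nu> x \<Longrightarrow> 0 \<le> \<nu> y \<Longrightarrow> 0 \<le> \<nu> (x * y)"
  by (rule ge_mult_int)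

lemma int_power: "0 \<le> \<nu> x \<Longrightarrow> 0 \<le> \<nu> (x ^ k)"
  by (induction k) (auto intro: int_mult)

lemma int_of_nat: "0 \<le> \<nu> (of_nat k)"
  by (induction k) (auto intro: ge_add)

lemma ge_sum: "(\<And>i. i \<in> I \<Longrightarrow> c \<le> \<nu> (f i)) \<Longrightarrow> c \<le> \<nu> (sum f I)"
  by (induction I rule: infinite_finite_induct) (auto intro: ge_add)

lemma gt_sum: "(\<And>i. i \<in> I \<Longrightarrow> c < \<nu> (f i)) \<Longrightarrow> c < \<infinity> \<Longrightarrow> c < \<nu> (sum f I)"
  by (induction I rule: infinite_finite_induct) (auto intro: gt_add)

lemma val_add_eq:
  assumes "\<nu> x < \<nu> y" shows "\<nu> (x + y) = \<nu> x"
proof (rule antisym)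
  show "\<nu> x \<le> \<nu> (x + y)" using assms by (intro ge_add) auto
  show "\<nu> (x + y) \<le> \<nu> x"
  proof (rule ccontr)
    assume "\<not> \<nu> (x + y) \<le> \<nu> x"
    then have "\<nu> x < \<nu> (x + y - y)" using assms by (intro gt_diff) auto
    then show False by simp
  qed
qed

lemma val_eqI: "\<nu> x < \<nu> (x - y) \<Longrightarrow> \<nu> y = \<nu> x"
  using val_add_eq[of x "y - x"] by (simp add: val_minus_commute)

lemma eq_0_if_val_unbounded:
  assumes "\<And>N::nat. ereal (real N) \<le> \<nu> x" shows "x = 0"
proof (rule ccontr)
  assume "x \<noteq> 0"
  then obtain r where "\<nu> x = ereal r" by (rule val_real)
  then show False using assms reals_Archimedean2[of r] by (metis ereal_less_eq(3) not_less)
qed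

text \<open>The term of least valuation dominates the sum.\<close>

lemma sum_val_distinct:
  assumes "finite I"
    and "\<And>i j. i \<in> I \<Longrightarrow> j \<in> I \<Longrightarrow> i \<noteq> j \<Longrightarrow> f i \<noteq> 0 \<Longrightarrow> f j \<noteq> 0 \<Longrightarrow> \<nu> (f i) \<noteq> \<nu> (f j)"
    and "k \<in> I"
  shows "\<nu> (sum f I) \<le> \<nu> (f k)"
proof (cases "\<exists>i\<in>I. f i \<noteq> 0")
  case False
  then show ?thesis using assms by auto
next
  case True
  define J where "J = {i \<in> I. f i \<noteq> 0}"
  have J: "finite J" "J \<noteq> {}" using True assms by (auto simp: J_def)
  obtain i where i: "i \<in> J" "\<And>j. j \<in> J \<Longrightarrow> \<nu> (f i) \<le> \<nu> (f j)"
    using J ex_min_if_finite[of "(\<lambda>i. \<nu> (f i)) ` J"] by (metis (no_types, lifting) arg_min_if_finite(1) arg_min_least)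
  have *: "\<nu> (f i) < \<nu> (f j)" if "j \<in> J" "j \<noteq> i" for j
    using i that assms(2)[of i j] by (auto simp: J_def order_less_le)
  have "sum f I = sum f J" unfolding J_def using assms(1) by (intro sum.mono_neutral_cong_right) auto
  also have "\<dots> = f i + sum f (J - {i})" using i J by (simp add: sum.remove)
  finally have "sum f I = f i + sum f (J - {i})" .
  moreover have "\<nu> (f i) < \<nu> (sum f (J - {i}))"
  proof (rule gt_sum)
    show "\<nu> (f i) < \<infinity>" using i infinity_iff[of "f i"] by (auto simp: J_def)
  qed (use * in auto)
  ultimately have "\<nu> (sum f I) = \<nu> (f i)" using val_add_eq by simp
  also have "\<dots> \<le> \<nu> (f k)"
    by (cases "f k = 0") (use i assms(3) in \<open>auto simp: J_def\<close>)
  finally show ?thesis .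
qed

text \<open>A lower bound for the Gauss valuation, the least valuation of a coefficient.\<close>

definition gauss_ge :: "ereal \<Rightarrow> 'a poly \<Rightarrow> bool" where
  "gauss_ge c P \<longleftrightarrow> (\<forall>i. c \<le> \<nu> (poly.coeff P i))"

lemma gauss_ge_0 [simp]: "gauss_ge c 0" by (simp add: gauss_ge_def)
lemma gauss_ge_add: "gauss_ge c P \<Longrightarrow> gauss_ge c Q \<Longrightarrow> gauss_ge c (P + Q)"
  by (auto simp: gauss_ge_def intro: ge_add)
lemma gauss_ge_mono: "gauss_ge c P \<Longrightarrow> d \<le> c \<Longrightarrow> gauss_ge d P"
  unfolding gauss_ge_def using order_trans by blast

lemma gauss_ge_diff: "gauss_ge c P \<Longrightarrow> gauss_ge c Q \<Longrightarrow> gauss_ge c (P - Q)"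
  by (auto simp: gauss_ge_def intro: ge_diff)
lemma gauss_ge_uminus: "gauss_ge c P \<Longrightarrow> gauss_ge c (- P)"
  by (auto simp: gauss_ge_def)
lemma gauss_ge_sum: "(\<And>i. i \<in> I \<Longrightarrow> gauss_ge c (f i)) \<Longrightarrow> gauss_ge c (sum f I)"
  by (induction I rule: infinite_finite_induct) (auto intro: gauss_ge_add)
lemma gauss_ge_mult:
  "gauss_ge (ereal c) P \<Longrightarrow> gauss_ge (ereal d) Q \<Longrightarrow> gauss_ge (ereal (c + d)) (P * Q)"
  unfolding gauss_ge_def coeff_mult by (intro allI ge_sum ge_mult) auto
lemma gauss_ge_mult_int: "gauss_ge c P \<Longrightarrow> gauss_ge 0 Q \<Longrightarrow> gauss_ge c (P * Q)"
  unfolding gauss_ge_def coeff_mult by (intro allI ge_sum ge_mult_int) auto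
lemma gauss_ge_mult_int': "gauss_ge 0 P \<Longrightarrow> gauss_ge c Q \<Longrightarrow> gauss_ge c (P * Q)"
  using gauss_ge_mult_int[of c Q P] by (simp add: mult.commute)
lemma gauss_ge_monom: "c \<le> \<nu> a \<Longrightarrow> gauss_ge c (Polynomial.monom a k)"
  by (auto simp: gauss_ge_def)
lemma gauss_ge_const: "c \<le> \<nu> a \<Longrightarrow> gauss_ge c [:a:]"
  using gauss_ge_monom[of c a 0] by (simp add: monom_0)
lemma gauss_ge_1: "gauss_ge 0 1"
  using gauss_ge_const[of 0 1] by (simp add: one_pCons)
lemma gauss_ge_prod: "(\<And>i. i \<in> I \<Longrightarrow> gauss_ge 0 (f i)) \<Longrightarrow> gauss_ge 0 (prod f I)"
  by (induction I rule: infinite_finite_induct) (auto intro: gauss_ge_mult_int gauss_ge_1)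

text \<open>
  For \<open>\<nu> x < 0\<close> the leading power would be the strictly dominant term of the equation.
\<close>

lemma root_integral:
  assumes "d > 0" "x ^ d = (\<Sum>i<d. a i * x ^ i)" "\<And>i. i < d \<Longrightarrow> 0 \<le> \<nu> (a i)"
  shows "0 \<le> \<nu> x"
proof (rule ccontr)
  assume neg: "\<not> 0 \<le> \<nu> x"
  then have "x \<noteq> 0" by auto
  then obtain r where r: "\<nu> x = ereal r" by (rule val_real)
  have r0: "r < 0" using neg r by auto
  have "ereal (real d * r) < \<nu> (\<Sum>i<d. a i * x ^ i)"
  proof (rule gt_sum)
    fix i assume "i \<in> {..<d}"
    then have i: "i < d" by auto
    have "ereal (real d * r) < ereal (real i * r)" using i r0 by simp
    also have "\<dots> = \<nu> (x ^ i)" by (simp add: val_power r)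
    also have "\<dots> \<le> \<nu> (a i * x ^ i)" by (rule ge_mult_int') (use assms(3) i in auto)
    finally show "ereal (real d * r) < \<nu> (a i * x ^ i)" .
  qed auto
  moreover have "\<nu> (x ^ d) = ereal (real d * r)" by (simp add: val_power r)
  ultimately show False using assms(2) by simp
qed

end

lemma carrier_valuation_ring [simp]: "carrier (valuation_ring \<nu>) = {x. 0 \<le> \<nu> x}"
  and mult_valuation_ring [simp]: "monoid.mult (valuation_ring \<nu>) = (*)"
  and add_valuation_ring [simp]: "ring.add (valuation_ring \<nu>) = (+)"
  and one_valuation_ring [simp]: "monoid.one (valuation_ring \<nu>) = 1"
  and zero_valuation_ring [simp]: "ring.zero (valuation_ring \<nu>) = 0"
  by (simp_all add: valuation_ring_def ring_of_type_algebra_def)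

section \<open>Residue classes\<close>

definition residue_class :: "('a::field \<Rightarrow> ereal) \<Rightarrow> 'a \<Rightarrow> 'a set" where
  "residue_class \<nu> x = {y. 0 < \<nu> (y - x)}"

context valued_field
begin

lemma residue_class_eq_iff: "residue_class \<nu> x = residue_class \<nu> y \<longleftrightarrow> 0 < \<nu> (x - y)"
proof
  assume "residue_class \<nu> x = residue_class \<nu> y"
  moreover have "x \<in> residue_class \<nu> x" by (simp add: residue_class_def)
  ultimately show "0 < \<nu> (x - y)" by (simp add: residue_class_def)
next
  assume "0 < \<nu> (x - y)"
  then show "residue_class \<nu> x = residue_class \<nu> y"
    unfolding residue_class_def using gt_trans[of 0] val_minus_commute by metis
qed

lemma residue_coset: "a_r_coset (valuation_ring \<nu>) (max_ideal \<nu>) x = residue_class \<nu> x"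
  unfolding a_r_coset_def' residue_class_def max_ideal_def
  by (auto intro!: exI[of _ "_ - x"])

lemma carrier_residue_field:
  "carrier (residue_field \<nu>) = residue_class \<nu> ` {x. 0 \<le> \<nu> x}"
  by (auto simp: residue_field_def FactRing_def A_RCOSETS_def' residue_coset)

lemma residue_class_mult_cong:
  assumes "0 \<le> \<nu> x" "0 \<le> \<nu> y" "0 < \<nu> (x' - x)" "0 < \<nu> (y' - y)"
  shows "0 < \<nu> (x' * y' - x * y)"
proof -
  have y': "0 \<le> \<nu> y'" using ge_add[of 0 y "y' - y"] assms by simp
  have "x' * y' - x * y = (x' - x) * y' + (y' - y) * x" by (simp add: algebra_simps)
  then show ?thesis using gt_add gt_mult_int assms y' by metis
qed

lemma residue_class_mult:
  assumes "0 \<le> \<nu> x" "0 \<le> \<nu> y"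
  shows "residue_class \<nu> x \<otimes>\<^bsub>residue_field \<nu>\<^esub> residue_class \<nu> y = residue_class \<nu> (x * y)"
proof -
  have "residue_class \<nu> x \<otimes>\<^bsub>residue_field \<nu>\<^esub> residue_class \<nu> y
     = (\<Union>a\<in>residue_class \<nu> x. \<Union>b\<in>residue_class \<nu> y. residue_class \<nu> (a * b))"
    by (simp add: residue_field_def FactRing_def rcoset_mult_def residue_coset)
  also have "\<dots> = residue_class \<nu> (x * y)"
  proof -
    have "residue_class \<nu> (a * b) = residue_class \<nu> (x * y)"
      if "a \<in> residue_class \<nu> x" "b \<in> residue_class \<nu> y" for a b
      unfolding residue_class_eq_iff
      by (rule residue_class_mult_cong[OF assms]) (use that in \<open>simp_all add: residue_class_def\<close>)
    moreover have "x \<in> residue_class \<nu> x" "y \<in> residue_class \<nu> y" by (simp_all add: residue_class_def)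
    ultimately show ?thesis by (intro equalityI) blast+
  qed
  finally show ?thesis .
qed

lemma residue_class_power:
  assumes "0 \<le> \<nu> x"
  shows "residue_class \<nu> x [^]\<^bsub>residue_field \<nu>\<^esub> (k::nat) = residue_class \<nu> (x ^ k)"
proof (induction k)
  case 0
  then show ?case by (simp add: nat_pow_def residue_field_def FactRing_def residue_coset)
next
  case (Suc k)
  have "residue_class \<nu> x [^]\<^bsub>residue_field \<nu>\<^esub> Suc k
    = residue_class \<nu> x [^]\<^bsub>residue_field \<nu>\<^esub> k \<otimes>\<^bsub>residue_field \<nu>\<^esub> residue_class \<nu> x"
    by (simp add: nat_pow_def)
  then show ?case using Suc residue_class_mult[of "x ^ k" x] assms int_power
    by (simp add: mult.commute)
qed

lemma perfect_residue_fieldD: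
  assumes "perfect_residue_field p \<nu>" "0 \<le> \<nu> x"
  shows "\<exists>y. 0 \<le> \<nu> y \<and> 0 < \<nu> (y ^ p - x)"
  using assms unfolding perfect_residue_field_def carrier_residue_field
  by (force simp: residue_class_power residue_class_eq_iff)

end

section \<open>Discreteness and hyperfield classes\<close>

context mixed_char_cdvf
begin

definition e :: nat where "e = ramification_index \<nu>"

lemma p_pos: "p > 0" using prime by (simp add: prime_gt_0_nat)

lemma val_p [simp]: "\<nu> (of_nat p) = 1" by (rule normalized)

lemma val_p_power: "\<nu> (of_nat p ^ k) = ereal (real k)"
  by (simp add: val_power)

lemma uniformizer_val:
  assumes "uniformizer \<nu> \<pi>"
  obtains k :: nat where "k > 0" "\<nu> \<pi> = ereal (1 / real k)"
proof -
  have pi: "\<pi> \<noteq> 0" "0 < \<nu> \<pi>" using assms by (auto simp: uniformizer_def)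
  obtain r where r: "\<nu> \<pi> = ereal r" using val_real[OF pi(1)] .
  have "(of_nat p :: 'a) \<noteq> 0" using p_pos by simp
  then obtain k :: int where "\<nu> (of_nat p) = ereal (of_int k) * \<nu> \<pi>"
    using assms unfolding uniformizer_def by blast
  then have k: "1 = of_int k * r" by (simp add: r one_ereal_def)
  have "r > 0" using pi r by simp
  then have "(0::real) < of_int k" using k zero_less_mult_pos2[of "of_int k" r] by simp
  then have "k > 0" by simp
  then show ?thesis using that[of "nat k"] k r
    by (simp add: field_simps)
qed

lemma uniformizer_unique_val:
  assumes "uniformizer \<nu> \<pi>" "uniformizer \<nu> \<rho>" shows "\<nu> \<pi> \<le> \<nu> \<rho>"
proof -
  have rho: "\<rho> \<noteq> 0" "0 < \<nu> \<rho>" using assms by (auto simp: uniformizer_def)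
  obtain k :: int where k: "\<nu> \<rho> = ereal (of_int k) * \<nu> \<pi>"
    using assms(1) rho by (auto simp: uniformizer_def)
  obtain l :: nat where l: "l > 0" "\<nu> \<pi> = ereal (1 / real l)" using uniformizer_val[OF assms(1)] .
  define r where "r = 1 / real l"
  have r: "\<nu> \<pi> = ereal r" "r > 0" using l by (auto simp: r_def)
  have "k > 0" using k rho r by (simp add: zero_less_mult_iff)
  then have "1 * r \<le> of_int k * r" using r by (intro mult_right_mono) auto
  then show ?thesis using k r by simp
qed

lemma e_pos: "e > 0" and uniformizer_val_e: "uniformizer \<nu> \<pi> \<Longrightarrow> \<nu> \<pi> = ereal (1 / real e)"
proof -
  obtain \<rho> where rho: "uniformizer \<nu> \<rho>" using discrete by blast
  obtain k :: nat where k: "k > 0" "\<nu> \<rho> = ereal (1 / real k)" using uniformizer_val[OF rho] .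
  have *: "\<nu> \<pi> = \<nu> \<rho>" if "uniformizer \<nu> \<pi>" for \<pi>
    using uniformizer_unique_val[OF that rho] uniformizer_unique_val[OF rho that] by simp
  have "e = k" unfolding e_def ramification_index_def
  proof (rule the_equality)
    show "\<exists>\<pi>. uniformizer \<nu> \<pi> \<and> \<nu> \<pi> = ereal (1 / real k)" using rho k by blast
    fix e assume "\<exists>\<pi>. uniformizer \<nu> \<pi> \<and> \<nu> \<pi> = ereal (1 / real e)"
    then have "1 / real e = 1 / real k" using * k by auto
    then show "e = k" using k by (metis divide_cancel_left of_nat_eq_iff zero_neq_one)
  qed
  then show "e > 0" "uniformizer \<nu> \<pi> \<Longrightarrow> \<nu> \<pi> = ereal (1 / real e)" using k * by auto
qed

lemma val_discrete:
  assumes "x \<noteq> 0"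
  obtains k :: int where "\<nu> x = ereal (of_int k / real e)"
proof -
  obtain \<rho> where rho: "uniformizer \<nu> \<rho>" using discrete by blast
  then obtain k :: int where "\<nu> x = ereal (of_int k) * \<nu> \<rho>" using assms by (auto simp: uniformizer_def)
  then show ?thesis using that[of k] uniformizer_val_e[OF rho] by simp
qed

lemma uniformizer_iff: "uniformizer \<nu> \<pi> \<longleftrightarrow> \<nu> \<pi> = ereal (1 / real e)"
proof
  assume pi: "\<nu> \<pi> = ereal (1 / real e)"
  show "uniformizer \<nu> \<pi>" unfolding uniformizer_def
  proof (intro conjI allI impI)
    show "0 < \<nu> \<pi>" using pi e_pos by simp
    show "\<pi> \<noteq> 0" using pi infinity_iff[of \<pi>] by auto
    fix x :: 'a assume "x \<noteq> 0"
    then obtain k :: int where "\<nu> x = ereal (of_int k / real e)" by (rule val_discrete)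
    then show "\<exists>k::int. \<nu> x = ereal (of_int k) * \<nu> \<pi>" using pi by auto
  qed
qed (rule uniformizer_val_e)

lemma gt_imp_ge_succ:
  assumes "ereal (of_int k / real e) < \<nu> x"
  shows "ereal ((of_int k + 1) / real e) \<le> \<nu> x"
proof (cases "x = 0")
  case False
  then obtain j :: int where j: "\<nu> x = ereal (of_int j / real e)" by (rule val_discrete)
  have "k < j" using assms j e_pos by (simp add: divide_less_cancel)
  then have "(of_int k :: real) + 1 \<le> of_int j" by linarith
  then show ?thesis using j e_pos by (simp add: divide_right_mono)
qed simp

lemma pos_imp_ge: "0 < \<nu> x \<Longrightarrow> ereal (1 / real e) \<le> \<nu> x"
  using gt_imp_ge_succ[of 0 x] by (simp add: zero_ereal_def)

lemma ge_imp_pos: "c > 0 \<Longrightarrow> ereal c \<le> \<nu> x \<Longrightarrow> 0 < \<nu> x"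
  by (metis ereal_less(2) order_less_le_trans)

text \<open>
  Division by a uniformizer writes an element of valuation at least \<open>(n+1)/e\<close> as a single
  product, so sums of products give nothing more.
\<close>

lemma max_ideal_power_eq: "max_ideal_power \<nu> n = {x. ereal (real n / real e) \<le> \<nu> x}"
proof (induction n)
  case 0
  then show ?case by (simp add: max_ideal_power_def flip: zero_ereal_def)
next
  case (Suc n)
  obtain \<pi> where pi: "uniformizer \<nu> \<pi>" using discrete by blast
  note vpi = uniformizer_val_e[OF pi]
  have pi0: "\<pi> \<noteq> 0" using pi by (simp add: uniformizer_def)
  have *: "max_ideal_power \<nu> (Suc n) = ideal_prod (valuation_ring \<nu>) (max_ideal \<nu>) (max_ideal_power \<nu> n)"
    by (simp add: max_ideal_power_def)
  show ?case
  proof (intro equalityI subsetI)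
    fix x assume "x \<in> max_ideal_power \<nu> (Suc n)"
    then have "x \<in> ideal_prod (valuation_ring \<nu>) (max_ideal \<nu>) {x. ereal (real n / real e) \<le> \<nu> x}"
      using * Suc by simp
    then show "x \<in> {x. ereal (real (Suc n) / real e) \<le> \<nu> x}"
    proof induction
      case (prod i j)
      then have "ereal (1 / real e) \<le> \<nu> i" using pos_imp_ge by (simp add: max_ideal_def)
      then show ?case using ge_mult[of "1 / real e" i "real n / real e" j] prod
        by (simp add: add_divide_distrib)
    qed (simp add: ge_add)
  next
    fix x assume "x \<in> {x. ereal (real (Suc n) / real e) \<le> \<nu> x}"
    then have x: "ereal (real (Suc n) / real e) \<le> \<nu> x" by simp
    have "ereal (real n / real e) \<le> \<nu> (x / \<pi>)"
    proof (cases "x = 0")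
      case False
      then obtain r where r: "\<nu> x = ereal r" by (rule val_real)
      show ?thesis using x e_pos by (simp add: val_divide[OF pi0] vpi r field_simps)
    qed simp
    then have "\<pi> \<otimes>\<^bsub>valuation_ring \<nu>\<^esub> (x / \<pi>) \<in> max_ideal_power \<nu> (Suc n)"
      unfolding * using Suc pi by (intro ideal_prod.prod) (auto simp: max_ideal_def uniformizer_def)
    then show "x \<in> max_ideal_power \<nu> (Suc n)" using pi0 by simp
  qed
qed

text \<open>
  At \<open>x = 0\<close> the left hand side of the inequality is infinite, in accordance with the class
  \<open>{0}\<close>.
\<close>

lemma in_hclass_iff: "y \<in> hclass \<nu> n x \<longleftrightarrow> \<nu> x + ereal (real n / real e) \<le> \<nu> (y - x)"
proof (cases "x = 0")
  case True
  have "\<exists>u. ereal (real n / real e) \<le> \<nu> u" by (rule exI[of _ 0]) simp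
  then show ?thesis using True infinity_iff[of y] by (auto simp: hclass_def max_ideal_power_eq)
next
  case False
  then obtain r where r: "\<nu> x = ereal r" by (rule val_real)
  have "y \<in> hclass \<nu> n x \<longleftrightarrow> ereal (real n / real e) \<le> \<nu> ((y - x) / x)"
  proof
    assume "y \<in> hclass \<nu> n x"
    then obtain u where "y = x * (1 + u)" "ereal (real n / real e) \<le> \<nu> u"
      by (auto simp: hclass_def max_ideal_power_eq)
    then show "ereal (real n / real e) \<le> \<nu> ((y - x) / x)" using False by (simp add: field_simps)
  next
    assume "ereal (real n / real e) \<le> \<nu> ((y - x) / x)"
    moreover have "y = x * (1 + (y - x) / x)" using False by (simp add: field_simps)
    ultimately show "y \<in> hclass \<nu> n x" unfolding hclass_def max_ideal_power_eq by blast
  qed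
  also have "\<dots> \<longleftrightarrow> \<nu> x + ereal (real n / real e) \<le> \<nu> (y - x)"
  proof (cases "y - x = 0")
    case ne: False
    then obtain s where "\<nu> (y - x) = ereal s" by (rule val_real)
    then show ?thesis by (simp add: val_divide[OF False] r algebra_simps)
  qed simp
  finally show ?thesis .
qed

lemma hclass_0 [simp]: "hclass \<nu> n 0 = {0}"
  by (auto simp: in_hclass_iff infinity_iff)

lemma self_in_hclass [simp]: "x \<in> hclass \<nu> n x"
  by (simp add: in_hclass_iff)

lemma in_hclass_val:
  assumes "n \<ge> 1" "y \<in> hclass \<nu> n x" shows "\<nu> y = \<nu> x"
proof (cases "x = 0")
  case False
  then obtain r where r: "\<nu> x = ereal r" by (rule val_real)
  have "\<nu> x < \<nu> x + ereal (real n / real e)" using r assms e_pos by simp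
  also have "\<dots> \<le> \<nu> (x - y)" using assms by (simp add: in_hclass_iff val_minus_commute)
  finally show ?thesis by (rule val_eqI)
qed (use assms in simp)

lemma hclass_eq_iff:
  assumes "n \<ge> 1" shows "hclass \<nu> n x = hclass \<nu> n y \<longleftrightarrow> y \<in> hclass \<nu> n x"
proof
  assume y: "y \<in> hclass \<nu> n x"
  have v: "\<nu> y = \<nu> x" by (rule in_hclass_val[OF assms y])
  show "hclass \<nu> n x = hclass \<nu> n y"
    using y unfolding set_eq_iff in_hclass_iff v using ge_trans val_minus_commute by metis
qed simp

lemma hclass_mult_mem:
  assumes "n \<ge> 1" "x' \<in> hclass \<nu> n x" "y' \<in> hclass \<nu> n y"
  shows "x' * y' \<in> hclass \<nu> n (x * y)"
proof -
  have "x' * y' - x * y = (x' - x) * y' + (y' - y) * x" by (simp add: algebra_simps)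
  moreover have "\<nu> (x * y) + ereal (real n / real e) \<le> \<nu> ((x' - x) * y')"
  proof -
    have "(\<nu> x + ereal (real n / real e)) + \<nu> y \<le> \<nu> (x' - x) + \<nu> y'"
      using assms in_hclass_val[OF assms(1,3)] by (intro add_mono) (auto simp: in_hclass_iff)
    then show ?thesis by (simp add: mult ac_simps)
  qed
  moreover have "\<nu> (x * y) + ereal (real n / real e) \<le> \<nu> ((y' - y) * x)"
  proof -
    have "(\<nu> y + ereal (real n / real e)) + \<nu> x \<le> \<nu> (y' - y) + \<nu> x"
      using assms by (intro add_mono) (auto simp: in_hclass_iff)
    then show ?thesis by (simp add: mult ac_simps)
  qed
  ultimately show ?thesis unfolding in_hclass_iff by (metis ge_add)
qed

lemma hmult_hclass:
  assumes "n \<ge> 1" shows "hmult \<nu> n (hclass \<nu> n x) (hclass \<nu> n y) = hclass \<nu> n (x * y)"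
  unfolding hmult_def
proof (rule the_equality)
  fix \<gamma> assume "\<exists>x' y'. hclass \<nu> n x = hclass \<nu> n x' \<and> hclass \<nu> n y = hclass \<nu> n y' \<and> \<gamma> = hclass \<nu> n (x' * y')"
  then show "\<gamma> = hclass \<nu> n (x * y)" using hclass_eq_iff[OF assms] hclass_mult_mem[OF assms] by metis
qed blast

lemma hval_hclass:
  assumes "n \<ge> 1" shows "hval \<nu> n (hclass \<nu> n x) = \<nu> x"
  unfolding hval_def
proof (rule the_equality)
  fix v assume "\<exists>x'. hclass \<nu> n x = hclass \<nu> n x' \<and> v = \<nu> x'"
  then show "v = \<nu> x" using in_hclass_val[OF assms] hclass_eq_iff[OF assms] by metis
qed blast

text \<open>
  Completeness with an explicit linear rate. All limits below are limits of sequences whose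
  successive differences have linearly growing valuation, and the rate passes to the limit.
\<close>

lemma complete_linear:
  assumes "\<delta> > 0" "\<And>i. ereal (real i * \<delta>) \<le> \<nu> (s (Suc i) - s i)"
  shows "\<exists>x. \<forall>i. ereal (real i * \<delta>) \<le> \<nu> (s i - x)"
proof -
  have *: "ereal (real i * \<delta>) \<le> \<nu> (s j - s i)" if "i \<le> j" for i j
    using that
  proof (induction j rule: dec_induct)
    case (step j)
    have "ereal (real i * \<delta>) \<le> ereal (real j * \<delta>)" using step assms(1) by simp
    also have "\<dots> \<le> \<nu> (s (Suc j) - s j)" by (rule assms)
    finally show ?case using ge_trans step by blast
  qed simp
  have big: "\<exists>N. \<forall>i\<ge>N. C < real i * \<delta>" for C
  proof -
    obtain N :: nat where N: "C / \<delta> < real N" using reals_Archimedean2 by blast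
    have "C < real i * \<delta>" if "i \<ge> N" for i
    proof -
      have "C < real N * \<delta>" using N assms(1) by (simp add: field_simps)
      also have "\<dots> \<le> real i * \<delta>" using that assms(1) by simp
      finally show ?thesis .
    qed
    then show ?thesis by blast
  qed
  have "val_Cauchy \<nu> s" unfolding val_Cauchy_def
  proof
    fix C :: real
    obtain N where N: "\<And>i. i \<ge> N \<Longrightarrow> C < real i * \<delta>" using big by blast
    have "ereal C < \<nu> (s i - s j)" if "i \<ge> N" "j \<ge> N" for i j
    proof -
      have "ereal (real (min i j) * \<delta>) \<le> \<nu> (s i - s j)"
        using *[of i j] *[of j i] by (cases "i \<le> j") (auto simp: val_minus_commute min_def)
      moreover have "ereal C < ereal (real (min i j) * \<delta>)" using N[of "min i j"] that by simp
      ultimately show ?thesis by (rule less_le_trans[rotated])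
    qed
    then show "\<exists>N. \<forall>i\<ge>N. \<forall>j\<ge>N. ereal C < \<nu> (s i - s j)" by blast
  qed
  then obtain x where x: "val_converges \<nu> s x" using complete by blast
  have "ereal (real i * \<delta>) \<le> \<nu> (s i - x)" for i
  proof -
    have "\<forall>\<^sub>F j in sequentially. ereal (real i * \<delta>) < \<nu> (s j - x)"
      using x unfolding val_converges_def tendsto_PInfty by blast
    then obtain j where "j \<ge> i" "ereal (real i * \<delta>) < \<nu> (s j - x)"
      unfolding eventually_sequentially by (metis nle_le)
    moreover from this have "ereal (real i * \<delta>) \<le> \<nu> (s i - s j)" using *[of i j] val_minus_commute by metis
    ultimately show ?thesis using ge_trans by (meson less_imp_le)
  qed
  then show ?thesis by blast
qed

lemma val_converges_linear:
  assumes "\<delta> > 0" "\<And>i. ereal (real i * \<delta>) \<le> \<nu> (s i - x)"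
  shows "val_converges \<nu> s x"
  unfolding val_converges_def tendsto_PInfty eventually_sequentially
proof
  fix C :: real
  obtain N :: nat where N: "C / \<delta> < real N" using reals_Archimedean2 by blast
  have "ereal C < \<nu> (s i - x)" if "i \<ge> N" for i
  proof -
    have "C < real N * \<delta>" using N assms(1) by (simp add: field_simps)
    also have "\<dots> \<le> real i * \<delta>" using that assms(1) by simp
    finally have "ereal C < ereal (real i * \<delta>)" by simp
    also have "\<dots> \<le> \<nu> (s i - x)" by (rule assms)
    finally show ?thesis .
  qed
  then show "\<exists>N. \<forall>n\<ge>N. ereal C < \<nu> (s n - x)" by blast
qed

lemma val_converges_unique:
  assumes "val_converges \<nu> s x" "val_converges \<nu> s y" shows "x = y"
proof -
  have "x - y = 0"
  proof (rule eq_0_if_val_unbounded)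
    fix N :: nat
    have "\<forall>\<^sub>F i in sequentially. ereal (real N) < \<nu> (s i - x) \<and> ereal (real N) < \<nu> (s i - y)"
      using assms unfolding val_converges_def tendsto_PInfty by (simp add: eventually_conj)
    then obtain i where "ereal (real N) < \<nu> (s i - x)" "ereal (real N) < \<nu> (s i - y)"
      unfolding eventually_sequentially by blast
    then show "ereal (real N) \<le> \<nu> (x - y)" using gt_trans[of _ x "s i" y] val_minus_commute[of x "s i"]
      by (simp add: order_less_imp_le)
  qed
  then show ?thesis by simp
qed

end

section \<open>Weierstrass factorization\<close>

interpretation to_ac: field_hom "to_ac :: 'a::field \<Rightarrow> 'a alg_closure"
  by unfold_locales simp_all
interpretation to_ac_poly: map_poly_inj_idom_hom "to_ac :: 'a::field \<Rightarrow> 'a alg_closure" ..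

context mixed_char_cdvf
begin

lemma division_by_monic:
  assumes G: "gauss_ge 0 G" "poly.coeff G r = 1" "Polynomial.degree G = r"
  shows "gauss_ge c E \<Longrightarrow> Polynomial.degree E \<le> r + k \<Longrightarrow>
    \<exists>S R. E = G * S + R \<and> gauss_ge c S \<and> gauss_ge c R \<and> (\<forall>i\<ge>r. poly.coeff R i = 0) \<and> Polynomial.degree S \<le> k"
proof (induction k arbitrary: E)
  case (0 E)
  define a where "a = poly.coeff E r"
  define R where "R = E - G * [:a:]"
  have a: "c \<le> \<nu> a" using 0 by (simp add: a_def gauss_ge_def)
  have "gauss_ge c R" unfolding R_def
    by (intro gauss_ge_diff 0 gauss_ge_mult_int' G gauss_ge_const a)
  moreover have "poly.coeff R i = 0" if "i \<ge> r" for i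
    using that 0 G by (cases "i = r") (auto simp: R_def a_def coeff_eq_0)
  ultimately show ?case using gauss_ge_const[OF a]
    by (intro exI[of _ "[:a:]"] exI[of _ R]) (auto simp: R_def)
next
  case (Suc k E)
  define a where "a = poly.coeff E (r + Suc k)"
  define E' where "E' = E - Polynomial.monom a (Suc k) * G"
  have a: "c \<le> \<nu> a" using Suc.prems by (simp add: a_def gauss_ge_def)
  have g: "gauss_ge c E'" unfolding E'_def
    by (intro gauss_ge_diff Suc.prems gauss_ge_mult_int G gauss_ge_monom a)
  have "Polynomial.degree E' \<le> r + k"
  proof (rule degree_le, intro allI impI)
    fix i assume i: "r + k < i"
    show "poly.coeff E' i = 0"
    proof (cases "i = r + Suc k")
      case True
      then show ?thesis using G by (simp add: E'_def a_def coeff_monom_mult)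
    next
      case False
      then have "i > r + Suc k" "i - Suc k > r" using i by auto
      then show ?thesis using G Suc.prems by (auto simp: E'_def coeff_monom_mult coeff_eq_0)
    qed
  qed
  then obtain S R where SR: "E' = G * S + R" "gauss_ge c S" "gauss_ge c R"
    "\<forall>i\<ge>r. poly.coeff R i = 0" "Polynomial.degree S \<le> k" using Suc.IH[OF g] by blast
  have "E = G * (Polynomial.monom a (Suc k) + S) + R"
    using SR(1) by (simp add: E'_def algebra_simps)
  moreover have "Polynomial.degree (Polynomial.monom a (Suc k) + S) \<le> Suc k"
    using SR(5) by (intro degree_add_le order_trans[OF degree_monom_le]) auto
  moreover have "gauss_ge c (Polynomial.monom a (Suc k) + S)"
    by (intro gauss_ge_add gauss_ge_monom a SR)
  ultimately show ?case using SR by blast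
qed

text \<open>
  Hensel's lemma for the factorization of \<open>Q\<close> as its part of degree at most \<open>r\<close> times \<open>1\<close>, modulo the maximal
  ideal. If \<open>Q = G H + E\<close> with \<open>H\<close> congruent to \<open>1\<close>, and \<open>E = G S + R\<close> by division by the monic \<open>G\<close>, then
  \<open>Q - (G + R) (H + S) = R (1 - H) - R S\<close> is smaller than \<open>E\<close>.
\<close>

lemma weierstrass_factorization:
  assumes Q: "gauss_ge 0 Q" "poly.coeff Q r = 1" "\<And>i. i > r \<Longrightarrow> 0 < \<nu> (poly.coeff Q i)"
    "Polynomial.degree Q \<le> r + k"
  shows "\<exists>G H. Q = G * H \<and> Polynomial.degree G = r \<and> Polynomial.degree H \<le> k"
proof -
  define \<delta> where "\<delta> = 1 / real e"
  have \<delta>: "\<delta> > 0" "0 \<le> ereal \<delta>" using e_pos by (auto simp: \<delta>_def)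
  \<comment> \<open>The error bound starts at \<open>\<delta>\<close>, which holds for the truncation of \<open>Q\<close> and \<open>1\<close>.\<close>
  define Inv where "Inv = (\<lambda>n (G, H). poly.coeff G r = 1 \<and> Polynomial.degree G = r \<and> gauss_ge 0 G \<and>
     Polynomial.degree H \<le> k \<and> gauss_ge (ereal \<delta>) (H - 1) \<and> gauss_ge (ereal (real (Suc n) * \<delta>)) (Q - G * H))"
  define Step where "Step = (\<lambda>n (G, H) (G', H'). gauss_ge (ereal (real n * \<delta>)) (G' - G) \<and>
     gauss_ge (ereal (real n * \<delta>)) (H' - H))"
  have "\<exists>f. \<forall>n. Inv n (f n) \<and> Step n (f n) (f (Suc n))"
  proof (rule dependent_nat_choice)
    define G where "G = poly_cutoff (Suc r) Q"
    have G: "poly.coeff G i = (if i \<le> r then poly.coeff Q i else 0)" for i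
      by (auto simp: G_def coeff_poly_cutoff)
    have "Polynomial.degree G = r"
      by (intro antisym degree_le le_degree) (auto simp: G Q)
    moreover have "gauss_ge (ereal \<delta>) (Q - G)"
      using Q pos_imp_ge by (auto simp: gauss_ge_def G \<delta>_def)
    ultimately show "\<exists>x. Inv 0 x"
      using Q by (intro exI[of _ "(G, 1)"]) (auto simp: Inv_def G gauss_ge_def)
  next
    fix x n assume "Inv n x"
    then obtain G H where x: "x = (G, H)" and G: "poly.coeff G r = 1" "Polynomial.degree G = r" "gauss_ge 0 G"
      and H: "Polynomial.degree H \<le> k" "gauss_ge (ereal \<delta>) (H - 1)"
      and E: "gauss_ge (ereal (real (Suc n) * \<delta>)) (Q - G * H)"
      by (cases x) (auto simp: Inv_def)
    define c where "c = real (Suc n) * \<delta>"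
    have c: "real n * \<delta> \<le> c" "\<delta> \<le> c" "0 \<le> c" using \<delta> by (auto simp: c_def algebra_simps)
    have "Polynomial.degree (Q - G * H) \<le> r + k"
      using Q(4) G H by (intro degree_diff_le order_trans[OF degree_mult_le]) auto
    then obtain S R where SR: "Q - G * H = G * S + R" "gauss_ge (ereal c) S" "gauss_ge (ereal c) R"
      "\<forall>i\<ge>r. poly.coeff R i = 0" "Polynomial.degree S \<le> k"
      using division_by_monic[OF G(3,1,2), of "ereal c" "Q - G * H" k] E unfolding c_def by blast
    have coeffs: "poly.coeff (G + R) i = (if i = r then 1 else if i > r then 0 else poly.coeff (G + R) i)" for i
      using SR(4) G by (auto simp: coeff_eq_0)
    have "Polynomial.degree (G + R) = r"
      by (intro antisym degree_le le_degree allI impI; subst coeffs; simp)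
    moreover have "gauss_ge 0 (G + R)"
      by (intro gauss_ge_add G gauss_ge_mono[OF SR(3)]) (use c in auto)
    moreover have "gauss_ge (ereal \<delta>) (H + S - 1)"
      using gauss_ge_add[OF H(2) gauss_ge_mono[OF SR(2)], of ] c by (simp add: algebra_simps)
    moreover have "gauss_ge (ereal (real (Suc (Suc n)) * \<delta>)) (Q - (G + R) * (H + S))"
    proof -
      have *: "Q - (G + R) * (H + S) = - (R * (H - 1)) - R * S"
        using SR(1) by (simp add: algebra_simps)
      have c': "real (Suc (Suc n)) * \<delta> = c + \<delta>" by (simp add: c_def algebra_simps)
      show ?thesis unfolding * c'
        by (intro gauss_ge_diff gauss_ge_uminus gauss_ge_mult SR H gauss_ge_mono[OF SR(2)]) (use c in auto)
    qed
    ultimately have "Inv (Suc n) (G + R, H + S)"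
      using G H SR by (auto simp: Inv_def intro!: degree_add_le)
    moreover have "Step n x (G + R, H + S)"
      using SR c by (auto simp: Step_def x intro: gauss_ge_mono)
    ultimately show "\<exists>y. Inv (Suc n) y \<and> Step n x y" by blast
  qed
  then obtain f where Inv: "\<And>n. Inv n (f n)" and Step: "\<And>n. Step n (f n) (f (Suc n))" by blast
  define G H where "G = (\<lambda>n. fst (f n))" and "H = (\<lambda>n. snd (f n))"
  have G: "poly.coeff (G n) r = 1" "Polynomial.degree (G n) = r" "gauss_ge 0 (G n)"
    and H: "Polynomial.degree (H n) \<le> k" "gauss_ge (ereal \<delta>) (H n - 1)"
    and E: "gauss_ge (ereal (real (Suc n) * \<delta>)) (Q - G n * H n)" for n
    using Inv[of n] by (auto simp: Inv_def G_def H_def split: prod.splits)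
  have GS: "gauss_ge (ereal (real n * \<delta>)) (G (Suc n) - G n)"
    and HS: "gauss_ge (ereal (real n * \<delta>)) (H (Suc n) - H n)" for n
    using Step[of n] by (auto simp: Step_def G_def H_def split: prod.splits)
  have limit: "\<exists>L. Polynomial.degree L \<le> d \<and> (\<forall>n. gauss_ge (ereal (real n * \<delta>)) (A n - L))"
    if deg: "\<And>n. Polynomial.degree (A n) \<le> d" and A: "\<And>n. gauss_ge (ereal (real n * \<delta>)) (A (Suc n) - A n)" for A d
  proof -
    have "\<exists>l. \<forall>n. ereal (real n * \<delta>) \<le> \<nu> (poly.coeff (A n) i - l)" for i
      by (rule complete_linear[OF \<delta>(1)]) (use A in \<open>simp add: gauss_ge_def\<close>)
    then obtain l where l: "\<And>i n. ereal (real n * \<delta>) \<le> \<nu> (poly.coeff (A n) i - l i)" by metis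
    define L where "L = (\<Sum>i\<le>d. Polynomial.monom (l i) i)"
    have L: "poly.coeff L i = (if i \<le> d then l i else 0)" for i
      by (auto simp: L_def coeff_sum)
    have "gauss_ge (ereal (real n * \<delta>)) (A n - L)" for n
      using l deg[of n] by (auto simp: gauss_ge_def L coeff_eq_0)
    moreover have "Polynomial.degree L \<le> d" by (rule degree_le) (simp add: L)
    ultimately show ?thesis by blast
  qed
  have deg: "Polynomial.degree (G n) \<le> r" for n using G by simp
  obtain G' where G': "Polynomial.degree G' \<le> r" "\<And>n. gauss_ge (ereal (real n * \<delta>)) (G n - G')"
    using limit[OF deg GS] by blast
  obtain H' where H': "Polynomial.degree H' \<le> k" "\<And>n. gauss_ge (ereal (real n * \<delta>)) (H n - H')"
    using limit[OF H(1) HS] by blast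
  have zero: "x = 0" if x: "\<And>n. ereal (real n * \<delta>) \<le> \<nu> x" for x
  proof (rule eq_0_if_val_unbounded)
    fix N show "ereal (real N) \<le> \<nu> x" using x[of "N * e"] e_pos by (simp add: \<delta>_def)
  qed
  have "1 - poly.coeff G' r = 0"
  proof (rule zero)
    fix n show "ereal (real n * \<delta>) \<le> \<nu> (1 - poly.coeff G' r)"
      using G'(2)[of n] G(1)[of n] unfolding gauss_ge_def by (metis coeff_diff)
  qed
  then have "Polynomial.degree G' = r" using G'(1) by (intro antisym le_degree) auto
  moreover have "Q - G' * H' = 0"
  proof (rule poly_eqI)
    fix i
    have "poly.coeff (Q - G' * H') i = 0"
    proof (rule zero)
      fix n
      have *: "Q - G' * H' = (Q - G n * H n) + (G n - G') * H n + G' * (H n - H')"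
        by (simp add: algebra_simps)
      have "gauss_ge 0 (H n - 1 + 1)"
        by (intro gauss_ge_add gauss_ge_1 gauss_ge_mono[OF H(2)]) (use \<delta> in auto)
      then have Hn: "gauss_ge 0 (H n)" by simp
      have "gauss_ge 0 (G 0 - (G 0 - G'))"
        by (intro gauss_ge_diff[of _ "G 0" "G 0 - G'"] G) (use G'(2)[of 0] in \<open>simp flip: zero_ereal_def\<close>)
      then have Gn: "gauss_ge 0 G'" by simp
      have "gauss_ge (ereal (real n * \<delta>)) (Q - G' * H')"
        unfolding * by (intro gauss_ge_add gauss_ge_mult_int gauss_ge_mult_int' G' H' Hn Gn gauss_ge_mono[OF E[of n]])
          (use \<delta> in \<open>simp add: algebra_simps\<close>)
      then show "ereal (real n * \<delta>) \<le> \<nu> (poly.coeff (Q - G' * H') i)" by (simp add: gauss_ge_def)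
    qed
    then show "poly.coeff (Q - G' * H') i = poly.coeff 0 i" by simp
  qed
  ultimately show ?thesis using H' by (metis eq_iff_diff_eq_0)
qed

section \<open>Integral elements of the algebraic closure\<close>

definition integral :: "'a alg_closure \<Rightarrow> bool" where
  "integral z \<longleftrightarrow> (\<exists>P. Polynomial.lead_coeff P = 1 \<and> gauss_ge 0 P \<and> poly (map_poly to_ac P) z = 0)"

lemma integral_to_ac: "0 \<le> \<nu> a \<Longrightarrow> integral (to_ac a)"
  unfolding integral_def
  by (rule exI[of _ "[:-a, 1:]"]) (auto simp: gauss_ge_def coeff_pCons split: nat.splits)

text \<open>
  Normalize an annihilating polynomial such that the least valuation of a coefficient is \<open>0\<close>, and let \<open>r\<close> be the last
  index where it is attained. If \<open>r\<close> is the degree, the equation is an integral equation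
  for \<open>z\<close>, and if \<open>r = 0\<close>, the reflected one is an integral equation for the inverse. In all other cases the polynomial
  factors, and one of the factors annihilates \<open>z\<close>.
\<close>

lemma integral_or_inverse_integral:
  assumes "P \<noteq> 0" "poly (map_poly to_ac P) z = 0"
  shows "integral z \<or> integral (inverse z)"
  using assms
proof (induction "Polynomial.degree P" arbitrary: P rule: less_induct)
  case less
  show ?case
  proof (cases "z = 0")
    case True
    then show ?thesis using integral_to_ac[of 0] by simp
  next
    case z: False
    define d where "d = Polynomial.degree P"
    define v where "v = Min ((\<lambda>i. \<nu> (poly.coeff P i)) ` {..d})"
    define r where "r = Max {i. i \<le> d \<and> \<nu> (poly.coeff P i) = v}"
    have "v \<in> (\<lambda>i. \<nu> (poly.coeff P i)) ` {..d}" unfolding v_def by (intro Min_in) auto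
    then have "{i. i \<le> d \<and> \<nu> (poly.coeff P i) = v} \<noteq> {}" by auto
    from Max_in[OF _ this] have r: "r \<le> d" "\<nu> (poly.coeff P r) = v" by (auto simp: r_def)
    have v_le: "v \<le> \<nu> (poly.coeff P i)" for i
    proof (cases "i \<le> d")
      case True
      then show ?thesis by (auto simp: v_def intro: Min_le)
    qed (simp add: d_def coeff_eq_0)
    have v_less: "v < \<nu> (poly.coeff P i)" if i: "i > r" "i \<le> d" for i
    proof (rule ccontr)
      assume "\<not> v < \<nu> (poly.coeff P i)"
      then have "\<nu> (poly.coeff P i) = v" using v_le[of i] by auto
      then have "i \<le> r" unfolding r_def using i by (intro Max_ge) auto
      then show False using i by simp
    qed
    have "v \<noteq> \<infinity>" using v_le[of d] less.prems(1) infinity_iff[of "Polynomial.lead_coeff P"] by (auto simp: d_def)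
    then have cr: "poly.coeff P r \<noteq> 0" using r by auto
    obtain w where w: "v = ereal w" using val_real[OF cr] r by auto
    define Q where "Q = Polynomial.smult (inverse (poly.coeff P r)) P"
    have Qc: "\<nu> (poly.coeff Q i) = \<nu> (poly.coeff P i) - v" for i
      using val_inverse[OF cr] r by (simp add: Q_def mult minus_ereal_def ac_simps)
    have Qr: "poly.coeff Q r = 1" using cr by (simp add: Q_def)
    have Qd: "Polynomial.degree Q = d" using cr by (simp add: Q_def d_def)
    have Q0: "gauss_ge 0 Q" using v_le by (simp add: gauss_ge_def Qc w ereal_le_minus_iff)
    have Qroot: "poly (map_poly to_ac Q) z = 0" using less.prems by (simp add: Q_def hom_distribs)
    have Qgt: "0 < \<nu> (poly.coeff Q i)" if "i > r" for i
    proof (cases "i \<le> d")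
      case True
      then show ?thesis using v_less[OF that True] by (simp add: Qc w ereal_less_minus_iff)
    qed (simp add: Qd coeff_eq_0)
    consider "r = d" | "r = 0" | "0 < r" "r < d" using r by linarith
    then show ?thesis
    proof cases
      case 1
      then have "integral z" unfolding integral_def using Qr Qd Q0 Qroot by blast
      then show ?thesis ..
    next
      case 2
      have "poly (reflect_poly (map_poly to_ac Q)) (inverse z) = 0"
        using Qroot z by (simp add: poly_reflect_poly_nz)
      moreover have "reflect_poly (map_poly to_ac Q) = map_poly to_ac (reflect_poly Q)"
        by (rule poly_eqI) (simp add: coeff_reflect_poly)
      moreover have "gauss_ge 0 (reflect_poly Q)"
        using Q0 by (auto simp: gauss_ge_def coeff_reflect_poly)
      moreover have "Polynomial.lead_coeff (reflect_poly Q) = 1"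
        using Qr 2 by (simp add: coeff_reflect_poly)
      ultimately have "integral (inverse z)" unfolding integral_def by metis
      then show ?thesis ..
    next
      case 3
      have "Polynomial.degree Q \<le> r + (d - r)" using Qd 3 by simp
      then obtain G H where GH: "Q = G * H" "Polynomial.degree G = r" "Polynomial.degree H \<le> d - r"
        using weierstrass_factorization[OF Q0 Qr Qgt] by blast
      have nz: "G \<noteq> 0" "H \<noteq> 0" using GH Qr by auto
      have "poly (map_poly to_ac G) z = 0 \<or> poly (map_poly to_ac H) z = 0"
        using Qroot by (simp add: GH hom_distribs)
      moreover have "Polynomial.degree G < d" "Polynomial.degree H < d" using GH 3 by auto
      ultimately show ?thesis using less.hyps nz unfolding d_def by blast
    qed
  qed
qed

text \<open>
  The determinant trick: an element that acts on a finitely generated module by an integral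
  matrix is a root of the characteristic polynomial of that matrix.
\<close>

lemma integral_if_acts_integrally:
  fixes v :: "'i \<Rightarrow> 'a alg_closure"
  assumes "finite I" "k0 \<in> I" "v k0 \<noteq> 0"
    and act: "\<And>k. k \<in> I \<Longrightarrow> z * v k = (\<Sum>l\<in>I. to_ac (M k l) * v l)"
    and M: "\<And>k l. k \<in> I \<Longrightarrow> l \<in> I \<Longrightarrow> 0 \<le> \<nu> (M k l)"
  shows "integral z"
proof -
  define n where "n = card I"
  obtain h where h: "bij_betw h {0..<n} I" using ex_bij_betw_nat_finite[OF assms(1)] by (auto simp: n_def)
  have hI: "h i \<in> I" if "i < n" for i using h that by (auto simp: bij_betw_def)
  define A where "A = Matrix.mat n n (\<lambda>(k, l). M (h k) (h l))"
  define w where "w = Matrix.vec n (\<lambda>k. v (h k))"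
  have A: "A \<in> carrier_mat n n" by (simp add: A_def)
  have A': "map_mat to_ac A \<in> carrier_mat n n" by (simp add: A_def)
  obtain i0 where i0: "i0 < n" "h i0 = k0" using h assms(2) by (auto simp: bij_betw_def image_iff)
  have "w \<noteq> 0\<^sub>v n"
  proof
    assume "w = 0\<^sub>v n"
    then have "w $ i0 = 0" using i0 by simp
    then show False using i0 assms(3) by (simp add: w_def)
  qed
  moreover have "map_mat to_ac A *\<^sub>v w = z \<cdot>\<^sub>v w"
  proof (rule eq_vecI)
    fix i assume "i < dim_vec (z \<cdot>\<^sub>v w)"
    then have i: "i < n" by (simp add: w_def)
    have "(map_mat to_ac A *\<^sub>v w) $ i = (\<Sum>l\<in>{0..<n}. to_ac (M (h i) (h l)) * v (h l))"
      using i by (simp add: A_def w_def scalar_prod_def)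
    also have "\<dots> = (\<Sum>l\<in>I. to_ac (M (h i) l) * v l)"
      by (rule sum.reindex_bij_betw[OF h])
    also have "\<dots> = z * v (h i)" using act[OF hI[OF i]] by simp
    finally show "(map_mat to_ac A *\<^sub>v w) $ i = (z \<cdot>\<^sub>v w) $ i" using i by (simp add: w_def)
  qed (simp add: A_def w_def)
  ultimately have "eigenvalue (map_mat to_ac A) z"
    unfolding eigenvalue_def eigenvector_def by (intro exI[of _ w]) (simp add: w_def A_def)
  then have "poly (char_poly (map_mat to_ac A)) z = 0"
    using eigenvalue_root_char_poly[OF A'] by simp
  then have root: "poly (map_poly to_ac (char_poly A)) z = 0"
    by (simp add: to_ac.char_poly_hom[OF A])
  have sgn: "gauss_ge 0 (signof q)" for q :: "nat \<Rightarrow> nat"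
    using gauss_ge_1 gauss_ge_uminus[OF gauss_ge_1] by (cases q rule: sign_cases) simp_all
  have "gauss_ge 0 (char_poly A)"
    unfolding char_poly_def det_def'[OF char_poly_matrix_closed[OF A]]
  proof (intro gauss_ge_sum gauss_ge_mult_int gauss_ge_prod sgn)
    fix q i assume "q \<in> {q. q permutes {0..<n}}" "i \<in> {0..<n}"
    then have iq: "i < n" "q i < n" by (auto simp: permutes_in_image)
    have "char_poly_matrix A $$ (i, q i) = (if i = q i then [:0, 1:] else 0) + [:- M (h i) (h (q i)):]"
      using iq by (simp add: char_poly_matrix_def A_def)
    moreover have "0 \<le> \<nu> (M (h i) (h (q i)))" using M hI iq by blast
    ultimately show "gauss_ge 0 (char_poly_matrix A $$ (i, q i))"
      by (auto simp: gauss_ge_def coeff_pCons split: nat.splits)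
  qed
  moreover have "Polynomial.lead_coeff (char_poly A) = 1" using degree_monic_char_poly[OF A] by simp
  ultimately show ?thesis unfolding integral_def using root by blast
qed

lemma integral_powers:
  assumes "integral x"
  obtains d c where "d > 0"
    "\<And>i. i < d \<Longrightarrow> x * x ^ i = (\<Sum>j<d. to_ac (c i j) * x ^ j)"
    "\<And>i j. 0 \<le> \<nu> (c i j)"
proof -
  obtain P where P: "Polynomial.lead_coeff P = 1" "gauss_ge 0 P" "poly (map_poly to_ac P) x = 0"
    using assms by (auto simp: integral_def)
  define d where "d = Polynomial.degree P"
  define c where "c = (\<lambda>i j. if Suc i < d then (if j = Suc i then 1 else 0) else - poly.coeff P j)"
  have "d \<noteq> 0"
  proof
    assume "d = 0"
    then obtain a where "P = [:a:]" unfolding d_def by (metis degree_eq_zeroE)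
    then show False using P by simp
  qed
  have "0 = (\<Sum>i\<le>d. to_ac (poly.coeff P i) * x ^ i)" using P(3) by (simp add: poly_altdef d_def)
  also have "{..d} = insert d {..<d}" by auto
  finally have rel: "x ^ d = (\<Sum>i<d. to_ac (- poly.coeff P i) * x ^ i)"
    using P(1) by (simp add: d_def sum_negf eq_neg_iff_add_eq_0)
  show ?thesis
  proof (rule that)
    show "d > 0" using \<open>d \<noteq> 0\<close> by simp
    show "0 \<le> \<nu> (c i j)" for i j using P(2) by (simp add: c_def gauss_ge_def)
    fix i assume i: "i < d"
    show "x * x ^ i = (\<Sum>j<d. to_ac (c i j) * x ^ j)"
    proof (cases "Suc i < d")
      case True
      then have "(\<Sum>j<d. to_ac (c i j) * x ^ j) = (\<Sum>j<d. if j = Suc i then x ^ j else 0)"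
        by (intro sum.cong) (auto simp: c_def)
      then show ?thesis using True by simp
    next
      case False
      then have "Suc i = d" using i by simp
      then show ?thesis using rel by (auto simp: c_def simp flip: power_Suc)
    qed
  qed
qed

lemma integral_mult:
  assumes "integral x" "integral y" shows "integral (x * y)"
proof -
  obtain d c where x: "d > 0" "\<And>i. i < d \<Longrightarrow> x * x ^ i = (\<Sum>j<d. to_ac (c i j) * x ^ j)"
    "\<And>i j. 0 \<le> \<nu> (c i j)" using integral_powers[OF assms(1)] by metis
  obtain d' c' where y: "d' > 0" "\<And>i. i < d' \<Longrightarrow> y * y ^ i = (\<Sum>j<d'. to_ac (c' i j) * y ^ j)"
    "\<And>i j. 0 \<le> \<nu> (c' i j)" using integral_powers[OF assms(2)] by metis
  show ?thesis
  proof (rule integral_if_acts_integrally)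
    show "finite ({..<d} \<times> {..<d'})" by simp
    show "(0, 0) \<in> {..<d} \<times> {..<d'}" using x y by simp
    show "(\<lambda>(i, j). x ^ i * y ^ j) (0, 0) \<noteq> 0" by simp
    show "0 \<le> \<nu> ((\<lambda>(i, i') (j, j'). c i j * c' i' j') k l)" for k l
      using x y by (auto simp: int_mult split: prod.splits)
    fix k assume "k \<in> {..<d} \<times> {..<d'}"
    then obtain i i' where k: "k = (i, i')" "i < d" "i' < d'" by auto
    have "x * y * (x ^ i * y ^ i') = (x * x ^ i) * (y * y ^ i')" by (simp add: ac_simps)
    also have "\<dots> = (\<Sum>j<d. \<Sum>j'<d'. to_ac (c i j * c' i' j') * (x ^ j * y ^ j'))"
      unfolding x(2)[OF k(2)] y(2)[OF k(3)] sum_product by (simp add: ac_simps)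
    also have "\<dots> = (\<Sum>l\<in>{..<d} \<times> {..<d'}. to_ac ((\<lambda>(i, i') (j, j'). c i j * c' i' j') k l) * (\<lambda>(i, j). x ^ i * y ^ j) l)"
      by (simp add: sum.cartesian_product k case_prod_unfold)
    finally show "x * y * (\<lambda>(i, j). x ^ i * y ^ j) k =
      (\<Sum>l\<in>{..<d} \<times> {..<d'}. to_ac ((\<lambda>(i, i') (j, j'). c i j * c' i' j') k l) * (\<lambda>(i, j). x ^ i * y ^ j) l)"
      by (simp add: k)
  qed
qed

end

lemma finite_total_preorder_has_least:
  assumes "finite I" "I \<noteq> {}"
    and "\<And>i j. i \<in> I \<Longrightarrow> j \<in> I \<Longrightarrow> R i j \<or> R j i"
    and "\<And>i j k. i \<in> I \<Longrightarrow> j \<in> I \<Longrightarrow> k \<in> I \<Longrightarrow> R i j \<Longrightarrow> R j k \<Longrightarrow> R i k"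
  shows "\<exists>i\<in>I. \<forall>j\<in>I. R i j"
  using assms
proof (induction I rule: finite_ne_induct)
  case (singleton x)
  then show ?case by blast
next
  case (insert x F)
  have "\<exists>i\<in>F. \<forall>j\<in>F. R i j"
  proof (rule insert.IH)
    show "R i j \<or> R j i" if "i \<in> F" "j \<in> F" for i j using insert.prems(1) that by simp
    show "R i k" if "i \<in> F" "j \<in> F" "k \<in> F" "R i j" "R j k" for i j k
      using insert.prems(2)[of i j k] that by simp
  qed
  then obtain i where i: "i \<in> F" "\<And>j. j \<in> F \<Longrightarrow> R i j" by blast
  show ?case
  proof (cases "R i x")
    case True
    then show ?thesis using i by blast
  next
    case False
    then have "R x i" "R x x" using insert.prems(1)[of i x] insert.prems(1)[of x x] i by auto
    moreover have "R x j" if "j \<in> F" for j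
      using insert.prems(2)[of x i j] calculation i that by auto
    ultimately show ?thesis by blast
  qed
qed

context mixed_char_cdvf
begin

lemma integral_dichotomy: "integral z \<or> integral (inverse z)"
proof -
  obtain P where "P \<noteq> 0" "poly (map_poly to_ac P) z = 0" by (rule alg_closure_algebraic)
  then show ?thesis by (rule integral_or_inverse_integral)
qed

lemma integral_1_add:
  assumes "integral z" shows "integral (1 + z)"
proof -
  obtain P where P: "Polynomial.lead_coeff P = 1" "gauss_ge 0 P" "poly (map_poly to_ac P) z = 0"
    using assms by (auto simp: integral_def)
  define Q where "Q = pcompose P [:-1, 1:]"
  have "Polynomial.lead_coeff Q = 1" unfolding Q_def by (subst lead_coeff_comp) (auto simp: P)
  moreover have "gauss_ge 0 Q"
  proof -
    have "gauss_ge 0 [:-1, 1:]" by (auto simp: gauss_ge_def coeff_pCons split: nat.splits)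
    moreover have "gauss_ge 0 (pcompose R S)" if "gauss_ge 0 R" "gauss_ge 0 S" for R S
      using that
    proof (induction R)
      case (pCons a R)
      then have "0 \<le> \<nu> a" "gauss_ge 0 R"
        using coeff_pCons_0[of a R] coeff_pCons_Suc[of a R] unfolding gauss_ge_def by metis+
      then show ?case using pCons by (auto simp: pcompose_pCons intro!: gauss_ge_add gauss_ge_mult_int gauss_ge_const)
    qed simp
    ultimately show ?thesis using P(2) by (simp add: Q_def)
  qed
  moreover have "poly (map_poly to_ac Q) (1 + z) = 0"
    unfolding Q_def by (subst to_ac.map_poly_pcompose) (simp add: poly_pcompose P(3))
  ultimately show ?thesis unfolding integral_def by blast
qed

text \<open>
  One of the two quotients of the summands is integral, which reduces sums to sums \<open>1 + z\<close>.
\<close>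

lemma integral_add:
  assumes "integral x" "integral y" shows "integral (x + y)"
proof -
  have *: "integral (x + y)" if "integral x" "x \<noteq> 0" "integral (y / x)" for x y
  proof -
    have "x + y = x * (1 + y / x)" using that by (simp add: field_simps)
    then show ?thesis using integral_mult[OF that(1) integral_1_add[OF that(3)]] by simp
  qed
  show ?thesis
  proof (cases "x = 0 \<or> y = 0")
    case False
    then have "integral (y / x) \<or> integral (x / y)"
      using integral_dichotomy[of "y / x"] by (simp add: field_simps)
    then show ?thesis using *[of x y] *[of y x] False assms by (auto simp: add.commute)
  qed (use assms in auto)
qed

lemma integral_0 [simp]: "integral 0" and integral_1 [simp]: "integral 1"
  using integral_to_ac[of 0] integral_to_ac[of 1] by simp_all

lemma integral_uminus: "integral x \<Longrightarrow> integral (- x)"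
  using integral_mult[of "-1" x] integral_to_ac[of "-1"] by simp

lemma integral_power: "integral x \<Longrightarrow> integral (x ^ k)"
  by (induction k) (auto intro: integral_mult)

lemma integral_imp_nonneg:
  assumes w: "valued_field w" "\<And>x. w (to_ac x) = \<nu> x" and "integral z"
  shows "0 \<le> w z"
proof -
  interpret w: valued_field w by (rule w)
  obtain d c where d: "d > 0" "\<And>i. i < d \<Longrightarrow> z * z ^ i = (\<Sum>j<d. to_ac (c i j) * z ^ j)"
    "\<And>i j. 0 \<le> \<nu> (c i j)" using integral_powers[OF assms(3)] by metis
  have "z ^ d = (\<Sum>j<d. to_ac (c (d - 1) j) * z ^ j)" 
    using d(1) d(2)[of "d - 1"] power_minus_mult[of d z] by (simp add: mult.commute)
  then show ?thesis
    by (rule w.root_integral[of d z "\<lambda>j. to_ac (c (d - 1) j)", OF d(1)]) (simp add: w d(3))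
qed

lemma integral_to_ac_iff: "integral (to_ac a) \<longleftrightarrow> 0 \<le> \<nu> a"
proof
  assume int: "integral (to_ac a)"
  obtain d c where d: "d > 0" "\<And>i. i < d \<Longrightarrow> to_ac a * to_ac a ^ i = (\<Sum>j<d. to_ac (c i j) * to_ac a ^ j)"
    "\<And>i j. 0 \<le> \<nu> (c i j)" using integral_powers[OF int] by metis
  have "to_ac (a ^ d) = to_ac (\<Sum>j<d. c (d - 1) j * a ^ j)"
    using d(1) d(2)[of "d - 1"] power_minus_mult[of d "to_ac a"] by (simp add: to_ac_sum mult.commute)
  then have "a ^ d = (\<Sum>j<d. c (d - 1) j * a ^ j)" by (simp only: to_ac_eq_iff)
  then show "0 \<le> \<nu> a" by (rule root_integral[of d a "\<lambda>j. c (d - 1) j", OF d(1)]) (rule d(3))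
qed (rule integral_to_ac)

section \<open>The extension of the valuation\<close>

definition int_unit :: "'a alg_closure \<Rightarrow> bool" where
  "int_unit z \<longleftrightarrow> z \<noteq> 0 \<and> integral z \<and> integral (inverse z)"

lemma int_unit_mult: "int_unit x \<Longrightarrow> int_unit y \<Longrightarrow> int_unit (x * y)"
  by (auto simp: int_unit_def integral_mult)
lemma int_unit_inverse: "int_unit x \<Longrightarrow> int_unit (inverse x)"
  by (auto simp: int_unit_def)
lemma int_unit_1 [simp]: "int_unit 1" by (simp add: int_unit_def)
lemma int_unit_power: "int_unit x \<Longrightarrow> int_unit (x ^ k)"
  by (induction k) (auto intro: int_unit_mult)
lemma int_unit_uminus_1: "int_unit (-1)"
  using integral_uminus[of 1] by (simp add: int_unit_def)

text \<open>
  One of two elements divides the other in the valuation ring of integral elements, so it divides the sum, and the sum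
  is a nonunit if both are.
\<close>

lemma nonunit_add:
  assumes "integral x" "\<not> int_unit x" "integral y" "\<not> int_unit y"
  shows "\<not> int_unit (x + y)"
proof -
  have *: "\<not> int_unit (x + y)" if "integral x" "\<not> int_unit x" "x \<noteq> 0" "integral (y / x)" for x y
  proof
    assume u: "int_unit (x + y)"
    have "inverse x = inverse (x + y) * (1 + y / x)" using u that by (simp add: field_simps int_unit_def)
    then have "integral (inverse x)"
      using u integral_mult[OF _ integral_1_add[OF that(4)]] by (simp add: int_unit_def)
    then show False using that by (simp add: int_unit_def)
  qed
  show ?thesis
  proof (cases "x = 0 \<or> y = 0")
    case False
    then have "integral (y / x) \<or> integral (x / y)"
      using integral_dichotomy[of "y / x"] by (simp add: field_simps)
    then show ?thesis using *[of x y] *[of y x] False assms by (auto simp: add.commute)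
  qed (use assms in auto)
qed

lemma nonunit_sum:
  assumes "\<And>i. i \<in> I \<Longrightarrow> integral (f i) \<and> \<not> int_unit (f i)"
  shows "integral (sum f I) \<and> \<not> int_unit (sum f I)"
  using assms
proof (induction I rule: infinite_finite_induct)
  case (insert i F)
  then have "integral (f i)" "\<not> int_unit (f i)" "integral (sum f F)" "\<not> int_unit (sum f F)" by auto
  then show ?case using insert.hyps integral_add nonunit_add by simp
qed (simp_all add: int_unit_def)

text \<open>
  An element of the closure satisfies a polynomial equation over the base field. Two of its
  terms must be associated in the ring of integral elements, since a sum in which one term
  strictly dominates does not vanish. Hence some power is associated to an element of the base.
\<close>

lemma ex_power_associated:
  assumes "x \<noteq> 0"
  shows "\<exists>n a. n > 0 \<and> a \<noteq> 0 \<and> int_unit (x ^ n / to_ac a)"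
proof -
  obtain P where P: "P \<noteq> 0" "poly (map_poly to_ac P) x = 0" by (rule alg_closure_algebraic)
  define I where "I = {i. i \<le> Polynomial.degree P \<and> poly.coeff P i \<noteq> 0}"
  define f where "f = (\<lambda>i. to_ac (poly.coeff P i) * x ^ i)"
  have I: "finite I" "I \<noteq> {}" using P(1) by (auto simp: I_def)
  have nz: "f i \<noteq> 0" if "i \<in> I" for i using that assms by (auto simp: I_def f_def)
  have sum0: "sum f I = 0"
  proof -
    have "sum f I = (\<Sum>i\<le>Polynomial.degree P. f i)"
      by (intro sum.mono_neutral_left) (auto simp: I_def f_def)
    then show ?thesis using P(2) by (simp add: poly_altdef f_def)
  qed
  have "\<exists>i\<in>I. \<forall>j\<in>I. integral (f j / f i)"
  proof (rule finite_total_preorder_has_least[OF I])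
    fix i j show "integral (f j / f i) \<or> integral (f i / f j)"
      using integral_dichotomy[of "f j / f i"] by simp
  next
    fix i j k assume "i \<in> I" "j \<in> I" "k \<in> I" "integral (f j / f i)" "integral (f k / f j)"
    moreover have "f k / f i = f k / f j * (f j / f i)" using nz[OF \<open>j \<in> I\<close>] by simp
    ultimately show "integral (f k / f i)" using integral_mult by metis
  qed
  then obtain i where i: "i \<in> I" "\<And>j. j \<in> I \<Longrightarrow> integral (f j / f i)" by blast
  have "\<exists>j\<in>I - {i}. int_unit (f j / f i)"
  proof (rule ccontr)
    assume "\<not> (\<exists>j\<in>I - {i}. int_unit (f j / f i))"
    then have "\<not> int_unit (\<Sum>j\<in>I - {i}. f j / f i)"
      using nonunit_sum[of "I - {i}" "\<lambda>j. f j / f i"] i by auto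
    moreover have "(\<Sum>j\<in>I - {i}. f j / f i) = -1"
    proof -
      have "f i + sum f (I - {i}) = 0" using sum0 sum.remove[OF I(1) i(1), of f] by simp
      then have "sum f (I - {i}) = - f i" by (metis add_eq_0_iff)
      then show ?thesis using nz[OF i(1)] by (simp flip: sum_divide_distrib)
    qed
    ultimately show False using int_unit_uminus_1 by simp
  qed
  then obtain j where j: "j \<in> I" "j \<noteq> i" "int_unit (f j / f i)" by blast
  have *: "\<exists>n a. n > 0 \<and> a \<noteq> 0 \<and> int_unit (x ^ n / to_ac a)"
    if "i \<in> I" "j \<in> I" "i < j" "int_unit (f j / f i)" for i j
  proof (intro exI conjI)
    show "j - i > 0" using that by simp
    show "poly.coeff P i / poly.coeff P j \<noteq> 0" using that by (auto simp: I_def)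
    have "x ^ (j - i) / to_ac (poly.coeff P i / poly.coeff P j) = f j / f i"
      using that assms by (simp add: f_def power_diff field_simps)
    then show "int_unit (x ^ (j - i) / to_ac (poly.coeff P i / poly.coeff P j))" using that by simp
  qed
  show ?thesis
  proof (cases "i < j")
    case True
    then show ?thesis using * i j by blast
  next
    case False
    then have "j < i" "int_unit (f i / f j)" using j int_unit_inverse[of "f j / f i"] by auto
    then show ?thesis using * i j by blast
  qed
qed

lemma associated_val_unique:
  assumes "int_unit (x ^ n / to_ac a)" "int_unit (x ^ k / to_ac b)" "n > 0" "k > 0" "a \<noteq> 0" "b \<noteq> 0"
  shows "\<nu> a / ereal (real n) = \<nu> b / ereal (real k)"
proof -
  have "(x ^ n / to_ac a) ^ k * inverse ((x ^ k / to_ac b) ^ n) = to_ac (b ^ n / a ^ k)"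
    using assms by (simp add: field_simps int_unit_def flip: power_mult)
  then have "int_unit (to_ac (b ^ n / a ^ k))"
    using assms by (metis int_unit_mult int_unit_power int_unit_inverse)
  then have "0 \<le> \<nu> (b ^ n / a ^ k)" "0 \<le> \<nu> (inverse (b ^ n / a ^ k))"
    unfolding int_unit_def by (auto simp flip: integral_to_ac_iff)
  moreover obtain r where "\<nu> a = ereal r" by (rule val_real[OF assms(5)])
  moreover obtain s where "\<nu> b = ereal s" by (rule val_real[OF assms(6)])
  ultimately show ?thesis using assms
    by (simp add: val_divide val_inverse val_power field_simps)
qed

text \<open>
  If \<open>x\<^sup>n\<close> is a unit times \<open>a\<close>, then the valuation of \<open>x\<close> can
  only be \<open>\<nu> a / n\<close>.
\<close>

definition ext_val :: "'a alg_closure \<Rightarrow> ereal" where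
  "ext_val x = (if x = 0 then \<infinity> else
     (THE v. \<exists>n a. n > 0 \<and> a \<noteq> 0 \<and> int_unit (x ^ n / to_ac a) \<and> v = \<nu> a / ereal (real n)))"

lemma ext_val_eq:
  assumes "int_unit (x ^ n / to_ac a)" "n > 0" "a \<noteq> 0"
  shows "ext_val x = \<nu> a / ereal (real n)"
proof -
  have "x \<noteq> 0" using assms by (auto simp: int_unit_def)
  moreover have "(THE v. \<exists>n a. n > 0 \<and> a \<noteq> 0 \<and> int_unit (x ^ n / to_ac a) \<and> v = \<nu> a / ereal (real n))
    = \<nu> a / ereal (real n)"
  proof (rule the_equality)
    fix v assume "\<exists>n a. n > 0 \<and> a \<noteq> 0 \<and> int_unit (x ^ n / to_ac a) \<and> v = \<nu> a / ereal (real n)"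
    then obtain k b where "k > 0" "b \<noteq> 0" "int_unit (x ^ k / to_ac b)" "v = \<nu> b / ereal (real k)" by blast
    then show "v = \<nu> a / ereal (real n)" using associated_val_unique assms by metis
  qed (use assms in blast)
  ultimately show ?thesis by (simp add: ext_val_def)
qed

lemma ext_val_real:
  assumes "x \<noteq> 0"
  obtains n a r where "n > 0" "a \<noteq> 0" "int_unit (x ^ n / to_ac a)" "\<nu> a = ereal r" "ext_val x = ereal (r / real n)"
proof -
  obtain n a where na: "n > 0" "a \<noteq> 0" "int_unit (x ^ n / to_ac a)" using ex_power_associated[OF assms] by blast
  moreover obtain r where r: "\<nu> a = ereal r" using val_real[OF na(2)] .
  ultimately show ?thesis using that[OF na r] ext_val_eq[OF na(3,1,2)] r by simp
qed

lemma ext_val_finite: "x \<noteq> 0 \<Longrightarrow> \<exists>r. ext_val x = ereal r"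
  by (rule ext_val_real) blast+

lemma ext_val_0 [simp]: "ext_val 0 = \<infinity>" by (simp add: ext_val_def)

lemma ext_val_not_MInfty: "ext_val x \<noteq> - \<infinity>"
proof (cases "x = 0")
  case False
  then obtain r where "ext_val x = ereal r" using ext_val_finite by blast
  then show ?thesis by simp
qed simp

lemma ext_val_mult: "ext_val (x * y) = ext_val x + ext_val y"
proof (cases "x = 0 \<or> y = 0")
  case True
  then show ?thesis using ext_val_not_MInfty[of x] ext_val_not_MInfty[of y] by auto
next
  case False
  then have nz: "x \<noteq> 0" "y \<noteq> 0" by auto
  obtain n a r where x: "n > 0" "a \<noteq> 0" "int_unit (x ^ n / to_ac a)" "\<nu> a = ereal r" "ext_val x = ereal (r / real n)"
    by (rule ext_val_real[OF nz(1)])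
  obtain k b s where y: "k > 0" "b \<noteq> 0" "int_unit (y ^ k / to_ac b)" "\<nu> b = ereal s" "ext_val y = ereal (s / real k)"
    by (rule ext_val_real[OF nz(2)])
  have "(x * y) ^ (n * k) / to_ac (a ^ k * b ^ n) = (x ^ n / to_ac a) ^ k * (y ^ k / to_ac b) ^ n"
    by (simp add: power_divide power_mult_distrib mult.commute flip: power_mult)
  then have "int_unit ((x * y) ^ (n * k) / to_ac (a ^ k * b ^ n))"
    using int_unit_mult[OF int_unit_power[OF x(3)] int_unit_power[OF y(3)]] by metis
  then have "ext_val (x * y) = \<nu> (a ^ k * b ^ n) / ereal (real (n * k))"
    by (rule ext_val_eq) (use x(1,2) y(1,2) in auto)
  also have "\<nu> (a ^ k * b ^ n) = ereal (real k * r + real n * s)"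
    by (simp add: mult val_power x(4) y(4))
  also have "\<dots> / ereal (real (n * k)) = ereal (r / real n) + ereal (s / real k)"
  proof -
    have "(real k * r + real n * s) / real (n * k) = r / real n + s / real k"
      using x(1) y(1) by (simp add: add_divide_distrib)
    then show ?thesis using x(1) y(1) by simp
  qed
  finally show ?thesis by (simp only: x(5) y(5))
qed

lemma ext_val_to_ac: "ext_val (to_ac x) = \<nu> x"
proof (cases "x = 0")
  case False
  then show ?thesis using ext_val_eq[of "to_ac x" 1 x] by (cases "\<nu> x") simp_all
qed simp

lemma integral_iff_ext_val: "integral x \<longleftrightarrow> 0 \<le> ext_val x"
proof (cases "x = 0")
  case False
  obtain n a r where x: "n > 0" "a \<noteq> 0" "int_unit (x ^ n / to_ac a)" "\<nu> a = ereal r" "ext_val x = ereal (r / real n)"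
    by (rule ext_val_real[OF False])
  show ?thesis
  proof
    assume "integral x"
    then have "integral (x ^ n * inverse (x ^ n / to_ac a))"
      using x by (intro integral_mult integral_power) (auto simp: int_unit_def)
    then have "integral (to_ac a)" using False x by simp
    then show "0 \<le> ext_val x" using x by (simp add: integral_to_ac_iff)
  next
    assume "0 \<le> ext_val x"
    then have "integral (to_ac a)" using x by (simp add: integral_to_ac_iff zero_le_divide_iff)
    then have xn: "integral (x ^ n)"
      using integral_mult[of "x ^ n / to_ac a" "to_ac a"] x by (simp add: int_unit_def)
    show "integral x"
    proof (rule ccontr)
      assume ni: "\<not> integral x"
      then have "integral (inverse x)" using integral_dichotomy by blast
      then have "integral (x ^ n * inverse x ^ (n - 1))" by (intro integral_mult integral_power xn)
      moreover have "x ^ n * inverse x ^ (n - 1) = x"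
        using False x(1) by (cases n) (simp_all add: field_simps)
      ultimately show False using ni by simp
    qed
  qed
qed simp

lemma valued_field_ext_val: "valued_field ext_val"
proof
  show "ext_val x \<noteq> - \<infinity>" for x
    by (rule ext_val_not_MInfty)
  show "ext_val x = \<infinity> \<longleftrightarrow> x = 0" for x
  proof (cases "x = 0")
    case False
    then obtain r where "ext_val x = ereal r" using ext_val_finite by blast
    then show ?thesis using False by simp
  qed simp
  show "ext_val (x * y) = ext_val x + ext_val y" for x y by (rule ext_val_mult)
  have *: "ext_val x \<le> ext_val (x + y)" if le: "ext_val x \<le> ext_val y" for x y
  proof (cases "x = 0")
    case True
    then show ?thesis using le by simp
  next
    case False
    have "0 \<le> ext_val (y / x)"
    proof (cases "y = 0")
      case y: False
      obtain r where r: "ext_val x = ereal r" using ext_val_finite[OF False] by blast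
      obtain s where s: "ext_val (y / x) = ereal s" using ext_val_finite[of "y / x"] False y by auto
      have "ext_val y = ext_val (y / x) + ext_val x" using ext_val_mult[of "y / x" x] False by simp
      then show ?thesis using le r s by simp
    qed simp
    then have "0 \<le> ext_val (1 + y / x)" using integral_1_add by (simp flip: integral_iff_ext_val)
    then have "ext_val x + 0 \<le> ext_val x + ext_val (1 + y / x)" by (intro add_mono) auto
    also have "\<dots> = ext_val (x * (1 + y / x))" by (rule ext_val_mult[symmetric])
    also have "x * (1 + y / x) = x + y" using False by (simp add: field_simps)
    finally show ?thesis by simp
  qed
  show "min (ext_val x) (ext_val y) \<le> ext_val (x + y)" for x y
    using *[of x y] *[of y x] by (cases "ext_val x \<le> ext_val y") (auto simp: min_def add.commute)
qed

text \<open>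
  An extension is nonnegative on integral elements, hence \<open>0\<close> on units, which determines it on
  the elements with a power associated to the base.
\<close>

lemma extended_valuation_eq: "extended_valuation \<nu> = ext_val"
  unfolding extended_valuation_def
proof (rule the_equality)
  show "valued_field ext_val \<and> (\<forall>x. ext_val (to_ac x) = \<nu> x)"
    using valued_field_ext_val ext_val_to_ac by blast
  fix w assume w: "valued_field w \<and> (\<forall>x. w (to_ac x) = \<nu> x)"
  interpret w: valued_field w using w by blast
  show "w = ext_val"
  proof
    fix x show "w x = ext_val x"
    proof (cases "x = 0")
      case False
      obtain n a r where x: "n > 0" "a \<noteq> 0" "int_unit (x ^ n / to_ac a)" "\<nu> a = ereal r" "ext_val x = ereal (r / real n)"
        by (rule ext_val_real[OF False])
      have "0 \<le> w (x ^ n / to_ac a)" "0 \<le> w (inverse (x ^ n / to_ac a))"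
        using x(3) w integral_imp_nonneg by (auto simp: int_unit_def)
      moreover obtain s where s: "w x = ereal s" using w.val_real[OF False] .
      ultimately have "real n * s = r" using x w False
        by (simp add: w.val_divide w.val_inverse w.val_power)
      then show ?thesis using x(1,5) s by (simp add: field_simps)
    qed simp
  qed
qed

text \<open>
  Integrality of an element depends on its annihilating polynomials only, hence so does its
  valuation. This is the invariance of the valuation under conjugation.
\<close>

lemma ext_val_conjugate_le:
  assumes conj: "\<And>R. poly (map_poly to_ac R) x = 0 \<Longrightarrow> poly (map_poly to_ac R) y = 0"
  shows "ext_val x \<le> ext_val y"
proof (cases "y = 0 \<or> x = 0")
  case True
  then show ?thesis using conj[of "[:0, 1:]"] by auto
next
  case False
  then have nz: "x \<noteq> 0" "y \<noteq> 0" by auto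
  interpret w: valued_field ext_val by (rule valued_field_ext_val)
  obtain n a r where x: "n > 0" "a \<noteq> 0" "int_unit (x ^ n / to_ac a)" "\<nu> a = ereal r" "ext_val x = ereal (r / real n)"
    by (rule ext_val_real[OF nz(1)])
  obtain P where P: "Polynomial.lead_coeff P = 1" "gauss_ge 0 P" "poly (map_poly to_ac P) (x ^ n / to_ac a) = 0"
    using x(3) by (auto simp: int_unit_def integral_def)
  define R where "R = pcompose P (Polynomial.monom (inverse a) n)"
  have R: "poly (map_poly to_ac R) z = poly (map_poly to_ac P) (z ^ n / to_ac a)" for z
    unfolding R_def by (subst to_ac.map_poly_pcompose)
      (simp add: poly_pcompose poly_monom map_poly_monom field_simps)
  have "poly (map_poly to_ac P) (y ^ n / to_ac a) = 0" using conj[of R] P(3) by (simp add: R)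
  then have "0 \<le> ext_val (y ^ n / to_ac a)" using P by (auto simp: integral_def simp flip: integral_iff_ext_val)
  moreover obtain s where s: "ext_val y = ereal s" by (rule w.val_real[OF nz(2)])
  ultimately have "r \<le> real n * s" using x by (simp add: w.val_divide w.val_power ext_val_to_ac)
  then show ?thesis using x s by (simp add: field_simps)
qed

text \<open>
  An element outside the base field has a second conjugate: otherwise its minimal polynomial
  would have a multiple root, which is impossible in characteristic \<open>0\<close>.
\<close>

lemma ex_conjugate:
  fixes x :: "'a alg_closure"
  assumes "x \<notin> range to_ac"
  obtains y where "y \<noteq> x" "\<And>R. poly (map_poly to_ac R) x = 0 \<Longrightarrow> poly (map_poly to_ac R) y = 0"
proof -
  define ann where "ann = (\<lambda>(P :: 'a poly) x. poly (map_poly to_ac P) x = 0)"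
  define d where "d = (LEAST d. \<exists>P. P \<noteq> 0 \<and> ann P x \<and> Polynomial.degree P = d)"
  have "\<exists>d P. P \<noteq> 0 \<and> ann P x \<and> Polynomial.degree P = d"
    unfolding ann_def by (rule alg_closure_algebraic[of x]) blast
  from LeastI_ex[OF this] obtain P where P: "P \<noteq> 0" "ann P x" "Polynomial.degree P = d" by (auto simp: d_def)
  have min: "d \<le> Polynomial.degree R" if "R \<noteq> 0" "ann R x" for R
    unfolding d_def using that by (intro Least_le) blast
  have dvd: "P dvd R" if "ann R x" for R
  proof -
    have "R mod P = R - P * (R div P)" by (simp add: minus_mult_div_eq_mod)
    then have "ann (R mod P) x" using that P by (simp add: ann_def hom_distribs)
    then have "R mod P = 0" using min[of "R mod P"] degree_mod_less[OF P(1), of R] P by fastforce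
    then show ?thesis by blast
  qed
  define P' where "P' = map_poly to_ac P"
  have P': "P' \<noteq> 0" "poly P' x = 0" "Polynomial.degree P' = d" using P by (auto simp: P'_def ann_def)
  then obtain Q where Q: "P' = [:-x, 1:] * Q" by (metis poly_eq_0_iff_dvd dvdE)
  have "Q \<noteq> 0" using Q P'(1) by auto
  then have "Polynomial.degree P' = Polynomial.degree [:-x, 1:] + Polynomial.degree Q"
    unfolding Q by (intro degree_mult_eq) simp_all
  then have degQ: "d = Suc (Polynomial.degree Q)" using P'(3) by simp
  have "Polynomial.degree Q \<noteq> 0"
  proof
    assume "Polynomial.degree Q = 0"
    then have "Polynomial.degree P = 1" using degQ P by simp
    then obtain a b where ab: "P = [:a, b:]" "b \<noteq> 0"
      by (metis One_nat_def degree1_coeffs)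
    then have "to_ac a + to_ac b * x = 0" using P by (simp add: ann_def algebra_simps)
    then have "x = to_ac (- a / b)" using ab by (simp add: field_simps eq_neg_iff_add_eq_0)
    then show False using assms by blast
  qed
  then obtain y where y: "poly Q y = 0" using alg_closed_imp_poly_has_root[of Q] by auto
  have "poly Q x \<noteq> 0"
  proof
    assume Qx: "poly Q x = 0"
    have "poly (pderiv P') x = 0" unfolding Q pderiv_mult by (simp add: pderiv_pCons Qx)
    moreover have "pderiv P' = map_poly to_ac (pderiv P)"
      by (rule poly_eqI) (simp add: P'_def coeff_pderiv)
    ultimately have "ann (pderiv P) x" by (simp add: ann_def)
    moreover have "pderiv P \<noteq> 0" using P degQ by (auto simp: pderiv_eq_0_iff)
    ultimately show False using min[of "pderiv P"] degQ P by (simp add: degree_pderiv)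
  qed
  then have "y \<noteq> x" using y by auto
  have "ann P y" using y Q by (simp add: ann_def P'_def)
  have 1: "ann R y" if "ann R x" for R
    using dvd[OF that] \<open>ann P y\<close> by (auto simp: ann_def hom_distribs elim!: dvdE)
  show ?thesis using that[OF \<open>y \<noteq> x\<close>] 1 unfolding ann_def by blast
qed

end

section \<open>Teichmueller representatives\<close>

lemma freshman_identity:
  fixes x y :: "'a::comm_ring_1"
  assumes "prime p"
  shows "(x + y) ^ p = x ^ p + y ^ p +
    of_nat p * (\<Sum>k\<in>{1..<p}. of_nat ((p choose k) div p) * (x ^ k * y ^ (p - k)))"
proof -
  have p: "p > 0" using assms prime_gt_0_nat by simp
  have "{..p} = insert 0 (insert p {1..<p})" using p by auto
  then have "(x + y) ^ p = y ^ p + x ^ p + (\<Sum>k\<in>{1..<p}. of_nat (p choose k) * x ^ k * y ^ (p - k))"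
    using p by (simp add: binomial_ring)
  also have "(\<Sum>k\<in>{1..<p}. of_nat (p choose k) * x ^ k * y ^ (p - k))
    = (\<Sum>k\<in>{1..<p}. of_nat p * (of_nat ((p choose k) div p) * (x ^ k * y ^ (p - k))))"
  proof (rule sum.cong)
    fix k assume "k \<in> {1..<p}"
    then have "(p choose k) = p * ((p choose k) div p)" using dvd_choose_prime[of k p] assms by simp
    then have "(of_nat (p choose k) :: 'a) = of_nat p * of_nat ((p choose k) div p)"
      by (metis of_nat_mult)
    then show "of_nat (p choose k) * x ^ k * y ^ (p - k) = of_nat p * (of_nat ((p choose k) div p) * (x ^ k * y ^ (p - k)))"
      by (simp only: mult.assoc)
  qed simp
  finally show ?thesis by (simp only: sum_distrib_left add.commute)
qed

context mixed_char_cdvf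
begin

lemma val_p_mult: "ereal c \<le> \<nu> x \<Longrightarrow> ereal (c + 1) \<le> \<nu> (of_nat p * x)"
  using ge_mult[of 1 "of_nat p" c x] by (simp add: add.commute one_ereal_def)

lemma val_diff_power:
  assumes "0 \<le> \<nu> x" "0 \<le> \<nu> y" "c \<le> \<nu> (x - y)" shows "c \<le> \<nu> (x ^ k - y ^ k)"
proof (induction k)
  case (Suc k)
  have "x ^ Suc k - y ^ Suc k = (x - y) * x ^ k + (x ^ k - y ^ k) * y" by (simp add: algebra_simps)
  then show ?case using Suc assms ge_add ge_mult_int int_power by metis
qed simp

lemma val_diff_sum: "(\<And>i. i \<in> I \<Longrightarrow> c \<le> \<nu> (f i - g i)) \<Longrightarrow> c \<le> \<nu> (sum f I - sum g I)"
  unfolding sum_subtractf[symmetric] by (rule ge_sum)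

lemma val_diff_mult:
  assumes "0 \<le> \<nu> x'" "0 \<le> \<nu> y" "c \<le> \<nu> (x - x')" "c \<le> \<nu> (y - y')" shows "c \<le> \<nu> (x * y - x' * y')"
proof -
  have "x * y - x' * y' = (x - x') * y + x' * (y - y')" by (simp add: algebra_simps)
  then show ?thesis using assms ge_add ge_mult_int ge_mult_int' by metis
qed

lemma int_if_close: "0 \<le> \<nu> x \<Longrightarrow> 0 \<le> \<nu> (x - y) \<Longrightarrow> 0 \<le> \<nu> y"
  using ge_diff[of 0 x "x - y"] by simp

text \<open>
  The second factor of \<open>x\<^sup>p - y\<^sup>p = (x - y) \<Sum> x\<^sup>i
  y\<^sup>p\<^sup>-\<^sup>1\<^sup>-\<^sup>i\<close> is congruent to \<open>p
  y\<^sup>p\<^sup>-\<^sup>1\<close>, so it lies in the maximal ideal.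
\<close>

lemma frobenius_contracts:
  assumes x: "0 \<le> \<nu> x" and y: "0 \<le> \<nu> y" and c: "1 / real e \<le> c" "ereal c \<le> \<nu> (x - y)"
  shows "ereal (c + 1 / real e) \<le> \<nu> (x ^ p - y ^ p)"
proof -
  have "x ^ p - y ^ p = (x - y) * (\<Sum>i<p. y ^ (p - Suc i) * x ^ i)" by (rule power_diff_sumr2)
  moreover have "ereal (1 / real e) \<le> \<nu> (\<Sum>i<p. y ^ (p - Suc i) * x ^ i)"
  proof -
    have "ereal (1 / real e) \<le> \<nu> ((\<Sum>i<p. y ^ (p - Suc i) * x ^ i) - (\<Sum>i<p. y ^ (p - Suc i) * y ^ i))"
    proof (rule val_diff_sum)
      fix i
      have "ereal (1 / real e) \<le> \<nu> (x - y)" using c by (meson ereal_less_eq(3) order_trans)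
      then have "ereal (1 / real e) \<le> \<nu> (y ^ (p - Suc i) * (x ^ i - y ^ i))"
        using val_diff_power[OF x y] ge_mult_int'[OF int_power[OF y]] by blast
      then show "ereal (1 / real e) \<le> \<nu> (y ^ (p - Suc i) * x ^ i - y ^ (p - Suc i) * y ^ i)"
        by (simp add: algebra_simps)
    qed
    moreover have "(\<Sum>i<p. y ^ (p - Suc i) * y ^ i) = of_nat p * y ^ (p - 1)"
      by (simp flip: power_add)
    moreover have "ereal (1 / real e) \<le> \<nu> (of_nat p * y ^ (p - 1))"
    proof -
      have "ereal (1 / real e) \<le> ereal (0 + 1)" using e_pos by simp
      also have "\<dots> \<le> \<nu> (of_nat p * y ^ (p - 1))"
        using int_power[OF y] by (intro val_p_mult) (simp flip: zero_ereal_def)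
      finally show ?thesis .
    qed
    ultimately show ?thesis using ge_add by (metis diff_add_cancel)
  qed
  ultimately show ?thesis using ge_mult[OF c(2)] by simp
qed

lemma frobenius_power_contracts:
  assumes x: "0 \<le> \<nu> x" and y: "0 \<le> \<nu> y" and c: "0 < \<nu> (x - y)"
  shows "ereal (real (Suc i) / real e) \<le> \<nu> (x ^ (p ^ i) - y ^ (p ^ i))"
proof (induction i)
  case 0
  then show ?case using pos_imp_ge[OF c] by simp
next
  case (Suc i)
  have "ereal (real (Suc i) / real e + 1 / real e) \<le> \<nu> ((x ^ (p ^ i)) ^ p - (y ^ (p ^ i)) ^ p)"
    using Suc by (intro frobenius_contracts int_power x y) (simp_all add: divide_right_mono)
  then show ?case by (simp add: add_divide_distrib mult.commute flip: power_mult)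
qed

lemma frobenius_additive:
  assumes "0 \<le> \<nu> x" "0 \<le> \<nu> y" shows "1 \<le> \<nu> ((x + y) ^ p - (x ^ p + y ^ p))"
proof -
  have "ereal (0 + 1) \<le> \<nu> (of_nat p * (\<Sum>k\<in>{1..<p}. of_nat ((p choose k) div p) * (x ^ k * y ^ (p - k))))"
    unfolding zero_ereal_def[symmetric]
    by (intro val_p_mult) (auto intro!: ge_sum int_mult int_of_nat int_power assms simp flip: zero_ereal_def)
  then show ?thesis by (simp add: freshman_identity[OF prime] one_ereal_def)
qed

lemma frobenius_injective:
  assumes x: "0 \<le> \<nu> x" and y: "0 \<le> \<nu> y" and c: "0 < \<nu> (x ^ p - y ^ p)"
  shows "0 < \<nu> (x - y)"
proof -
  have "1 \<le> \<nu> ((y + (x - y)) ^ p - (y ^ p + (x - y) ^ p))"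
    by (intro frobenius_additive y ge_diff x)
  then have "0 < \<nu> (x ^ p - (y ^ p + (x - y) ^ p))" by (simp add: less_le_trans[of 0 1])
  then have "0 < \<nu> ((x ^ p - y ^ p) - (x ^ p - (y ^ p + (x - y) ^ p)))" by (rule gt_diff[OF c])
  then have "0 < \<nu> ((x - y) ^ p)" by simp
  then have "0 < ereal (real p) * \<nu> (x - y)" by (simp add: val_power)
  then show ?thesis using p_pos by (simp add: ereal_zero_less_0_iff)
qed

lemma frobenius_power_injective:
  assumes x: "0 \<le> \<nu> x" and y: "0 \<le> \<nu> y" and c: "0 < \<nu> (x ^ (p ^ i) - y ^ (p ^ i))"
  shows "0 < \<nu> (x - y)"
  using c
proof (induction i)
  case (Suc i)
  then have "0 < \<nu> ((x ^ (p ^ i)) ^ p - (y ^ (p ^ i)) ^ p)" by (simp add: mult.commute flip: power_mult)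
  then show ?case using Suc.IH frobenius_injective int_power x y by blast
qed simp

lemma frobenius_power_additive:
  assumes "0 \<le> \<nu> x" "0 \<le> \<nu> y" shows "0 < \<nu> ((x + y) ^ (p ^ i) - (x ^ (p ^ i) + y ^ (p ^ i)))"
proof (induction i)
  case (Suc i)
  define a b where "a = x ^ (p ^ i)" and "b = y ^ (p ^ i)"
  have ab: "0 \<le> \<nu> a" "0 \<le> \<nu> b" unfolding a_def b_def by (intro int_power assms)+
  have "0 < \<nu> (((x + y) ^ (p ^ i)) ^ p - (a + b) ^ p)"
  proof -
    have "ereal (1 / real e) \<le> \<nu> ((x + y) ^ (p ^ i) - (a + b))"
      using Suc pos_imp_ge by (simp add: a_def b_def)
    then have "ereal (1 / real e) \<le> \<nu> (((x + y) ^ (p ^ i)) ^ p - (a + b) ^ p)"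
      by (intro val_diff_power int_power ge_add assms ab)
    then show ?thesis using e_pos by (intro ge_imp_pos[of "1 / real e"]) auto
  qed
  moreover have "0 < \<nu> ((a + b) ^ p - (a ^ p + b ^ p))"
    using frobenius_additive[OF ab] by (simp add: less_le_trans[of 0 1])
  ultimately have "0 < \<nu> (((x + y) ^ (p ^ i)) ^ p - (a ^ p + b ^ p))" by (rule gt_trans)
  then show ?case by (simp add: a_def b_def mult.commute flip: power_mult)
qed simp

text \<open>
  The Teichmueller elements, described without the residue field: the integral elements that have
  \<open>p\<^sup>i\<close>-th roots for all \<open>i\<close>. For a perfect residue field this is the image of \<^const>\<open>teichmuller\<close>.
\<close>

definition teich :: "'a set" where
  "teich = {x. \<forall>i. \<exists>y. 0 \<le> \<nu> y \<and> y ^ (p ^ i) = x}"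

lemma teich_int: "t \<in> teich \<Longrightarrow> 0 \<le> \<nu> t"
  unfolding teich_def by (auto dest: spec[of _ 0])

lemma eq_0_if_val_ge_all:
  assumes "\<And>i::nat. ereal (real i / real e) \<le> \<nu> x" shows "x = 0"
proof (rule eq_0_if_val_unbounded)
  fix N :: nat show "ereal (real N) \<le> \<nu> x" using assms[of "N * e"] e_pos by simp
qed

text \<open>
  The \<open>p\<^sup>i\<close>-th roots of \<open>s\<close> and \<open>t\<close> are congruent too, and
  taking the \<open>p\<^sup>i\<close>-th power again improves the congruence \<open>i\<close> times.
\<close>

lemma teich_unique:
  assumes "s \<in> teich" "t \<in> teich" "0 < \<nu> (s - t)" shows "s = t"
proof -
  have "s - t = 0"
  proof (rule eq_0_if_val_ge_all)
    fix i
    obtain x y where x: "0 \<le> \<nu> x" "x ^ (p ^ i) = s" and y: "0 \<le> \<nu> y" "y ^ (p ^ i) = t"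
      using assms(1,2) unfolding teich_def by blast
    have "0 < \<nu> (x - y)" using frobenius_power_injective[OF x(1) y(1)] assms(3) x y by auto
    then have "ereal (real (Suc i) / real e) \<le> \<nu> (s - t)" using frobenius_power_contracts x y by metis
    moreover have "ereal (real i / real e) \<le> ereal (real (Suc i) / real e)" by (simp add: divide_right_mono)
    ultimately show "ereal (real i / real e) \<le> \<nu> (s - t)" by (rule order_trans[rotated])
  qed
  then show ?thesis by simp
qed

lemma teich_0 [simp]: "0 \<in> teich" and teich_1 [simp]: "1 \<in> teich"
  using p_pos unfolding teich_def by (auto intro: exI[of _ 0] exI[of _ 1])

lemma teich_mult: "s \<in> teich \<Longrightarrow> t \<in> teich \<Longrightarrow> s * t \<in> teich"
  unfolding teich_def by (auto, metis int_mult power_mult_distrib)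

lemma teich_power: "t \<in> teich \<Longrightarrow> t ^ k \<in> teich"
  by (induction k) (auto intro: teich_mult)

lemma teich_unit: assumes "t \<in> teich" "t \<noteq> 0" shows "\<nu> t = 0"
  using teich_unique[OF assms(1) teich_0] teich_int[OF assms(1)] assms(2) by fastforce

end

locale perfect_cdvf = mixed_char_cdvf +
  assumes perfect: "perfect_residue_field p \<nu>"
begin

text \<open>
  With lifts \<open>s\<^sub>i\<close> of the \<open>p\<^sup>i\<close>-th roots of the residue class of
  \<open>x\<close>, the sequences \<open>j \<mapsto> s\<^sub>i\<^sub>+\<^sub>j\<^bsup>p^j\<^esup>\<close>
  converge to elements \<open>t\<^sub>i\<close> such that \<open>t\<^sub>i\<^sub>+\<^sub>1\<^sup>p =
  t\<^sub>i\<close>.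
\<close>

lemma teich_exists:
  assumes x: "0 \<le> \<nu> x" obtains t where "t \<in> teich" "0 < \<nu> (x - t)"
proof -
  have "\<exists>s. \<forall>i. 0 \<le> \<nu> (s i) \<and> (i = 0 \<longrightarrow> s i = x) \<and> 0 < \<nu> (s (Suc i) ^ p - s i)"
  proof -
    have "\<exists>s. \<forall>i. (0 \<le> \<nu> (s i) \<and> (i = 0 \<longrightarrow> s i = x)) \<and> 0 < \<nu> (s (Suc i) ^ p - s i)"
    proof (rule dependent_nat_choice)
      fix y :: 'a and n :: nat assume "0 \<le> \<nu> y \<and> (n = 0 \<longrightarrow> y = x)"
      then show "\<exists>z. (0 \<le> \<nu> z \<and> (Suc n = 0 \<longrightarrow> z = x)) \<and> 0 < \<nu> (z ^ p - y)"
        using perfect_residue_fieldD[OF perfect] by simp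
    qed (use x in auto)
    then show ?thesis by simp
  qed
  then obtain s where "\<forall>i. 0 \<le> \<nu> (s i) \<and> (i = 0 \<longrightarrow> s i = x) \<and> 0 < \<nu> (s (Suc i) ^ p - s i)" ..
  note * = this[rule_format]
  have s: "s 0 = x" "0 \<le> \<nu> (s i)" "0 < \<nu> (s (Suc i) ^ p - s i)" for i
    subgoal by (rule *[of 0, THEN conjunct2, THEN conjunct1, rule_format, OF refl])
    subgoal by (rule *[of i, THEN conjunct1])
    subgoal by (rule *[of i, THEN conjunct2, THEN conjunct2])
    done
  have "\<exists>t. \<forall>j. ereal (real j * (1 / real e)) \<le> \<nu> (s (i + j) ^ (p ^ j) - t)" for i
  proof (rule complete_linear)
    fix j
    have "ereal (real (Suc j) / real e) \<le> \<nu> ((s (Suc (i + j)) ^ p) ^ (p ^ j) - s (i + j) ^ (p ^ j))"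
      by (intro frobenius_power_contracts int_power s)
    then have "ereal (real j * (1 / real e)) \<le> \<nu> ((s (Suc (i + j)) ^ p) ^ (p ^ j) - s (i + j) ^ (p ^ j))"
      by (rule order_trans[rotated]) (simp add: divide_right_mono)
    then show "ereal (real j * (1 / real e)) \<le> \<nu> (s (i + Suc j) ^ (p ^ Suc j) - s (i + j) ^ (p ^ j))"
      by (simp add: power_mult)
  qed (use e_pos in simp)
  then obtain t where t: "\<And>i j. ereal (real j / real e) \<le> \<nu> (s (i + j) ^ (p ^ j) - t i)" by (metis times_divide_eq_right mult.right_neutral)
  have tint: "0 \<le> \<nu> (t i)" for i
    using int_if_close[of "s i" "t i"] t[of 0 i] s by (simp flip: zero_ereal_def)
  have step: "t (Suc i) ^ p = t i" for i
  proof -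
    have "t (Suc i) ^ p - t i = 0"
    proof (rule eq_0_if_val_ge_all)
      fix j
      have "ereal (real j / real e) \<le> \<nu> (s (Suc i + j) ^ (p ^ j) - t (Suc i))" by (rule t)
      then have "ereal (real j / real e) \<le> \<nu> ((s (Suc i + j) ^ (p ^ j)) ^ p - t (Suc i) ^ p)"
        by (intro val_diff_power int_power s tint)
      then have 1: "ereal (real j / real e) \<le> \<nu> (t (Suc i) ^ p - s (i + Suc j) ^ (p ^ Suc j))"
        by (simp add: val_minus_commute mult.commute flip: power_mult)
      have "ereal (real j / real e) \<le> ereal (real (Suc j) / real e)" by (simp add: divide_right_mono)
      also have "\<dots> \<le> \<nu> (s (i + Suc j) ^ (p ^ Suc j) - t i)" by (rule t)
      finally show "ereal (real j / real e) \<le> \<nu> (t (Suc i) ^ p - t i)" using 1 ge_trans by blast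
    qed
    then show ?thesis by simp
  qed
  have "t i ^ (p ^ i) = t 0" for i
  proof (induction i)
    case (Suc i)
    then show ?case using step[of i] by (simp add: power_mult)
  qed simp
  then have "t 0 \<in> teich" using tint unfolding teich_def by blast
  moreover have "0 < \<nu> (x - t 0)"
  proof -
    have "0 < \<nu> (s 1 ^ p - t 0)" using t[of 1 0] e_pos by (intro ge_imp_pos[of "1 / real e"]) auto
    then show ?thesis using s(3)[of 0] s(1) gt_trans[of 0 x "s 1 ^ p" "t 0"] by (simp add: val_minus_commute)
  qed
  ultimately show ?thesis by (rule that)
qed

lemma teich_root_p:
  assumes "t \<in> teich" obtains s where "s \<in> teich" "s ^ p = t"
proof -
  have "\<exists>y. 0 \<le> \<nu> y \<and> y ^ (p ^ 1) = t" using assms unfolding teich_def by blast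
  then obtain y where y: "0 \<le> \<nu> y" "y ^ p = t" by auto
  obtain s where s: "s \<in> teich" "0 < \<nu> (y - s)" using teich_exists[OF y(1)] .
  have "ereal (1 / real e) \<le> \<nu> (y ^ p - s ^ p)"
    by (intro val_diff_power y teich_int s pos_imp_ge)
  then have "0 < \<nu> (t - s ^ p)" using y e_pos by (intro ge_imp_pos[of "1 / real e"]) auto
  then have "s ^ p = t" using teich_unique assms teich_power s by metis
  then show ?thesis using that s by blast
qed

lemma teich_root:
  assumes "t \<in> teich" obtains s where "s \<in> teich" "s ^ (p ^ i) = t"
proof -
  have "\<exists>s\<in>teich. s ^ (p ^ i) = t"
  proof (induction i)
    case (Suc i)
    then obtain s where "s \<in> teich" "s ^ (p ^ i) = t" by blast
    moreover then obtain r where "r \<in> teich" "r ^ p = s" using teich_root_p by blast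
    ultimately show ?case by (auto simp: power_mult)
  qed (use assms in simp)
  then show ?thesis using that by blast
qed

text \<open>
  The map that picks the element of \<^const>\<open>teich\<close> in a residue class is a multiplicative section. Conversely, the values of a
  multiplicative section have \<open>p\<^sup>i\<close>-th roots, since residue classes have them.
\<close>

lemma teichmuller_unique:
  assumes "0 \<le> \<nu> x" "t \<in> teich" "0 < \<nu> (t - x)"
  shows "teichmuller \<nu> (residue_class \<nu> x) = t"
proof -
  define F where "F = (\<lambda>a\<in>carrier (residue_field \<nu>). THE t. t \<in> teich \<and> t \<in> a)"
  have F: "F (residue_class \<nu> x) = t" if "0 \<le> \<nu> x" "t \<in> teich" "0 < \<nu> (t - x)" for x t
  proof -
    have "(THE t. t \<in> teich \<and> t \<in> residue_class \<nu> x) = t"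
    proof (rule the_equality)
      show "t \<in> teich \<and> t \<in> residue_class \<nu> x" using that by (simp add: residue_class_def)
      fix s assume "s \<in> teich \<and> s \<in> residue_class \<nu> x"
      then show "s = t" using that teich_unique[of s t] gt_trans[of 0 s x t]
        by (simp add: residue_class_def val_minus_commute)
    qed
    then show ?thesis using that by (auto simp: F_def carrier_residue_field)
  qed
  have "teichmuller \<nu> = F"
    unfolding teichmuller_def
  proof (rule the_equality)
    show "F \<in> extensional (carrier (residue_field \<nu>)) \<and> (\<forall>a\<in>carrier (residue_field \<nu>). F a \<in> a) \<and>
      (\<forall>a\<in>carrier (residue_field \<nu>). \<forall>b\<in>carrier (residue_field \<nu>). F (a \<otimes>\<^bsub>residue_field \<nu>\<^esub> b) = F a * F b)"
    proof (intro conjI ballI)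
      show "F \<in> extensional (carrier (residue_field \<nu>))" by (simp add: F_def)
      fix a assume "a \<in> carrier (residue_field \<nu>)"
      then obtain x where x: "a = residue_class \<nu> x" "0 \<le> \<nu> x" by (auto simp: carrier_residue_field)
      obtain s where s: "s \<in> teich" "0 < \<nu> (x - s)" using teich_exists[OF x(2)] .
      then have Fs: "F a = s" using F[OF x(2) s(1)] x by (simp add: val_minus_commute)
      then show "F a \<in> a" using s x by (simp add: residue_class_def val_minus_commute)
      fix b assume "b \<in> carrier (residue_field \<nu>)"
      then obtain y where y: "b = residue_class \<nu> y" "0 \<le> \<nu> y" by (auto simp: carrier_residue_field)
      obtain r where r: "r \<in> teich" "0 < \<nu> (y - r)" using teich_exists[OF y(2)] .
      then have Fr: "F b = r" using F[OF y(2) r(1)] y by (simp add: val_minus_commute)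
      have "0 < \<nu> (s * r - x * y)"
        using residue_class_mult_cong[OF x(2) y(2), of s r] s r by (simp add: val_minus_commute)
      then show "F (a \<otimes>\<^bsub>residue_field \<nu>\<^esub> b) = F a * F b"
        using F[of "x * y" "s * r"] s r x y Fs Fr by (simp add: residue_class_mult int_mult teich_mult)
    qed
  next
    fix f assume f: "f \<in> extensional (carrier (residue_field \<nu>)) \<and> (\<forall>a\<in>carrier (residue_field \<nu>). f a \<in> a) \<and>
      (\<forall>a\<in>carrier (residue_field \<nu>). \<forall>b\<in>carrier (residue_field \<nu>). f (a \<otimes>\<^bsub>residue_field \<nu>\<^esub> b) = f a * f b)"
    show "f = F"
    proof (rule extensionalityI)
      show "f \<in> extensional (carrier (residue_field \<nu>))" "F \<in> extensional (carrier (residue_field \<nu>))"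
        using f by (auto simp: F_def)
      fix a assume "a \<in> carrier (residue_field \<nu>)"
      then obtain x where x: "a = residue_class \<nu> x" "0 \<le> \<nu> x" by (auto simp: carrier_residue_field)
      have cl: "f (residue_class \<nu> y) \<in> residue_class \<nu> y" if "0 \<le> \<nu> y" for y
        using f that by (simp add: carrier_residue_field)
      have mul: "f (residue_class \<nu> (y * z)) = f (residue_class \<nu> y) * f (residue_class \<nu> z)"
        if "0 \<le> \<nu> y" "0 \<le> \<nu> z" for y z
        using f that by (simp add: carrier_residue_field flip: residue_class_mult)
      have int: "0 \<le> \<nu> (f (residue_class \<nu> y))" if "0 \<le> \<nu> y" for y
        using cl[OF that] that ge_add[of 0 y "f (residue_class \<nu> y) - y"] by (simp add: residue_class_def)
      have pow: "f (residue_class \<nu> (y ^ Suc k)) = f (residue_class \<nu> y) ^ Suc k" if "0 \<le> \<nu> y" for y k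
        by (induction k) (use that in \<open>simp_all add: mul int_power int_mult\<close>)
      obtain s where s: "s \<in> teich" "0 < \<nu> (x - s)" using teich_exists[OF x(2)] .
      have as: "a = residue_class \<nu> s" using x s by (simp add: residue_class_eq_iff)
      have "f a \<in> teich" unfolding teich_def
      proof (intro CollectI allI)
        fix i
        obtain r where r: "r \<in> teich" "r ^ (p ^ i) = s" using teich_root[OF s(1)] .
        have "f a = f (residue_class \<nu> r) ^ (p ^ i)"
          using pow[OF teich_int[OF r(1)], of "p ^ i - 1"] p_pos as r by simp
        then show "\<exists>y. 0 \<le> \<nu> y \<and> y ^ (p ^ i) = f a" using int teich_int[OF r(1)] by metis
      qed
      then show "f a = F a" using F[OF x(2), of "f a"] cl[OF x(2)] x by (simp add: residue_class_def)
    qed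
  qed
  then show ?thesis using F assms by simp
qed

lemma residue_root_class:
  assumes "t \<in> teich" shows "residue_root p \<nu> i (residue_class \<nu> (t ^ (p ^ i))) = residue_class \<nu> t"
  unfolding residue_root_def
proof (rule the_equality)
  show "residue_class \<nu> t \<in> carrier (residue_field \<nu>) \<and>
    residue_class \<nu> t [^]\<^bsub>residue_field \<nu>\<^esub> (p ^ i) = residue_class \<nu> (t ^ (p ^ i))"
    using teich_int[OF assms] by (auto simp: carrier_residue_field residue_class_power)
  fix b assume b: "b \<in> carrier (residue_field \<nu>) \<and> b [^]\<^bsub>residue_field \<nu>\<^esub> (p ^ i) = residue_class \<nu> (t ^ (p ^ i))"
  then obtain y where y: "b = residue_class \<nu> y" "0 \<le> \<nu> y" by (auto simp: carrier_residue_field)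
  then have "0 < \<nu> (y ^ (p ^ i) - t ^ (p ^ i))" using b by (simp add: residue_class_power residue_class_eq_iff)
  then show "b = residue_class \<nu> t"
    using frobenius_power_injective y teich_int[OF assms] by (simp add: residue_class_eq_iff)
qed

lemma teichmuller_residue_root_range:
  "(\<lambda>a. teichmuller \<nu> (residue_root p \<nu> i a)) ` carrier (residue_field \<nu>) = teich"
proof (intro equalityI subsetI)
  fix t assume t: "t \<in> teich"
  have "teichmuller \<nu> (residue_root p \<nu> i (residue_class \<nu> (t ^ (p ^ i)))) = t"
    using t teichmuller_unique[of t t] by (simp add: residue_root_class teich_int)
  then show "t \<in> (\<lambda>a. teichmuller \<nu> (residue_root p \<nu> i a)) ` carrier (residue_field \<nu>)"
    unfolding carrier_residue_field using teich_int[OF t]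
    by (intro image_eqI[of _ _ "residue_class \<nu> (t ^ (p ^ i))"] imageI) (auto simp: int_power)
next
  fix t assume "t \<in> (\<lambda>a. teichmuller \<nu> (residue_root p \<nu> i a)) ` carrier (residue_field \<nu>)"
  then obtain x where x: "0 \<le> \<nu> x" "t = teichmuller \<nu> (residue_root p \<nu> i (residue_class \<nu> x))"
    by (auto simp: carrier_residue_field)
  obtain s where s: "s \<in> teich" "0 < \<nu> (x - s)" using teich_exists[OF x(1)] .
  obtain r where r: "r \<in> teich" "r ^ (p ^ i) = s" using teich_root[OF s(1)] .
  have "residue_class \<nu> x = residue_class \<nu> (r ^ (p ^ i))" using s r by (simp add: residue_class_eq_iff)
  then have "t = teichmuller \<nu> (residue_root p \<nu> i (residue_class \<nu> (r ^ (p ^ i))))" using x(2) by simp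
  also have "\<dots> = r" unfolding residue_root_class[OF r(1)]
    using r(1) teich_int by (intro teichmuller_unique) auto
  finally have "t = r" .
  then show "t \<in> teich" using r by simp
qed

lemma witt_ring_eq:
  "witt_ring p \<nu> = {x. \<exists>t. (\<forall>i. t i \<in> teich) \<and> val_converges \<nu> (\<lambda>N. \<Sum>i<N. of_nat p ^ i * t i) x}"
proof (intro equalityI subsetI)
  fix x assume "x \<in> witt_ring p \<nu>"
  then obtain a where a: "\<And>i. a i \<in> carrier (residue_field \<nu>)"
    "val_converges \<nu> (\<lambda>N. \<Sum>i<N. of_nat p ^ i * teichmuller \<nu> (residue_root p \<nu> i (a i))) x"
    by (auto simp: witt_ring_def)
  have "teichmuller \<nu> (residue_root p \<nu> i (a i)) \<in> teich" for i
    using a(1)[of i] teichmuller_residue_root_range[of i] by blast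
  then show "x \<in> {x. \<exists>t. (\<forall>i. t i \<in> teich) \<and> val_converges \<nu> (\<lambda>N. \<Sum>i<N. of_nat p ^ i * t i) x}"
    using a(2) by (intro CollectI exI[of _ "\<lambda>i. teichmuller \<nu> (residue_root p \<nu> i (a i))"] conjI allI)
next
  fix x assume "x \<in> {x. \<exists>t. (\<forall>i. t i \<in> teich) \<and> val_converges \<nu> (\<lambda>N. \<Sum>i<N. of_nat p ^ i * t i) x}"
  then obtain t where t: "\<And>i. t i \<in> teich" "val_converges \<nu> (\<lambda>N. \<Sum>i<N. of_nat p ^ i * t i) x" by blast
  have "\<exists>a. a \<in> carrier (residue_field \<nu>) \<and> teichmuller \<nu> (residue_root p \<nu> i a) = t i" for i
  proof -
    have "t i \<in> (\<lambda>a. teichmuller \<nu> (residue_root p \<nu> i a)) ` carrier (residue_field \<nu>)"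
      unfolding teichmuller_residue_root_range by (rule t)
    then obtain a where "t i = teichmuller \<nu> (residue_root p \<nu> i a)" "a \<in> carrier (residue_field \<nu>)"
      by (rule imageE)
    then show ?thesis by (intro exI[of _ a]) simp
  qed
  note ex = this
  define a where "a = (\<lambda>i. SOME a. a \<in> carrier (residue_field \<nu>) \<and> teichmuller \<nu> (residue_root p \<nu> i a) = t i)"
  have ai: "a i \<in> carrier (residue_field \<nu>) \<and> teichmuller \<nu> (residue_root p \<nu> i (a i)) = t i" for i
    using someI_ex[OF ex[of i]] unfolding a_def .
  have "(\<lambda>N. \<Sum>i<N. of_nat p ^ i * t i) =
      (\<lambda>N. \<Sum>i<N. of_nat p ^ i * teichmuller \<nu> (residue_root p \<nu> i (a i)))"
    using ai by presburger
  then have "val_converges \<nu> (\<lambda>N. \<Sum>i<N. of_nat p ^ i * teichmuller \<nu> (residue_root p \<nu> i (a i))) x"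
    using t(2) by metis
  then show "x \<in> witt_ring p \<nu>" unfolding witt_ring_def
    by (intro CollectI exI[of _ a] conjI allI) (rule ai[THEN conjunct1])
qed

end

section \<open>Functoriality of the Witt ring\<close>

context mixed_char_cdvf
begin

lemma val_p_cancel:
  assumes "ereal (c + 1) \<le> \<nu> (of_nat p * x)" shows "ereal c \<le> \<nu> x"
proof (cases "x = 0")
  case False
  then obtain r where "\<nu> x = ereal r" by (rule val_real)
  then show ?thesis using assms by (simp add: mult one_ereal_def)
qed simp

lemma p_neq_0 [simp]: "p \<noteq> 0" using p_pos by simp

end

text \<open>
  A map of Teichmueller elements that induces a homomorphism of residue fields. The ring homomorphism of
  Witt rings that belongs to it is constructed through its graph, a subring of the product of the two fields. The diagonal
  case, where \<open>\<kappa>\<close> is the identity of one field, shows that the Witt ring is a ring.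
\<close>

locale witt_pair = K1: perfect_cdvf \<nu>\<^sub>1 p + K2: perfect_cdvf \<nu>\<^sub>2 p
  for \<nu>\<^sub>1 :: "'a::field_char_0 \<Rightarrow> ereal" and \<nu>\<^sub>2 :: "'b::field_char_0 \<Rightarrow> ereal" and p :: nat +
  fixes \<kappa> :: "'a \<Rightarrow> 'b"
  assumes \<kappa>_teich: "t \<in> K1.teich \<Longrightarrow> \<kappa> t \<in> K2.teich"
    and \<kappa>_mult: "s \<in> K1.teich \<Longrightarrow> t \<in> K1.teich \<Longrightarrow> \<kappa> (s * t) = \<kappa> s * \<kappa> t"
    and \<kappa>_0: "\<kappa> 0 = 0" and \<kappa>_1: "\<kappa> 1 = 1"
    and \<kappa>_add: "s \<in> K1.teich \<Longrightarrow> t \<in> K1.teich \<Longrightarrow> u \<in> K1.teich \<Longrightarrow> 0 < \<nu>\<^sub>1 (s + t - u) \<Longrightarrow>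
      0 < \<nu>\<^sub>2 (\<kappa> s + \<kappa> t - \<kappa> u)"
begin

lemma \<kappa>_power: "t \<in> K1.teich \<Longrightarrow> \<kappa> (t ^ k) = \<kappa> t ^ k"
  by (induction k) (simp_all add: \<kappa>_1 \<kappa>_mult K1.teich_power)

inductive span :: "'a \<Rightarrow> 'b \<Rightarrow> bool" where
  zero: "span 0 0"
| plus: "span x y \<Longrightarrow> t \<in> K1.teich \<Longrightarrow> span (x + t) (y + \<kappa> t)"
| minus: "span x y \<Longrightarrow> t \<in> K1.teich \<Longrightarrow> span (x - t) (y - \<kappa> t)"

lemma span_add: "span x' y' \<Longrightarrow> span x y \<Longrightarrow> span (x + x') (y + y')"
proof (induction rule: span.induct)
  case (plus x' y' t)
  then show ?case using span.plus[of "x + x'" "y + y'" t] by (simp add: add.assoc)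
next
  case (minus x' y' t)
  then show ?case using span.minus[of "x + x'" "y + y'" t] by (simp add: add_diff_eq)
qed simp

lemma span_uminus: "span x y \<Longrightarrow> span (- x) (- y)"
proof (induction rule: span.induct)
  case (plus x y t)
  then show ?case using span.minus[of "- x" "- y" t] by simp
next
  case (minus x y t)
  then show ?case using span.plus[of "- x" "- y" t] by simp
qed (simp add: span.zero)

lemma span_teich: "t \<in> K1.teich \<Longrightarrow> span t (\<kappa> t)"
  using span.plus[OF span.zero] by simp

lemma span_mult_teich:
  assumes "t \<in> K1.teich" shows "span x y \<Longrightarrow> span (x * t) (y * \<kappa> t)"
proof (induction rule: span.induct)
  case (plus x y s)
  then show ?case using span.plus[of "x * t" "y * \<kappa> t" "s * t"] assms
    by (simp add: distrib_right \<kappa>_mult K1.teich_mult)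
next
  case (minus x y s)
  then show ?case using span.minus[of "x * t" "y * \<kappa> t" "s * t"] assms
    by (simp add: left_diff_distrib \<kappa>_mult K1.teich_mult)
qed (simp add: span.zero)

lemma span_mult: "span x' y' \<Longrightarrow> span x y \<Longrightarrow> span (x * x') (y * y')"
proof (induction rule: span.induct)
  case (plus x' y' t)
  then show ?case using span_add[of "x * t" "y * \<kappa> t" "x * x'" "y * y'"] span_mult_teich
    by (simp add: distrib_left)
next
  case (minus x' y' t)
  then show ?case using span_add[of "- (x * t)" "- (y * \<kappa> t)" "x * x'" "y * y'"] span_mult_teich span_uminus
    by (simp add: right_diff_distrib)
qed (simp add: span.zero)

lemma span_1: "span 1 1" using span_teich[OF K1.teich_1] by (simp add: \<kappa>_1)

lemma span_of_nat: "span (of_nat k) (of_nat k)"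
  by (induction k) (auto intro: span_add span_1 span.zero)

lemma span_power: "span x y \<Longrightarrow> span (x ^ k) (y ^ k)"
  by (induction k) (auto intro: span_mult span_1)

lemma span_sum: "(\<And>i. i \<in> I \<Longrightarrow> span (f i) (g i)) \<Longrightarrow> span (sum f I) (sum g I)"
  by (induction I rule: infinite_finite_induct) (auto intro: span_add span.zero)

lemma span_int: "span x y \<Longrightarrow> 0 \<le> \<nu>\<^sub>1 x \<and> 0 \<le> \<nu>\<^sub>2 y"
  by (induction rule: span.induct)
    (auto intro: K1.ge_add K1.ge_diff K2.ge_add K2.ge_diff K1.teich_int K2.teich_int \<kappa>_teich)

lemma span_freshman:
  assumes "span a a'" "span b b'"
  shows "\<exists>z z'. span z z' \<and> (a + b) ^ p = a ^ p + b ^ p + of_nat p * z \<and>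
    (a' + b') ^ p = a' ^ p + b' ^ p + of_nat p * z'"
proof (intro exI conjI)
  show "(a + b) ^ p = a ^ p + b ^ p +
    of_nat p * (\<Sum>k\<in>{1..<p}. of_nat ((p choose k) div p) * (a ^ k * b ^ (p - k)))"
    "(a' + b') ^ p = a' ^ p + b' ^ p +
    of_nat p * (\<Sum>k\<in>{1..<p}. of_nat ((p choose k) div p) * (a' ^ k * b' ^ (p - k)))"
    by (rule freshman_identity[OF K1.prime])+
  show "span (\<Sum>k\<in>{1..<p}. of_nat ((p choose k) div p) * (a ^ k * b ^ (p - k)))
    (\<Sum>k\<in>{1..<p}. of_nat ((p choose k) div p) * (a' ^ k * b' ^ (p - k)))"
    by (intro span_sum span_mult span_of_nat span_power assms)
qed

lemma span_freshman_power:
  assumes "s \<in> K1.teich" "t \<in> K1.teich"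
  shows "\<exists>z z'. span z z' \<and> (s + t) ^ (p ^ N) = s ^ (p ^ N) + t ^ (p ^ N) + of_nat p * z \<and>
    (\<kappa> s + \<kappa> t) ^ (p ^ N) = \<kappa> s ^ (p ^ N) + \<kappa> t ^ (p ^ N) + of_nat p * z'"
proof (induction N)
  case 0
  show ?case using span.zero by (intro exI[of _ 0]) simp
next
  case (Suc N)
  then obtain z z' where z: "span z z'" "(s + t) ^ (p ^ N) = s ^ (p ^ N) + t ^ (p ^ N) + of_nat p * z"
    "(\<kappa> s + \<kappa> t) ^ (p ^ N) = \<kappa> s ^ (p ^ N) + \<kappa> t ^ (p ^ N) + of_nat p * z'" by blast
  define a b a' b' where "a = s ^ (p ^ N)" and "b = t ^ (p ^ N)" and "a' = \<kappa> s ^ (p ^ N)" and "b' = \<kappa> t ^ (p ^ N)"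
  have sp: "span a a'" "span b b'" "span (of_nat p * z) (of_nat p * z')"
    unfolding a_def b_def a'_def b'_def by (intro span_power span_teich assms span_mult span_of_nat z)+
  obtain u u' where u: "span u u'" "(a + b) ^ p = a ^ p + b ^ p + of_nat p * u"
    "(a' + b') ^ p = a' ^ p + b' ^ p + of_nat p * u'" using span_freshman[OF sp(1,2)] by blast
  obtain v v' where v: "span v v'" "(a + b + of_nat p * z) ^ p = (a + b) ^ p + (of_nat p * z) ^ p + of_nat p * v"
    "(a' + b' + of_nat p * z') ^ p = (a' + b') ^ p + (of_nat p * z') ^ p + of_nat p * v'"
    using span_freshman[OF span_add[OF sp(2,1)] sp(3)] by blast
  have pp: "(of_nat p * w) ^ p = of_nat p * (of_nat p ^ (p - 1) * w ^ p)" for w :: "'c::field"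
    using K1.p_pos by (cases p) (simp_all add: power_mult_distrib)
  have "span (u + of_nat p ^ (p - 1) * z ^ p + v) (u' + of_nat p ^ (p - 1) * z' ^ p + v')"
    by (intro span_add span_mult span_power span_of_nat z u v)
  moreover have "(s + t) ^ (p ^ Suc N) = s ^ (p ^ Suc N) + t ^ (p ^ Suc N) + of_nat p * (u + of_nat p ^ (p - 1) * z ^ p + v)"
  proof -
    have "(s + t) ^ (p ^ Suc N) = (a + b + of_nat p * z) ^ p"
      unfolding a_def b_def z(2)[symmetric] by (simp add: mult.commute flip: power_mult)
    also have "\<dots> = a ^ p + b ^ p + of_nat p * (u + of_nat p ^ (p - 1) * z ^ p + v)"
      unfolding v u pp by (simp add: distrib_left add_ac)
    finally show ?thesis by (simp add: a_def b_def mult.commute flip: power_mult)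
  qed
  moreover have "(\<kappa> s + \<kappa> t) ^ (p ^ Suc N) = \<kappa> s ^ (p ^ Suc N) + \<kappa> t ^ (p ^ Suc N) + of_nat p * (u' + of_nat p ^ (p - 1) * z' ^ p + v')"
  proof -
    have "(\<kappa> s + \<kappa> t) ^ (p ^ Suc N) = (a' + b' + of_nat p * z') ^ p"
      unfolding a'_def b'_def z(3)[symmetric] by (simp add: mult.commute flip: power_mult)
    also have "\<dots> = a' ^ p + b' ^ p + of_nat p * (u' + of_nat p ^ (p - 1) * z' ^ p + v')"
      unfolding v u pp by (simp add: distrib_left add_ac)
    finally show ?thesis by (simp add: a'_def b'_def mult.commute flip: power_mult)
  qed
  ultimately show ?case by blast
qed

text \<open>The closure of \<^const>\<open>span\<close> in the product of the two fields.\<close>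

definition graph :: "'a \<Rightarrow> 'b \<Rightarrow> bool" where
  "graph x y \<longleftrightarrow> (\<forall>C::nat. \<exists>x' y'. span x' y' \<and> ereal (real C) \<le> \<nu>\<^sub>1 (x - x') \<and> ereal (real C) \<le> \<nu>\<^sub>2 (y - y'))"

lemma graphE:
  assumes "graph x y"
  obtains x' y' where "span x' y'" "ereal (real C) \<le> \<nu>\<^sub>1 (x - x')" "ereal (real C) \<le> \<nu>\<^sub>2 (y - y')"
  using assms unfolding graph_def by blast

lemma graph_if_span: "span x y \<Longrightarrow> graph x y"
  unfolding graph_def by (intro allI exI[of _ x] exI[of _ y]) simp

lemma graph_int:
  assumes "graph x y" shows "0 \<le> \<nu>\<^sub>1 x" "0 \<le> \<nu>\<^sub>2 y"
proof -
  obtain x' y' where "span x' y'" "ereal (real 0) \<le> \<nu>\<^sub>1 (x - x')" "ereal (real 0) \<le> \<nu>\<^sub>2 (y - y')"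
    using graphE[OF assms] .
  then show "0 \<le> \<nu>\<^sub>1 x" "0 \<le> \<nu>\<^sub>2 y"
    using span_int[of x' y'] K1.ge_add[of 0 "x - x'" x'] K2.ge_add[of 0 "y - y'" y']
    by (simp_all flip: zero_ereal_def)
qed

lemma graph_closed:
  assumes "\<And>C::nat. \<exists>x' y'. graph x' y' \<and> ereal (real C) \<le> \<nu>\<^sub>1 (x - x') \<and> ereal (real C) \<le> \<nu>\<^sub>2 (y - y')"
  shows "graph x y"
  unfolding graph_def
proof
  fix C :: nat
  obtain x' y' where x': "graph x' y'" "ereal (real C) \<le> \<nu>\<^sub>1 (x - x')" "ereal (real C) \<le> \<nu>\<^sub>2 (y - y')"
    using assms by blast
  obtain x'' y'' where x'': "span x'' y''" "ereal (real C) \<le> \<nu>\<^sub>1 (x' - x'')" "ereal (real C) \<le> \<nu>\<^sub>2 (y' - y'')"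
    using graphE[OF x'(1)] .
  show "\<exists>x' y'. span x' y' \<and> ereal (real C) \<le> \<nu>\<^sub>1 (x - x') \<and> ereal (real C) \<le> \<nu>\<^sub>2 (y - y')"
    using x''(1) K1.ge_trans[OF x'(2) x''(2)] K2.ge_trans[OF x'(3) x''(3)] by blast
qed

lemma graph_add:
  assumes "graph x y" "graph a b" shows "graph (x + a) (y + b)"
  unfolding graph_def
proof
  fix C :: nat
  obtain x' y' where x': "span x' y'" "ereal (real C) \<le> \<nu>\<^sub>1 (x - x')" "ereal (real C) \<le> \<nu>\<^sub>2 (y - y')"
    using graphE[OF assms(1)] .
  obtain a' b' where a': "span a' b'" "ereal (real C) \<le> \<nu>\<^sub>1 (a - a')" "ereal (real C) \<le> \<nu>\<^sub>2 (b - b')"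
    using graphE[OF assms(2)] .
  have "ereal (real C) \<le> \<nu>\<^sub>1 ((x + a) - (x' + a'))" "ereal (real C) \<le> \<nu>\<^sub>2 ((y + b) - (y' + b'))"
    using K1.ge_add[OF x'(2) a'(2)] K2.ge_add[OF x'(3) a'(3)] by (simp_all add: add_diff_add)
  then show "\<exists>x' y'. span x' y' \<and> ereal (real C) \<le> \<nu>\<^sub>1 (x + a - x') \<and> ereal (real C) \<le> \<nu>\<^sub>2 (y + b - y')"
    using span_add[OF a'(1) x'(1)] by blast
qed

lemma graph_mult:
  assumes "graph x y" "graph a b" shows "graph (x * a) (y * b)"
  unfolding graph_def
proof
  fix C :: nat
  obtain x' y' where x': "span x' y'" "ereal (real C) \<le> \<nu>\<^sub>1 (x - x')" "ereal (real C) \<le> \<nu>\<^sub>2 (y - y')"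
    using graphE[OF assms(1)] .
  obtain a' b' where a': "span a' b'" "ereal (real C) \<le> \<nu>\<^sub>1 (a - a')" "ereal (real C) \<le> \<nu>\<^sub>2 (b - b')"
    using graphE[OF assms(2)] .
  have "ereal (real C) \<le> \<nu>\<^sub>1 (x * a - x' * a')" "ereal (real C) \<le> \<nu>\<^sub>2 (y * b - y' * b')"
    using span_int[OF x'(1)] graph_int[OF assms(2)] x' a' by (auto intro: K1.val_diff_mult K2.val_diff_mult)
  then show "\<exists>x' y'. span x' y' \<and> ereal (real C) \<le> \<nu>\<^sub>1 (x * a - x') \<and> ereal (real C) \<le> \<nu>\<^sub>2 (y * b - y')"
    using span_mult[OF a'(1) x'(1)] by blast
qed

lemma graph_of_nat: "graph (of_nat k) (of_nat k)"
  by (rule graph_if_span[OF span_of_nat])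

lemma graph_0: "graph 0 0" and graph_1: "graph 1 1"
  using graph_of_nat[of 0] graph_of_nat[of 1] by simp_all

lemma graph_uminus:
  assumes "graph x y" shows "graph (- x) (- y)"
  using graph_mult[OF graph_if_span[OF span_uminus[OF span_1]] assms] by simp

lemma graph_diff: "graph x y \<Longrightarrow> graph a b \<Longrightarrow> graph (x - a) (y - b)"
  using graph_add[of x y "- a" "- b"] graph_uminus by simp

lemma graph_teich: "t \<in> K1.teich \<Longrightarrow> graph t (\<kappa> t)"
  by (rule graph_if_span[OF span_teich])

lemma graph_power: "graph x y \<Longrightarrow> graph (x ^ k) (y ^ k)"
  by (induction k) (auto intro: graph_mult graph_1)

text \<open>
  The Witt vector addition law to first order. With \<open>q = p\<^sup>N\<close> and \<open>q\<close>-th roots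
  \<open>s', t', u'\<close> of \<open>s, t, u\<close>, the binomial theorem gives
  \<open>(s' + t')\<^sup>q = s + t + p z\<close> with \<open>z\<close> an integral combination of Teichmueller elements. The left
  hand side tends to \<open>u = u'\<^sup>q\<close> for large \<open>N\<close>, because \<open>s' + t'\<close> and \<open>u'\<close> have the same residue. The coefficients of
  \<open>z\<close> are the same in both fields, so \<open>- z\<close> converges to a pair in the graph.
\<close>

lemma graph_teich_add:
  assumes s: "s \<in> K1.teich" and t: "t \<in> K1.teich" and u: "u \<in> K1.teich" and res: "0 < \<nu>\<^sub>1 (s + t - u)"
  obtains x y where "graph x y" "s + t = u + of_nat p * x" "\<kappa> s + \<kappa> t = \<kappa> u + of_nat p * y"
proof -
  define x where "x = (s + t - u) / of_nat p"
  define y where "y = (\<kappa> s + \<kappa> t - \<kappa> u) / of_nat p"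
  have "graph x y" unfolding graph_def
  proof
    fix C :: nat
    \<comment> \<open>large enough for \<open>N/e \<ge> C + 1\<close> in both fields; one unit is lost in the division by \<open>p\<close>\<close>
    define N where "N = (C + 1) * (K1.e * K2.e)"
    obtain s' where s': "s' \<in> K1.teich" "s' ^ (p ^ N) = s" using K1.teich_root[OF s] .
    obtain t' where t': "t' \<in> K1.teich" "t' ^ (p ^ N) = t" using K1.teich_root[OF t] .
    obtain u' where u': "u' \<in> K1.teich" "u' ^ (p ^ N) = u" using K1.teich_root[OF u] .
    note int = K1.teich_int[OF s'(1)] K1.teich_int[OF t'(1)] K1.teich_int[OF u'(1)]
    note int' = K2.teich_int[OF \<kappa>_teich[OF s'(1)]] K2.teich_int[OF \<kappa>_teich[OF t'(1)]] K2.teich_int[OF \<kappa>_teich[OF u'(1)]]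
    have "0 < \<nu>\<^sub>1 ((s' + t') ^ (p ^ N) - (s + t))"
      using K1.frobenius_power_additive[OF int(1,2), of N] s' t' by simp
    then have "0 < \<nu>\<^sub>1 ((s' + t') ^ (p ^ N) - u' ^ (p ^ N))"
      using K1.gt_trans[of 0 "(s' + t') ^ (p ^ N)" "s + t" u] res u'(2) by simp
    then have 1: "0 < \<nu>\<^sub>1 (s' + t' - u')"
      by (rule K1.frobenius_power_injective[OF K1.ge_add[OF int(1,2)] int(3)])
    then have 2: "0 < \<nu>\<^sub>2 (\<kappa> s' + \<kappa> t' - \<kappa> u')" using \<kappa>_add s' t' u' by blast
    obtain z z' where z: "span z z'" "(s' + t') ^ (p ^ N) = s' ^ (p ^ N) + t' ^ (p ^ N) + of_nat p * z"
      "(\<kappa> s' + \<kappa> t') ^ (p ^ N) = \<kappa> s' ^ (p ^ N) + \<kappa> t' ^ (p ^ N) + of_nat p * z'"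
      using span_freshman_power[OF s'(1) t'(1)] by blast
    have N: "real C + 1 \<le> real (Suc N) / real K1.e" "real C + 1 \<le> real (Suc N) / real K2.e"
    proof -
      have "K1.e \<le> K1.e * K2.e" "K2.e \<le> K1.e * K2.e" using K1.e_pos K2.e_pos by auto
      then have "(C + 1) * K1.e \<le> N" "(C + 1) * K2.e \<le> N"
        unfolding N_def using mult_le_mono2 by blast+
      then have "(C + 1) * K1.e \<le> Suc N" "(C + 1) * K2.e \<le> Suc N"
        using le_SucI by blast+
      then have "real ((C + 1) * K1.e) \<le> real (Suc N)" "real ((C + 1) * K2.e) \<le> real (Suc N)"
        by (simp_all only: of_nat_le_iff)
      then show "real C + 1 \<le> real (Suc N) / real K1.e" "real C + 1 \<le> real (Suc N) / real K2.e"
        using K1.e_pos K2.e_pos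
        by (simp_all only: pos_le_divide_eq of_nat_0_less_iff of_nat_mult of_nat_add of_nat_1)
    qed
    have "ereal (real C + 1) \<le> ereal (real (Suc N) / real K1.e)" using N by simp
    also have "\<dots> \<le> \<nu>\<^sub>1 ((s' + t') ^ (p ^ N) - u' ^ (p ^ N))"
      by (intro K1.frobenius_power_contracts K1.ge_add int 1)
    also have "(s' + t') ^ (p ^ N) - u' ^ (p ^ N) = of_nat p * (x - (- z))"
      unfolding z(2) by (simp add: s' t' u' x_def distrib_left)
    finally have A: "ereal (real C) \<le> \<nu>\<^sub>1 (x - (- z))" by (rule K1.val_p_cancel)
    have "ereal (real C + 1) \<le> ereal (real (Suc N) / real K2.e)" using N by simp
    also have "\<dots> \<le> \<nu>\<^sub>2 ((\<kappa> s' + \<kappa> t') ^ (p ^ N) - \<kappa> u' ^ (p ^ N))"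
      by (intro K2.frobenius_power_contracts K2.ge_add int' 2)
    also have "(\<kappa> s' + \<kappa> t') ^ (p ^ N) - \<kappa> u' ^ (p ^ N) = of_nat p * (y - (- z'))"
      unfolding z(3) using s' t' u' by (simp add: y_def distrib_left flip: \<kappa>_power)
    finally have B: "ereal (real C) \<le> \<nu>\<^sub>2 (y - (- z'))" by (rule K2.val_p_cancel)
    show "\<exists>x' y'. span x' y' \<and> ereal (real C) \<le> \<nu>\<^sub>1 (x - x') \<and> ereal (real C) \<le> \<nu>\<^sub>2 (y - y')"
      using span_uminus[OF z(1)] A B by blast
  qed
  then show ?thesis by (rule that) (use K1.p_pos in \<open>simp_all add: x_def y_def\<close>)
qed

lemma span_decompose:
  "span x y \<Longrightarrow> \<exists>t x' y'. t \<in> K1.teich \<and> graph x' y' \<and> x = t + of_nat p * x' \<and> y = \<kappa> t + of_nat p * y'"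
proof (induction rule: span.induct)
  case zero
  show ?case by (rule exI[of _ 0], rule exI[of _ 0], rule exI[of _ 0]) (simp add: graph_0 \<kappa>_0)
next
  case (plus x y s)
  then obtain t x' y' where t: "t \<in> K1.teich" "graph x' y'" "x = t + of_nat p * x'" "y = \<kappa> t + of_nat p * y'" by blast
  obtain u where u: "u \<in> K1.teich" "0 < \<nu>\<^sub>1 (s + t - u)"
    using K1.teich_exists[OF K1.ge_add[OF K1.teich_int[OF plus(2)] K1.teich_int[OF t(1)]]] by blast
  obtain a b where a: "graph a b" "s + t = u + of_nat p * a" "\<kappa> s + \<kappa> t = \<kappa> u + of_nat p * b"
    using graph_teich_add[OF plus(2) t(1) u] .
  have "x + s = u + of_nat p * (a + x')" "y + \<kappa> s = \<kappa> u + of_nat p * (b + y')"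
    using a t by (simp_all add: distrib_left add.assoc[symmetric]) (simp_all add: add_ac)
  then show ?case using u graph_add[OF a(1) t(2)] by blast
next
  case (minus x y s)
  then obtain t x' y' where t: "t \<in> K1.teich" "graph x' y'" "x = t + of_nat p * x'" "y = \<kappa> t + of_nat p * y'" by blast
  obtain u where u: "u \<in> K1.teich" "0 < \<nu>\<^sub>1 (t - s - u)"
    using K1.teich_exists[OF K1.ge_diff[OF K1.teich_int[OF t(1)] K1.teich_int[OF minus(2)]]] by blast
  have "0 < \<nu>\<^sub>1 (u + s - t)" using u K1.val_minus_commute[of "u + s" t] by (simp add: algebra_simps)
  then obtain a b where a: "graph a b" "u + s = t + of_nat p * a" "\<kappa> u + \<kappa> s = \<kappa> t + of_nat p * b"
    using graph_teich_add[OF u(1) minus(2) t(1)] by blast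
  have "x - s = u + of_nat p * (x' - a)" "y - \<kappa> s = \<kappa> u + of_nat p * (y' - b)"
    using a(2,3) t(3,4) by (simp_all add: right_diff_distrib) (simp_all add: algebra_simps)
  then show ?case using u graph_diff[OF t(2) a(1)] by blast
qed

lemma graph_decompose:
  assumes "graph x y" "t \<in> K1.teich" "0 < \<nu>\<^sub>1 (x - t)"
  obtains x' y' where "graph x' y'" "x = t + of_nat p * x'" "y = \<kappa> t + of_nat p * y'"
proof -
  define x' where "x' = (x - t) / of_nat p"
  define y' where "y' = (y - \<kappa> t) / of_nat p"
  have "graph x' y'"
  proof (rule graph_closed)
    fix C :: nat
    obtain a b where a: "span a b" "ereal (real (C + 1)) \<le> \<nu>\<^sub>1 (x - a)" "ereal (real (C + 1)) \<le> \<nu>\<^sub>2 (y - b)"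
      using graphE[OF assms(1)] .
    obtain s a' b' where s: "s \<in> K1.teich" "graph a' b'" "a = s + of_nat p * a'" "b = \<kappa> s + of_nat p * b'"
      using span_decompose[OF a(1)] by blast
    have "0 < \<nu>\<^sub>1 (of_nat p * a')"
      using K1.gt_mult_int[of 0 "of_nat p" a'] graph_int[OF s(2)] by simp
    then have "0 < \<nu>\<^sub>1 (a - s)" using s by simp
    moreover have "0 < \<nu>\<^sub>1 (x - a)" using a(2) by (intro K1.ge_imp_pos[of "real (C + 1)"]) auto
    ultimately have "0 < \<nu>\<^sub>1 (x - s)" using K1.gt_trans by blast
    then have "0 < \<nu>\<^sub>1 (t - s)" using assms(3) K1.gt_trans[of 0 t x s] by (simp add: K1.val_minus_commute)
    then have "t = s" using K1.teich_unique assms(2) s(1) by blast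
    have "of_nat p * x' = x - t" "of_nat p * y' = y - \<kappa> t"
      using K1.p_pos by (simp_all add: x'_def y'_def)
    then have "of_nat p * (x' - a') = x - a" "of_nat p * (y' - b') = y - b"
      unfolding right_diff_distrib by (simp_all add: \<open>t = s\<close> s(3,4))
    then have "ereal (real C + 1) \<le> \<nu>\<^sub>1 (of_nat p * (x' - a'))" "ereal (real C + 1) \<le> \<nu>\<^sub>2 (of_nat p * (y' - b'))"
      using a(2,3) by (simp_all add: add.commute)
    then have "ereal (real C) \<le> \<nu>\<^sub>1 (x' - a')" "ereal (real C) \<le> \<nu>\<^sub>2 (y' - b')"
      using K1.val_p_cancel K2.val_p_cancel by blast+
    then show "\<exists>x'' y''. graph x'' y'' \<and> ereal (real C) \<le> \<nu>\<^sub>1 (x' - x'') \<and> ereal (real C) \<le> \<nu>\<^sub>2 (y' - y'')"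
      using s(2) by blast
  qed
  then show ?thesis by (rule that) (use K1.p_pos in \<open>simp_all add: x'_def y'_def\<close>)
qed

text \<open>
  A pair \<open>(0, y)\<close> in the graph is \<open>p\<close> times a pair of the same form, so
  \<open>y\<close> is divisible by all powers of \<open>p\<close>.
\<close>

lemma graph_zero: assumes "graph 0 y" shows "y = 0"
proof -
  have "\<exists>y'. graph 0 y' \<and> y = of_nat p ^ N * y'" for N
  proof (induction N)
    case (Suc N)
    then obtain y' where y': "graph 0 y'" "y = of_nat p ^ N * y'" by blast
    obtain x'' y'' where x'': "graph x'' y''" "0 = 0 + of_nat p * x''" "y' = \<kappa> 0 + of_nat p * y''"
      by (rule graph_decompose[OF y'(1) K1.teich_0]) simp_all
    then have "x'' = 0" by simp
    then show ?case using x'' y' by (auto simp: \<kappa>_0 mult.assoc)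
  qed (use assms in simp)
  then have "ereal (real N) \<le> \<nu>\<^sub>2 y" for N
  proof -
    obtain y' where "graph 0 y'" "y = of_nat p ^ N * y'" using \<open>\<exists>y'. graph 0 y' \<and> y = of_nat p ^ N * y'\<close> by blast
    then show ?thesis using K2.ge_mult_int[of "ereal (real N)" "of_nat p ^ N" y'] graph_int(2)[of 0 y']
      by (simp add: K2.val_p_power)
  qed
  then show ?thesis by (rule K2.eq_0_if_val_unbounded)
qed

lemma graph_unique: "graph x y \<Longrightarrow> graph x z \<Longrightarrow> y = z"
  using graph_diff[of x y x z] graph_zero[of "y - z"] by simp

lemma graph_sum: "(\<And>i. i \<in> I \<Longrightarrow> graph (f i) (g i)) \<Longrightarrow> graph (sum f I) (sum g I)"
  by (induction I rule: infinite_finite_induct) (auto intro: graph_add graph_0)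

lemma graph_expansion:
  assumes "graph x y"
  obtains t where "\<And>i. t i \<in> K1.teich"
    "\<And>N. \<exists>x' y'. graph x' y' \<and> x = (\<Sum>i<N. of_nat p ^ i * t i) + of_nat p ^ N * x'
        \<and> y = (\<Sum>i<N. of_nat p ^ i * \<kappa> (t i)) + of_nat p ^ N * y'"
proof -
  have "\<exists>f. \<forall>n. (case f n of (a, b) \<Rightarrow> graph a b \<and> (n = 0 \<longrightarrow> a = x \<and> b = y)) \<and>
    (case f n of (a, b) \<Rightarrow> case f (Suc n) of (a', b') \<Rightarrow>
      \<exists>t. t \<in> K1.teich \<and> a = t + of_nat p * a' \<and> b = \<kappa> t + of_nat p * b')"
  proof (rule dependent_nat_choice)
    show "\<exists>f. case f of (a, b) \<Rightarrow> graph a b \<and> (0 = (0::nat) \<longrightarrow> a = x \<and> b = y)" using assms by auto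
    fix f :: "'a \<times> 'b" and n :: nat
    assume "case f of (a, b) \<Rightarrow> graph a b \<and> (n = 0 \<longrightarrow> a = x \<and> b = y)"
    then obtain a b where ab: "f = (a, b)" "graph a b" by auto
    obtain t where t: "t \<in> K1.teich" "0 < \<nu>\<^sub>1 (a - t)" using K1.teich_exists[OF graph_int(1)[OF ab(2)]] .
    obtain a' b' where "graph a' b'" "a = t + of_nat p * a'" "b = \<kappa> t + of_nat p * b'"
      using graph_decompose[OF ab(2) t] .
    then show "\<exists>g. (case g of (a, b) \<Rightarrow> graph a b \<and> (Suc n = 0 \<longrightarrow> a = x \<and> b = y)) \<and>
      (case f of (a, b) \<Rightarrow> case g of (a', b') \<Rightarrow>
      \<exists>t. t \<in> K1.teich \<and> a = t + of_nat p * a' \<and> b = \<kappa> t + of_nat p * b')"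
      using t ab by (intro exI[of _ "(a', b')"]) auto
  qed
  then obtain f where f: "\<And>n. (case f n of (a, b) \<Rightarrow> graph a b \<and> (n = 0 \<longrightarrow> a = x \<and> b = y)) \<and>
    (case f n of (a, b) \<Rightarrow> case f (Suc n) of (a', b') \<Rightarrow>
      \<exists>t. t \<in> K1.teich \<and> a = t + of_nat p * a' \<and> b = \<kappa> t + of_nat p * b')" by blast
  define a b where "a = (\<lambda>n. fst (f n))" and "b = (\<lambda>n. snd (f n))"
  have g: "graph (a n) (b n)" and init: "a 0 = x" "b 0 = y" for n
    using f[of n] f[of 0] by (auto simp: a_def b_def split: prod.splits)
  have "\<exists>t. t \<in> K1.teich \<and> a n = t + of_nat p * a (Suc n) \<and> b n = \<kappa> t + of_nat p * b (Suc n)" for n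
    using f[of n] by (auto simp: a_def b_def split: prod.splits)
  then obtain t where t: "\<And>n. t n \<in> K1.teich" "\<And>n. a n = t n + of_nat p * a (Suc n)"
    "\<And>n. b n = \<kappa> (t n) + of_nat p * b (Suc n)" by metis
  have "x = (\<Sum>i<N. of_nat p ^ i * t i) + of_nat p ^ N * a N
        \<and> y = (\<Sum>i<N. of_nat p ^ i * \<kappa> (t i)) + of_nat p ^ N * b N" for N
  proof (induction N)
    case (Suc N)
    then show ?case using t(2)[of N] t(3)[of N] by (simp add: distrib_left mult_ac add_ac)
  qed (simp add: init)
  then show ?thesis using that[of t] t(1) g by blast
qed

lemma witt_series_converges:
  assumes "\<And>i. t i \<in> K1.teich"
  obtains x y where "graph x y" "val_converges \<nu>\<^sub>1 (\<lambda>N. \<Sum>i<N. of_nat p ^ i * t i) x"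
proof -
  have val1: "ereal (real N * 1) \<le> \<nu>\<^sub>1 ((\<Sum>i<Suc N. of_nat p ^ i * t i) - (\<Sum>i<N. of_nat p ^ i * t i))" for N
    using K1.ge_mult_int[of "ereal (real N)" "of_nat p ^ N" "t N"] K1.teich_int[OF assms]
    by (simp add: K1.val_p_power)
  have val2: "ereal (real N * 1) \<le> \<nu>\<^sub>2 ((\<Sum>i<Suc N. of_nat p ^ i * \<kappa> (t i)) - (\<Sum>i<N. of_nat p ^ i * \<kappa> (t i)))" for N
    using K2.ge_mult_int[of "ereal (real N)" "of_nat p ^ N" "\<kappa> (t N)"] K2.teich_int[OF \<kappa>_teich[OF assms]]
    by (simp add: K2.val_p_power)
  have "\<exists>x. \<forall>N. ereal (real N * 1) \<le> \<nu>\<^sub>1 ((\<Sum>i<N. of_nat p ^ i * t i) - x)"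
    by (rule K1.complete_linear[where \<delta> = 1, OF zero_less_one_class.zero_less_one]) (rule val1)
  then obtain x where x: "\<And>N. ereal (real N * 1) \<le> \<nu>\<^sub>1 ((\<Sum>i<N. of_nat p ^ i * t i) - x)" by blast
  have "\<exists>y. \<forall>N. ereal (real N * 1) \<le> \<nu>\<^sub>2 ((\<Sum>i<N. of_nat p ^ i * \<kappa> (t i)) - y)"
    by (rule K2.complete_linear[where \<delta> = 1, OF zero_less_one_class.zero_less_one]) (rule val2)
  then obtain y where y: "\<And>N. ereal (real N * 1) \<le> \<nu>\<^sub>2 ((\<Sum>i<N. of_nat p ^ i * \<kappa> (t i)) - y)" by blast
  have "graph x y"
  proof (rule graph_closed)
    fix C :: nat
    have "graph (\<Sum>i<C. of_nat p ^ i * t i) (\<Sum>i<C. of_nat p ^ i * \<kappa> (t i))"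
      by (intro graph_sum graph_mult graph_power graph_of_nat graph_teich assms)
    then show "\<exists>x' y'. graph x' y' \<and> ereal (real C) \<le> \<nu>\<^sub>1 (x - x') \<and> ereal (real C) \<le> \<nu>\<^sub>2 (y - y')"
      using x[of C] y[of C] by (intro exI conjI) (auto simp: K1.val_minus_commute K2.val_minus_commute)
  qed
  moreover have "val_converges \<nu>\<^sub>1 (\<lambda>N. \<Sum>i<N. of_nat p ^ i * t i) x"
    by (rule K1.val_converges_linear[where \<delta> = 1, OF zero_less_one_class.zero_less_one x])
  ultimately show ?thesis by (rule that)
qed

text \<open>
  Repeated decomposition expands an element of the domain as \<open>\<Sum>i. p\<^sup>i t\<^sub>i\<close>;
  conversely such a series converges in both fields.
\<close>

lemma domain_graph: "{x. \<exists>y. graph x y} = witt_ring p \<nu>\<^sub>1"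
proof (intro equalityI subsetI)
  fix x assume "x \<in> {x. \<exists>y. graph x y}"
  then obtain y where "graph x y" by blast
  then obtain t where t: "\<And>i. t i \<in> K1.teich"
    "\<And>N. \<exists>x' y'. graph x' y' \<and> x = (\<Sum>i<N. of_nat p ^ i * t i) + of_nat p ^ N * x'
        \<and> y = (\<Sum>i<N. of_nat p ^ i * \<kappa> (t i)) + of_nat p ^ N * y'" by (rule graph_expansion) blast
  have "val_converges \<nu>\<^sub>1 (\<lambda>N. \<Sum>i<N. of_nat p ^ i * t i) x"
  proof (rule K1.val_converges_linear[where \<delta> = 1, OF zero_less_one_class.zero_less_one])
    fix N
    obtain x' y' where x': "graph x' y'" "x = (\<Sum>i<N. of_nat p ^ i * t i) + of_nat p ^ N * x'" using t(2) by blast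
    have "(\<Sum>i<N. of_nat p ^ i * t i) - x = - (of_nat p ^ N * x')" by (subst x'(2)) simp
    then show "ereal (real N * 1) \<le> \<nu>\<^sub>1 ((\<Sum>i<N. of_nat p ^ i * t i) - x)"
      using K1.ge_mult_int[of "ereal (real N)" "of_nat p ^ N" x'] graph_int(1)[OF x'(1)]
      by (simp add: K1.val_p_power)
  qed
  then show "x \<in> witt_ring p \<nu>\<^sub>1" using t(1) unfolding K1.witt_ring_eq by blast
next
  fix x assume "x \<in> witt_ring p \<nu>\<^sub>1"
  then obtain t where t: "\<And>i. t i \<in> K1.teich" "val_converges \<nu>\<^sub>1 (\<lambda>N. \<Sum>i<N. of_nat p ^ i * t i) x"
    unfolding K1.witt_ring_eq by blast
  obtain x' y where "graph x' y" "val_converges \<nu>\<^sub>1 (\<lambda>N. \<Sum>i<N. of_nat p ^ i * t i) x'"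
    using witt_series_converges[OF t(1)] .
  then show "x \<in> {x. \<exists>y. graph x y}" using K1.val_converges_unique[OF t(2)] by blast
qed

definition witt_map :: "'a \<Rightarrow> 'b" where "witt_map x = (THE y. graph x y)"

lemma witt_map_eq: "graph x y \<Longrightarrow> witt_map x = y"
  unfolding witt_map_def using graph_unique by blast

lemma graph_witt_map: "x \<in> witt_ring p \<nu>\<^sub>1 \<Longrightarrow> graph x (witt_map x)"
  unfolding domain_graph[symmetric] using witt_map_eq by blast

lemma witt_map_add: "x \<in> witt_ring p \<nu>\<^sub>1 \<Longrightarrow> y \<in> witt_ring p \<nu>\<^sub>1 \<Longrightarrow> witt_map (x + y) = witt_map x + witt_map y"
  by (intro witt_map_eq graph_add graph_witt_map)

lemma witt_map_mult: "x \<in> witt_ring p \<nu>\<^sub>1 \<Longrightarrow> y \<in> witt_ring p \<nu>\<^sub>1 \<Longrightarrow> witt_map (x * y) = witt_map x * witt_map y"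
  by (intro witt_map_eq graph_mult graph_witt_map)

lemma witt_map_1: "witt_map 1 = 1" by (rule witt_map_eq[OF graph_1])

lemma witt_map_int: "x \<in> witt_ring p \<nu>\<^sub>1 \<Longrightarrow> 0 \<le> \<nu>\<^sub>2 (witt_map x)"
  using graph_witt_map graph_int(2) by blast

lemma witt_map_teich: "t \<in> K1.teich \<Longrightarrow> witt_map t = \<kappa> t"
  by (rule witt_map_eq[OF graph_teich])

end

context perfect_cdvf
begin

interpretation self: witt_pair \<nu> \<nu> p "\<lambda>x. x"
  by unfold_locales auto

lemma self_graph: assumes "self.graph x y" shows "x = y"
proof -
  have sp: "x = y" if "self.span x y" for x y using that by induction simp_all
  have "self.graph x x" unfolding self.graph_def
  proof
    fix C :: nat
    obtain a b where ab: "self.span a b" "ereal (real C) \<le> \<nu> (x - a)" using self.graphE[OF assms] by blast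
    then show "\<exists>x' y'. self.span x' y' \<and> ereal (real C) \<le> \<nu> (x - x') \<and> ereal (real C) \<le> \<nu> (x - y')"
      using sp[OF ab(1)] by blast
  qed
  then show ?thesis using assms self.graph_unique by blast
qed

lemma witt_ring_iff: "x \<in> witt_ring p \<nu> \<longleftrightarrow> self.graph x x"
  unfolding self.domain_graph[symmetric] using self_graph by blast

lemma witt_add: "x \<in> witt_ring p \<nu> \<Longrightarrow> y \<in> witt_ring p \<nu> \<Longrightarrow> x + y \<in> witt_ring p \<nu>"
  and witt_diff: "x \<in> witt_ring p \<nu> \<Longrightarrow> y \<in> witt_ring p \<nu> \<Longrightarrow> x - y \<in> witt_ring p \<nu>"
  and witt_mult: "x \<in> witt_ring p \<nu> \<Longrightarrow> y \<in> witt_ring p \<nu> \<Longrightarrow> x * y \<in> witt_ring p \<nu>"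
  and witt_of_nat [simp]: "of_nat k \<in> witt_ring p \<nu>"
  and witt_int: "x \<in> witt_ring p \<nu> \<Longrightarrow> 0 \<le> \<nu> x"
  and witt_teich: "t \<in> teich \<Longrightarrow> t \<in> witt_ring p \<nu>"
  unfolding witt_ring_iff
  by (simp_all add: self.graph_add self.graph_diff self.graph_mult self.graph_of_nat self.graph_int self.graph_teich)

lemma witt_0 [simp]: "0 \<in> witt_ring p \<nu>" and witt_1 [simp]: "1 \<in> witt_ring p \<nu>"
  using witt_of_nat[of 0] witt_of_nat[of 1] by simp_all

lemma witt_power: "x \<in> witt_ring p \<nu> \<Longrightarrow> x ^ k \<in> witt_ring p \<nu>"
  by (induction k) (auto intro: witt_mult)

lemma witt_sum: "(\<And>i. i \<in> I \<Longrightarrow> f i \<in> witt_ring p \<nu>) \<Longrightarrow> sum f I \<in> witt_ring p \<nu>"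
  by (induction I rule: infinite_finite_induct) (auto intro: witt_add)

lemma witt_closed:
  assumes "\<And>N::nat. \<exists>y. y \<in> witt_ring p \<nu> \<and> ereal (real N) \<le> \<nu> (x - y)"
  shows "x \<in> witt_ring p \<nu>"
  unfolding witt_ring_iff
  by (rule self.graph_closed) (use assms witt_ring_iff in blast)

lemma witt_decompose:
  assumes "x \<in> witt_ring p \<nu>"
  obtains t y where "t \<in> teich" "y \<in> witt_ring p \<nu>" "x = t + of_nat p * y"
proof -
  obtain t where t: "t \<in> teich" "0 < \<nu> (x - t)" using teich_exists[OF witt_int[OF assms]] .
  obtain y z where "self.graph y z" "x = t + of_nat p * y"
    using self.graph_decompose[OF assms[unfolded witt_ring_iff] t] by blast
  then show ?thesis using that[OF t(1), of y] self_graph[of y z] witt_ring_iff by blast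
qed

text \<open>
  In the expansion \<open>\<Sum>i. p\<^sup>i t\<^sub>i\<close> the first nonzero Teichmueller element has
  valuation \<open>0\<close>.
\<close>

lemma witt_val:
  assumes "x \<in> witt_ring p \<nu>" "x \<noteq> 0" obtains k :: nat where "\<nu> x = ereal (real k)"
proof -
  have "\<exists>k::nat. \<nu> x = ereal (real k)" if "x \<in> witt_ring p \<nu>" "\<nu> x < ereal (real n)" for n x
    using that
  proof (induction n arbitrary: x)
    case 0
    then show ?case using witt_int[of x] by (simp add: zero_ereal_def)
  next
    case (Suc n)
    obtain t y where t: "t \<in> teich" "y \<in> witt_ring p \<nu>" "x = t + of_nat p * y"
      using witt_decompose[OF Suc.prems(1)] .
    show ?case
    proof (cases "t = 0")
      case True
      then have x: "\<nu> x = 1 + \<nu> y" using t by (simp add: mult)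
      then have "\<nu> y < ereal (real n)" using Suc.prems(2) by (cases "\<nu> y") (auto simp: one_ereal_def)
      then obtain k :: nat where "\<nu> y = ereal (real k)" using Suc.IH t by blast
      then show ?thesis using x by (intro exI[of _ "Suc k"]) (simp add: one_ereal_def)
    next
      case False
      have "0 < \<nu> (of_nat p * y)" using gt_mult_int[of 0 "of_nat p" y] witt_int[OF t(2)] by simp
      then have "\<nu> x = 0" using teich_unit[OF t(1) False] val_add_eq[of t "of_nat p * y"] t by simp
      then show ?thesis by (intro exI[of _ 0]) (simp add: zero_ereal_def)
    qed
  qed
  moreover obtain r where "\<nu> x = ereal r" using val_real[OF assms(2)] .
  moreover obtain n :: nat where "r < real n" using reals_Archimedean2 by blast
  ultimately show ?thesis using that assms by fastforce
qed

end

section \<open>The Eisenstein presentation of the valuation ring\<close>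

lemma field_homs_iff:
  "(g :: 'a::field \<Rightarrow> 'b::field) \<in> field_homs \<longleftrightarrow>
    (\<forall>x y. g (x + y) = g x + g y) \<and> (\<forall>x y. g (x * y) = g x * g y) \<and> g 1 = 1"
  by (auto simp: field_homs_def ring_of_type_algebra_def Ring.ring_hom_def)

lemma field_hom_if_in_field_homs:
  assumes "(g :: 'a::field \<Rightarrow> 'b::field) \<in> field_homs" shows "field_hom g"
proof -
  have g: "g (x + y) = g x + g y" "g (x * y) = g x * g y" "g 1 = 1" for x y
    using assms by (auto simp: field_homs_iff)
  have "g 0 = g 0 + g 0" using g(1)[of 0 0] by (simp only: add_0_right)
  then have "g 0 = 0" by (metis add_left_cancel add_0_right)
  then show ?thesis using g by unfold_locales auto
qed

text \<open>
  Multiplication by \<open>z\<close> in the coordinates with respect to \<open>1, z, \<dots>,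
  z\<^sup>d\<^sup>-\<^sup>1\<close>.
\<close>

lemma shift_coordinates:
  fixes z :: "'a::comm_ring_1"
  assumes "d > 0" "z ^ d = (\<Sum>i<d. E i * z ^ i)"
  shows "z * (\<Sum>i<d. c i * z ^ i) = (\<Sum>i<d. ((if i = 0 then 0 else c (i - 1)) + c (d - 1) * E i) * z ^ i)"
proof -
  obtain k where d: "d = Suc k" using assms(1) by (cases d) auto
  have "z * (\<Sum>i<d. c i * z ^ i) = (\<Sum>i<k. c i * z ^ Suc i) + c k * z ^ d"
    unfolding d by (simp add: sum_distrib_left distrib_left mult_ac)
  also have "(\<Sum>i<k. c i * z ^ Suc i) = (\<Sum>i<d. (if i = 0 then 0 else c (i - 1)) * z ^ i)"
    unfolding d by (simp add: sum.lessThan_Suc_shift del: sum.lessThan_Suc)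
  also have "c k * z ^ d = (\<Sum>i<d. c (d - 1) * E i * z ^ i)"
    unfolding assms(2) by (simp add: d sum_distrib_left mult_ac del: sum.lessThan_Suc)
  finally show ?thesis by (simp add: distrib_right sum.distrib del: sum.lessThan_Suc)
qed

context perfect_cdvf
begin

text \<open>The uniformizer that occurs in the definition of \<^const>\<open>M_inv\<close>.\<close>

definition unif :: 'a where "unif = (SOME x. uniformizer \<nu> x)"

lemma val_unif: "\<nu> unif = ereal (1 / real e)"
  unfolding unif_def using discrete uniformizer_val_e by (metis someI_ex)

lemma unif_int: "0 \<le> \<nu> unif" and unif_neq_0 [simp]: "unif \<noteq> 0"
  using val_unif e_pos infinity_iff[of unif] by auto

lemma val_unif_power: "\<nu> (unif ^ k) = ereal (real k / real e)"
  by (simp add: val_power val_unif)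

lemma teich_expansion:
  assumes \<pi>: "uniformizer \<nu> \<pi>" and x: "0 \<le> \<nu> x"
  shows "\<exists>t. (\<forall>i. t i \<in> teich) \<and> ereal (real k / real e) \<le> \<nu> (x - (\<Sum>i<k. t i * \<pi> ^ i))"
proof (induction k)
  case 0
  show ?case using x by (intro exI[of _ "\<lambda>_. 0"]) (simp flip: zero_ereal_def)
next
  case (Suc k)
  have \<pi>0: "\<pi> \<noteq> 0" using \<pi> by (simp add: uniformizer_def)
  have v: "\<nu> (\<pi> ^ k) = ereal (real k / real e)" using \<pi> by (simp add: val_power uniformizer_val_e)
  obtain t where t: "\<And>i. t i \<in> teich" "ereal (real k / real e) \<le> \<nu> (x - (\<Sum>i<k. t i * \<pi> ^ i))"
    using Suc by blast
  define r where "r = (x - (\<Sum>i<k. t i * \<pi> ^ i)) / \<pi> ^ k"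
  have r: "x - (\<Sum>i<k. t i * \<pi> ^ i) = r * \<pi> ^ k" using \<pi>0 by (simp add: r_def)
  have "0 \<le> \<nu> r"
  proof (cases "r = 0")
    case False
    then obtain c where c: "\<nu> r = ereal c" by (rule val_real)
    then show ?thesis using t(2) unfolding r mult v by simp
  qed simp
  then obtain s where s: "s \<in> teich" "0 < \<nu> (r - s)" using teich_exists by blast
  have "ereal (1 / real e + real k / real e) \<le> \<nu> ((r - s) * \<pi> ^ k)"
    by (rule ge_mult[OF pos_imp_ge[OF s(2)]]) (simp add: v)
  also have "(r - s) * \<pi> ^ k = x - (\<Sum>i<Suc k. (t(k := s)) i * \<pi> ^ i)"
  proof -
    have "(\<Sum>i<k. (t(k := s)) i * \<pi> ^ i) = (\<Sum>i<k. t i * \<pi> ^ i)" by (intro sum.cong) auto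
    then have "(\<Sum>i<Suc k. (t(k := s)) i * \<pi> ^ i) = (\<Sum>i<k. t i * \<pi> ^ i) + s * \<pi> ^ k"
      by (simp only: sum.lessThan_Suc fun_upd_same)
    then show ?thesis by (simp only: left_diff_distrib r[symmetric] diff_diff_eq)
  qed
  also have "1 / real e + real k / real e = real (Suc k) / real e" by (simp add: add_divide_distrib)
  finally show ?case using t s by (intro exI[of _ "t(k := s)"]) auto
qed

lemma uniformizer_unif: "uniformizer \<nu> unif" by (simp add: uniformizer_iff val_unif)

lemma unif_expansion_step:
  assumes "0 \<le> \<nu> x"
  obtains t y where "\<And>i. t i \<in> teich" "0 \<le> \<nu> y" "x = (\<Sum>i<e. t i * unif ^ i) + of_nat p * y"
proof -
  obtain t where t: "\<And>i. t i \<in> teich" "ereal (real e / real e) \<le> \<nu> (x - (\<Sum>i<e. t i * unif ^ i))"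
    using teich_expansion[OF uniformizer_unif assms, of e] by blast
  define y where "y = (x - (\<Sum>i<e. t i * unif ^ i)) / of_nat p"
  have y: "x - (\<Sum>i<e. t i * unif ^ i) = of_nat p * y" by (simp add: y_def)
  have "ereal (0 + 1) \<le> \<nu> (of_nat p * y)" unfolding y[symmetric] using t(2) e_pos by simp
  then have "ereal 0 \<le> \<nu> y" by (rule val_p_cancel)
  then have "0 \<le> \<nu> y" by (simp add: zero_ereal_def)
  moreover have "x = (\<Sum>i<e. t i * unif ^ i) + of_nat p * y" unfolding y[symmetric] by simp
  ultimately show ?thesis by (rule that[OF t(1)])
qed

text \<open>
  Iterating the expansion modulo \<open>p\<close> gives a series in \<open>p\<^sup>j \<pi>\<^sup>i\<close> with \<open>i < e\<close>. The Teichmueller coefficients that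
  belong to a fixed \<open>i\<close> sum up to an element of the Witt ring.
\<close>

lemma ex_coords:
  assumes "0 \<le> \<nu> x"
  obtains a where "\<And>i. a i \<in> witt_ring p \<nu>" "x = (\<Sum>i<e. a i * unif ^ i)"
proof -
  have "\<exists>f. \<forall>n. (0 \<le> \<nu> (f n) \<and> (n = 0 \<longrightarrow> f n = x)) \<and>
    (\<exists>t. (\<forall>i. t i \<in> teich) \<and> f n = (\<Sum>i<e. t i * unif ^ i) + of_nat p * f (Suc n))"
  proof (rule dependent_nat_choice)
    fix y :: 'a and n :: nat assume "0 \<le> \<nu> y \<and> (n = 0 \<longrightarrow> y = x)"
    then obtain t z where "\<And>i. t i \<in> teich" "0 \<le> \<nu> z" "y = (\<Sum>i<e. t i * unif ^ i) + of_nat p * z"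
      using unif_expansion_step by blast
    then show "\<exists>z. (0 \<le> \<nu> z \<and> (Suc n = 0 \<longrightarrow> z = x)) \<and>
      (\<exists>t. (\<forall>i. t i \<in> teich) \<and> y = (\<Sum>i<e. t i * unif ^ i) + of_nat p * z)" by blast
  qed (use assms in auto)
  then obtain f where f: "\<And>n. 0 \<le> \<nu> (f n)" "f 0 = x"
    "\<And>n. \<exists>t. (\<forall>i. t i \<in> teich) \<and> f n = (\<Sum>i<e. t i * unif ^ i) + of_nat p * f (Suc n)" by metis
  obtain t where t: "\<And>n i. t n i \<in> teich" "\<And>n. f n = (\<Sum>i<e. t n i * unif ^ i) + of_nat p * f (Suc n)"
    using f(3) by metis
  define S where "S = (\<lambda>i N. \<Sum>j<N. of_nat p ^ j * t j i)"
  have xS: "x = (\<Sum>i<e. S i N * unif ^ i) + of_nat p ^ N * f N" for N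
  proof (induction N)
    case (Suc N)
    have "(\<Sum>i<e. S i (Suc N) * unif ^ i) = (\<Sum>i<e. S i N * unif ^ i) + of_nat p ^ N * (\<Sum>i<e. t N i * unif ^ i)"
      by (simp add: S_def distrib_right sum.distrib sum_distrib_left mult.assoc)
    then show ?case using Suc t(2)[of N] by (simp add: distrib_left mult_ac add_ac)
  qed (simp add: S_def f)
  have "\<exists>a. \<forall>N. ereal (real N * 1) \<le> \<nu> (S i N - a)" for i
  proof (rule complete_linear)
    fix N show "ereal (real N * 1) \<le> \<nu> (S i (Suc N) - S i N)"
      using ge_mult_int[of "ereal (real N)" "of_nat p ^ N" "t N i"] teich_int[OF t(1)]
      by (simp add: S_def val_p_power)
  qed simp
  then obtain a where a: "\<And>i N. ereal (real N) \<le> \<nu> (S i N - a i)" by (metis mult.right_neutral)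
  have "a i \<in> witt_ring p \<nu>" for i
  proof (rule witt_closed)
    fix N
    have "S i N \<in> witt_ring p \<nu>" unfolding S_def
      by (intro witt_sum witt_mult witt_power witt_of_nat witt_teich t)
    then show "\<exists>y. y \<in> witt_ring p \<nu> \<and> ereal (real N) \<le> \<nu> (a i - y)"
      using a[of N i] by (intro exI[of _ "S i N"]) (simp add: val_minus_commute)
  qed
  moreover have "x - (\<Sum>i<e. a i * unif ^ i) = 0"
  proof (rule eq_0_if_val_unbounded)
    fix N :: nat
    have eq: "x - (\<Sum>i<e. a i * unif ^ i) = (\<Sum>i<e. (S i N - a i) * unif ^ i) + of_nat p ^ N * f N"
      by (subst xS[of N]) (simp add: left_diff_distrib sum_subtractf)
    have 1: "ereal (real N) \<le> \<nu> (\<Sum>i<e. (S i N - a i) * unif ^ i)"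
      by (rule ge_sum, rule ge_mult_int[OF a int_power[OF unif_int]])
    have 2: "ereal (real N) \<le> \<nu> (of_nat p ^ N * f N)"
      by (rule ge_mult_int) (simp_all add: val_p_power f)
    show "ereal (real N) \<le> \<nu> (x - (\<Sum>i<e. a i * unif ^ i))" unfolding eq by (rule ge_add[OF 1 2])
  qed
  ultimately show ?thesis using that[of a] by simp
qed

text \<open>
  Elements of the Witt ring have integral valuations, so the terms of a combination of
  \<open>1, \<pi>, \<dots>, \<pi>\<^sup>e\<^sup>-\<^sup>1\<close> have valuations in distinct classes modulo \<open>1\<close> and cannot cancel.
\<close>

lemma val_combination_le:
  assumes "\<And>i. a i \<in> witt_ring p \<nu>" "k < e"
  shows "\<nu> (\<Sum>i<e. a i * unif ^ i) \<le> \<nu> (a k * unif ^ k)"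
proof (rule sum_val_distinct)
  fix i j assume ij: "i \<in> {..<e}" "j \<in> {..<e}" "i \<noteq> j" "a i * unif ^ i \<noteq> 0" "a j * unif ^ j \<noteq> 0"
  obtain m :: nat where m: "\<nu> (a i) = ereal (real m)" using witt_val[OF assms(1)] ij by (metis mult_zero_left)
  obtain n :: nat where n: "\<nu> (a j) = ereal (real n)" using witt_val[OF assms(1)] ij by (metis mult_zero_left)
  show "\<nu> (a i * unif ^ i) \<noteq> \<nu> (a j * unif ^ j)"
  proof
    assume "\<nu> (a i * unif ^ i) = \<nu> (a j * unif ^ j)"
    then have "real m + real i / real e = real n + real j / real e"
      unfolding mult m n val_unif_power by simp
    moreover have "real (m * e + i) / real e = real m + real i / real e" for m i
      using e_pos by (simp add: add_divide_distrib)
    ultimately have "real (m * e + i) / real e = real (n * e + j) / real e" by (simp only:)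
    then have "real (m * e + i) = real (n * e + j)"
      using e_pos by (simp del: of_nat_add of_nat_mult)
    then have "m * e + i = n * e + j" by (simp only: of_nat_eq_iff)
    then have "(m * e + i) mod e = (n * e + j) mod e" by simp
    then show False using ij by simp
  qed
qed (use assms in auto)

lemma combination_eq_0:
  assumes "\<And>i. a i \<in> witt_ring p \<nu>" "(\<Sum>i<e. a i * unif ^ i) = 0" "k < e"
  shows "a k = 0"
  using val_combination_le[of a k, OF assms(1,3)] infinity_iff[of "a k * unif ^ k"] assms(2) by simp

text \<open>
  Coordinates over the Witt ring, padded with \<open>0\<close>. They are meaningful for integral elements
  only.
\<close>

definition coords :: "'a \<Rightarrow> nat \<Rightarrow> 'a" where
  "coords x = (SOME a. (\<forall>i. a i \<in> witt_ring p \<nu>) \<and> (\<forall>i\<ge>e. a i = 0) \<and> x = (\<Sum>i<e. a i * unif ^ i))"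

lemma coords:
  assumes "0 \<le> \<nu> x"
  shows "coords x i \<in> witt_ring p \<nu>" "i \<ge> e \<Longrightarrow> coords x i = 0" "x = (\<Sum>i<e. coords x i * unif ^ i)"
proof -
  obtain a where a: "\<And>i. a i \<in> witt_ring p \<nu>" "x = (\<Sum>i<e. a i * unif ^ i)"
    using ex_coords[OF assms] by blast
  have "\<exists>a. (\<forall>i. a i \<in> witt_ring p \<nu>) \<and> (\<forall>i\<ge>e. a i = 0) \<and> x = (\<Sum>i<e. a i * unif ^ i)"
    using a by (intro exI[of _ "\<lambda>i. if i < e then a i else 0"]) auto
  from someI_ex[OF this] show "coords x i \<in> witt_ring p \<nu>" "i \<ge> e \<Longrightarrow> coords x i = 0"
    "x = (\<Sum>i<e. coords x i * unif ^ i)" unfolding coords_def[symmetric] by blast+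
qed

lemma coords_unique:
  assumes "\<And>i. a i \<in> witt_ring p \<nu>" "i < e"
  shows "coords (\<Sum>i<e. a i * unif ^ i) i = a i"
proof -
  define x where "x = (\<Sum>i<e. a i * unif ^ i)"
  have x: "0 \<le> \<nu> x" unfolding x_def
    by (intro ge_sum int_mult int_power unif_int witt_int assms)
  have "(\<Sum>i<e. (coords x i - a i) * unif ^ i) = 0"
    using coords(3)[OF x] by (simp add: left_diff_distrib sum_subtractf x_def)
  then have "coords x i - a i = 0"
    by (rule combination_eq_0[rotated]) (use witt_diff[OF coords(1)[OF x] assms(1)] assms(2) in auto)
  then show ?thesis by (simp add: x_def)
qed

text \<open>
  The coefficients of the Eisenstein relation. Expanding \<open>\<pi>\<^sup>e / p\<close> makes it visible
  that they are divisible by \<open>p\<close>.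
\<close>

definition eis :: "nat \<Rightarrow> 'a" where "eis i = of_nat p * coords (unif ^ e / of_nat p) i"

lemma unif_power_e_int: "0 \<le> \<nu> (unif ^ e / of_nat p)"
proof -
  have "\<nu> (unif ^ e / of_nat p) = 0"
    using e_pos p_pos by (simp add: val_divide val_unif_power one_ereal_def)
  then show ?thesis by simp
qed

lemma eis_witt: "eis i \<in> witt_ring p \<nu>"
  unfolding eis_def by (intro witt_mult witt_of_nat coords unif_power_e_int)

lemma unif_power_e: "unif ^ e = (\<Sum>i<e. eis i * unif ^ i)"
proof -
  have "unif ^ e = of_nat p * (unif ^ e / of_nat p)" by simp
  also have "\<dots> = of_nat p * (\<Sum>i<e. coords (unif ^ e / of_nat p) i * unif ^ i)"
    using coords(3)[OF unif_power_e_int] by simp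
  finally show ?thesis by (simp add: eis_def sum_distrib_left mult.assoc)
qed

text \<open>
  A homomorphism on the valuation ring that exists by the universal property of
  \<open>W[X]/(X\<^sup>e - \<Sum>i<e. a\<^sub>i X\<^sup>i)\<close>, extended to the fraction field. It preserves the valuation
  since it preserves integrality.
\<close>

lemma extend_witt_hom:
  fixes w :: "'c::field_char_0 \<Rightarrow> ereal" and g0 :: "'a \<Rightarrow> 'c"
  assumes w: "valued_field w" and wp: "w (of_nat p) = 1"
    and g0_add: "\<And>x y. x \<in> witt_ring p \<nu> \<Longrightarrow> y \<in> witt_ring p \<nu> \<Longrightarrow> g0 (x + y) = g0 x + g0 y"
    and g0_mult: "\<And>x y. x \<in> witt_ring p \<nu> \<Longrightarrow> y \<in> witt_ring p \<nu> \<Longrightarrow> g0 (x * y) = g0 x * g0 y"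
    and g0_1: "g0 1 = 1"
    and g0_int: "\<And>x. x \<in> witt_ring p \<nu> \<Longrightarrow> 0 \<le> w (g0 x)"
    and root: "\<beta> ^ e = (\<Sum>i<e. g0 (eis i) * \<beta> ^ i)"
  obtains g where "g \<in> field_homs" "\<And>x. x \<in> witt_ring p \<nu> \<Longrightarrow> g x = g0 x" "g unif = \<beta>" "\<And>x. w (g x) = \<nu> x"
proof -
  interpret w: valued_field w by (rule w)
  have g0_0: "g0 0 = 0" using g0_add[of 0 0] by simp
  have g0_of_nat: "g0 (of_nat k) = of_nat k" for k
  proof (induction k)
    case (Suc k)
    then show ?case using g0_add[of 1 "of_nat k"] g0_1 by simp
  qed (simp add: g0_0)
  have \<beta>_int: "0 \<le> w \<beta>"
    by (rule w.root_integral[OF e_pos root]) (rule g0_int[OF eis_witt])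
  define h where "h = (\<lambda>x. \<Sum>i<e. g0 (coords x i) * \<beta> ^ i)"
  have h_comb: "h (\<Sum>i<e. a i * unif ^ i) = (\<Sum>i<e. g0 (a i) * \<beta> ^ i)" if "\<And>i. a i \<in> witt_ring p \<nu>" for a
    unfolding h_def using coords_unique[of a, OF that] by (intro sum.cong) auto
  have h_add: "h (x + y) = h x + h y" if x: "0 \<le> \<nu> x" and y: "0 \<le> \<nu> y" for x y
  proof -
    have "x + y = (\<Sum>i<e. (coords x i + coords y i) * unif ^ i)"
      using coords(3)[OF x] coords(3)[OF y] by (simp add: distrib_right sum.distrib)
    then show ?thesis using h_comb[of "\<lambda>i. coords x i + coords y i"] coords(1)[OF x] coords(1)[OF y]
      by (simp add: witt_add g0_add h_def distrib_right sum.distrib)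
  qed
  have h_smult: "h (a * x) = g0 a * h x" if a: "a \<in> witt_ring p \<nu>" and x: "0 \<le> \<nu> x" for a x
  proof -
    have "a * x = (\<Sum>i<e. (a * coords x i) * unif ^ i)"
      using arg_cong[OF coords(3)[OF x], of "(*) a"] by (simp add: sum_distrib_left mult.assoc)
    then show ?thesis using h_comb[of "\<lambda>i. a * coords x i"] coords(1)[OF x] a
      by (simp add: witt_mult g0_mult h_def sum_distrib_left mult.assoc)
  qed
  have h_unif: "h (unif * x) = \<beta> * h x" if x: "0 \<le> \<nu> x" for x
  proof -
    define c where "c = (\<lambda>i. (if i = 0 then 0 else coords x (i - 1)) + coords x (e - 1) * eis i)"
    have c: "c i \<in> witt_ring p \<nu>" for i
      using coords(1)[OF x] eis_witt by (simp add: c_def witt_add witt_mult)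
    have "unif * x = (\<Sum>i<e. c i * unif ^ i)"
      using shift_coordinates[OF e_pos unif_power_e, of "coords x"] coords(3)[OF x] by (simp add: c_def)
    then have "h (unif * x) = (\<Sum>i<e. g0 (c i) * \<beta> ^ i)" using h_comb[OF c] by simp
    also have "\<dots> = (\<Sum>i<e. ((if i = 0 then 0 else g0 (coords x (i - 1))) + g0 (coords x (e - 1)) * g0 (eis i)) * \<beta> ^ i)"
      using coords(1)[OF x] eis_witt
      by (intro sum.cong) (auto simp: c_def g0_add g0_mult witt_mult g0_0)
    also have "\<dots> = \<beta> * h x"
      using shift_coordinates[OF e_pos root, of "\<lambda>i. g0 (coords x i)"] by (simp add: h_def)
    finally show ?thesis .
  qed
  have h_unif_power: "h (unif ^ k * x) = \<beta> ^ k * h x" if x: "0 \<le> \<nu> x" for k x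
  proof (induction k)
    case (Suc k)
    then show ?case using h_unif[of "unif ^ k * x"] x by (simp add: int_mult int_power unif_int mult.assoc)
  qed simp
  have h_sum: "h (\<Sum>i\<in>I. f i) = (\<Sum>i\<in>I. h (f i))" if "finite I" "\<And>i. i \<in> I \<Longrightarrow> 0 \<le> \<nu> (f i)" for f :: "nat \<Rightarrow> 'a" and I
    using that
  proof (induction I rule: finite_induct)
    case empty
    then show ?case using h_comb[of "\<lambda>_. 0"] by (simp add: g0_0)
  next
    case (insert i I)
    then show ?case by (simp add: h_add ge_sum)
  qed
  have h_mult: "h (x * y) = h x * h y" if x: "0 \<le> \<nu> x" and y: "0 \<le> \<nu> y" for x y
  proof -
    have "x * y = (\<Sum>i<e. coords x i * (unif ^ i * y))"
      using arg_cong[OF coords(3)[OF x], of "\<lambda>x. x * y"] by (simp add: sum_distrib_right mult.assoc)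
    also have "h \<dots> = (\<Sum>i<e. h (coords x i * (unif ^ i * y)))"
    proof (rule h_sum)
      show "0 \<le> \<nu> (coords x i * (unif ^ i * y))" for i
        by (rule int_mult[OF witt_int[OF coords(1)[OF x]] int_mult[OF int_power[OF unif_int] y]])
    qed simp
    also have "\<dots> = (\<Sum>i<e. g0 (coords x i) * \<beta> ^ i * h y)"
      using y coords(1)[OF x] by (intro sum.cong) (auto simp: h_smult h_unif_power int_mult int_power unif_int)
    also have "\<dots> = h x * h y" by (simp add: h_def sum_distrib_right)
    finally show ?thesis .
  qed
  have h_witt: "h a = g0 a" if "a \<in> witt_ring p \<nu>" for a
  proof -
    have sum0: "(\<Sum>i<e. (if i = 0 then c else 0) * z ^ i) = c" for c z :: "'x::comm_ring_1"
      using e_pos by (subst sum.mono_neutral_right[of _ "{0}"]) auto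
    have "h (\<Sum>i<e. (if i = 0 then a else 0) * unif ^ i) = (\<Sum>i<e. g0 (if i = 0 then a else 0) * \<beta> ^ i)"
      using that by (intro h_comb) auto
    also have "\<dots> = (\<Sum>i<e. (if i = 0 then g0 a else 0) * \<beta> ^ i)"
      by (intro sum.cong) (auto simp: g0_0)
    finally show ?thesis by (simp only: sum0)
  qed
  have h_p: "h (of_nat p ^ k * x) = of_nat p ^ k * h x" if "0 \<le> \<nu> x" for k x
  proof -
    have "g0 (of_nat p ^ k) = of_nat p ^ k" using g0_of_nat[of "p ^ k"] by simp
    then show ?thesis using h_smult[of "of_nat p ^ k" x] that by (simp add: witt_power)
  qed
  have h_int: "0 \<le> w (h x)" if "0 \<le> \<nu> x" for x
    unfolding h_def by (intro w.ge_sum w.int_mult w.int_power \<beta>_int g0_int coords(1)[OF that])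
  define g where "g = (\<lambda>x. let N = (SOME N. 0 \<le> \<nu> (of_nat p ^ N * x)) in h (of_nat p ^ N * x) / of_nat p ^ N)"
  have ex_N: "\<exists>N. 0 \<le> \<nu> (of_nat p ^ N * x)" for x
  proof (cases "x = 0")
    case False
    then obtain r where r: "\<nu> x = ereal r" by (rule val_real)
    obtain N :: nat where "- r < real N" using reals_Archimedean2 by blast
    then show ?thesis by (intro exI[of _ N]) (simp add: mult r val_p_power)
  qed simp
  have int_mono: "0 \<le> \<nu> (of_nat p ^ (M + N) * x)" if "0 \<le> \<nu> (of_nat p ^ N * x)" for M N x
    using int_mult[OF int_power[OF int_of_nat[of p], of M] that] by (simp add: power_add mult.assoc)
  have g_eq: "g x = h (of_nat p ^ N * x) / of_nat p ^ N" if N: "0 \<le> \<nu> (of_nat p ^ N * x)" for x N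
  proof -
    define M where "M = (SOME N. 0 \<le> \<nu> (of_nat p ^ N * x))"
    have M: "0 \<le> \<nu> (of_nat p ^ M * x)" unfolding M_def by (rule someI_ex[OF ex_N])
    have "of_nat p ^ N * h (of_nat p ^ M * x) = h (of_nat p ^ N * (of_nat p ^ M * x))" using h_p[OF M] by simp
    also have "\<dots> = h (of_nat p ^ M * (of_nat p ^ N * x))" by (simp only: mult.left_commute)
    also have "\<dots> = of_nat p ^ M * h (of_nat p ^ N * x)" using h_p[OF N] by simp
    finally have *: "of_nat p ^ N * h (of_nat p ^ M * x) = of_nat p ^ M * h (of_nat p ^ N * x)" .
    have "g x = h (of_nat p ^ M * x) / of_nat p ^ M" by (simp add: g_def M_def Let_def)
    also have "\<dots> = h (of_nat p ^ N * x) / of_nat p ^ N" using * by (simp add: frac_eq_eq mult.commute)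
    finally show ?thesis .
  qed
  have g_int: "g x = h x" if "0 \<le> \<nu> x" for x using g_eq[of 0 x] that by simp
  have g_add: "g (x + y) = g x + g y" for x y
  proof -
    obtain M N where MN: "0 \<le> \<nu> (of_nat p ^ M * x)" "0 \<le> \<nu> (of_nat p ^ N * y)" using ex_N by metis
    have x: "0 \<le> \<nu> (of_nat p ^ (M + N) * x)" and y: "0 \<le> \<nu> (of_nat p ^ (M + N) * y)"
      using int_mono[OF MN(1), of N] int_mono[OF MN(2), of M] by (simp_all add: add.commute)
    then have xy: "0 \<le> \<nu> (of_nat p ^ (M + N) * (x + y))" by (simp add: distrib_left ge_add)
    show ?thesis unfolding g_eq[OF x] g_eq[OF y] g_eq[OF xy]
      by (simp add: distrib_left h_add[OF x y] add_divide_distrib)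
  qed
  have g_mult: "g (x * y) = g x * g y" for x y
  proof -
    obtain M N where x: "0 \<le> \<nu> (of_nat p ^ M * x)" and y: "0 \<le> \<nu> (of_nat p ^ N * y)" using ex_N by metis
    have eq: "of_nat p ^ (M + N) * (x * y) = (of_nat p ^ M * x) * (of_nat p ^ N * y)"
      by (simp add: power_add mult_ac)
    have xy: "0 \<le> \<nu> (of_nat p ^ (M + N) * (x * y))" unfolding eq by (rule int_mult[OF x y])
    have "g (x * y) = h (of_nat p ^ M * x) * h (of_nat p ^ N * y) / of_nat p ^ (M + N)"
      unfolding g_eq[OF xy] eq h_mult[OF x y] ..
    then show ?thesis unfolding g_eq[OF x] g_eq[OF y] by (simp add: power_add)
  qed
  have g_1: "g 1 = 1" using g_int[of 1] h_witt[of 1] g0_1 by simp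
  have gh: "g \<in> field_homs" using g_add g_mult g_1 by (simp add: field_homs_iff)
  interpret g: field_hom g by (rule field_hom_if_in_field_homs[OF gh])
  have unit: "w (g x) = 0" if "\<nu> x = 0" for x
  proof -
    have x0: "x \<noteq> 0" using that by auto
    then have "0 \<le> \<nu> (inverse x)" using that by (simp add: val_inverse)
    then have "0 \<le> w (g (inverse x))" using g_int h_int by simp
    moreover have "0 \<le> w (g x)" using that g_int h_int by simp
    moreover obtain r where "w (g x) = ereal r" using w.val_real[of "g x"] x0 by auto
    moreover have "w (g (inverse x)) = - w (g x)" using x0 by (simp add: w.val_inverse hom_distribs)
    ultimately show ?thesis by (simp add: zero_ereal_def)
  qed
  have gp: "g (of_nat p) = of_nat p" by (simp add: hom_distribs)
  have nonneg: "w (g x) = \<nu> x" if x: "0 \<le> \<nu> x" for x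
  proof (cases "x = 0")
    case False
    then obtain k :: int where k: "\<nu> x = ereal (of_int k / real e)" by (rule val_discrete)
    then have "0 \<le> (of_int k :: real)" using x e_pos by (simp add: zero_le_divide_iff)
    then obtain j :: nat where j: "k = int j" by (metis of_int_0_le_iff nonneg_int_cases)
    have "\<nu> (x ^ e / of_nat p ^ j) = 0"
      using e_pos p_pos by (simp add: val_divide val_power k j)
    then have "w (g (x ^ e / of_nat p ^ j)) = 0" by (rule unit)
    then have "w (g x ^ e / of_nat p ^ j) = 0" by (simp add: hom_distribs gp)
    moreover obtain r where r: "w (g x) = ereal r" using w.val_real[of "g x"] False by auto
    ultimately have "real e * r = real j" using p_pos
      by (simp add: w.val_divide w.val_power wp zero_ereal_def one_ereal_def)
    then show ?thesis using r k j e_pos by (simp add: field_simps)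
  qed simp
  have "w (g x) = \<nu> x" for x
  proof (cases "0 \<le> \<nu> x")
    case False
    then have x0: "x \<noteq> 0" by auto
    then obtain r where r: "\<nu> x = ereal r" by (rule val_real)
    have "w (g (inverse x)) = \<nu> (inverse x)" using False r x0 by (intro nonneg) (simp add: val_inverse)
    moreover obtain s where "w (g x) = ereal s" using w.val_real[of "g x"] x0 by auto
    ultimately show ?thesis using x0 r by (simp add: val_inverse w.val_inverse hom_distribs)
  qed (rule nonneg)
  moreover have "g unif = \<beta>"
    using h_unif[of 1] h_witt[of 1] g0_1 g_int[of unif] unif_int by simp
  moreover have "g x = g0 x" if "x \<in> witt_ring p \<nu>" for x
    using that g_int h_witt witt_int by simp
  ultimately show ?thesis using that gh by blast
qed

end

section \<open>The separation of conjugates\<close>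

text \<open>The coefficient of degree \<open>k\<close> is a sum of products of all but \<open>k\<close> roots.\<close>

lemma (in valued_field) prod_linear_coeff_bound:
  assumes "\<And>r. r \<in># A \<Longrightarrow> r \<noteq> 0 \<and> \<nu> r \<le> ereal \<mu>"
  shows "poly.coeff (\<Prod>r\<in>#A. [:-r, 1:]) 0 \<noteq> 0 \<and>
    (\<forall>k. \<nu> (poly.coeff (\<Prod>r\<in>#A. [:-r, 1:]) 0) \<le> \<nu> (poly.coeff (\<Prod>r\<in>#A. [:-r, 1:]) k) + ereal (real k * \<mu>))"
  using assms
proof (induction A)
  case empty
  have "0 \<le> \<nu> (poly.coeff 1 k) + ereal (real k * \<mu>)" for k
    by (cases "k = 0") (simp_all add: zero_ereal_def)
  then show ?case by simp
next
  case (add r A)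
  define H where "H = (\<Prod>r\<in>#A. [:-r, 1:])"
  have IH: "poly.coeff H 0 \<noteq> 0" "\<And>k. \<nu> (poly.coeff H 0) \<le> \<nu> (poly.coeff H k) + ereal (real k * \<mu>)"
    using add by (auto simp: H_def)
  have r: "r \<noteq> 0" "\<nu> r \<le> ereal \<mu>" using add.prems by auto
  have P: "(\<Prod>r\<in>#add_mset r A. [:-r, 1:]) = [:-r, 1:] * H" by (simp add: H_def)
  have c0: "poly.coeff ([:-r, 1:] * H) 0 = - (r * poly.coeff H 0)" by simp
  obtain a where a: "\<nu> (poly.coeff H 0) = ereal a" using val_real[OF IH(1)] .
  obtain b where b: "\<nu> r = ereal b" using val_real[OF r(1)] .
  have "\<nu> (poly.coeff ([:-r, 1:] * H) 0) \<le> \<nu> (poly.coeff ([:-r, 1:] * H) k) + ereal (real k * \<mu>)" for k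
  proof -
    have 1: "ereal (a + b - real k * \<mu>) \<le> \<nu> (- (r * poly.coeff H k))"
      using IH(2)[of k] by (cases "\<nu> (poly.coeff H k)") (simp_all add: mult a b)
    have 2: "ereal (a + b - real k * \<mu>) \<le> \<nu> (poly.coeff H (k - 1))" if "k \<noteq> 0"
    proof -
      have "real k * \<mu> = real (k - 1) * \<mu> + \<mu>" using that by (cases k) (simp_all add: algebra_simps)
      then show ?thesis using IH(2)[of "k - 1"] r(2) by (cases "\<nu> (poly.coeff H (k - 1))") (simp_all add: a b)
    qed
    have "poly.coeff ([:-r, 1:] * H) k = - (r * poly.coeff H k) + (if k = 0 then 0 else poly.coeff H (k - 1))"
      by (cases k) (simp_all add: coeff_pCons)
    then have "ereal (a + b - real k * \<mu>) \<le> \<nu> (poly.coeff ([:-r, 1:] * H) k)"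
      using 1 ge_add[OF 1 2] by (cases "k = 0") (simp_all del: val_uminus add: add.commute)
    then show ?thesis unfolding c0 by (cases "\<nu> (poly.coeff ([:-r, 1:] * H) k)") (simp_all add: mult a b)
  qed
  then show ?case unfolding P using c0 r(1) IH(1) by simp
qed

context perfect_cdvf
begin

definition eis_poly :: "'a poly" where
  "eis_poly = Polynomial.monom 1 e - (\<Sum>i<e. Polynomial.monom (eis i) i)"

lemma coeff_eis_poly:
  "poly.coeff eis_poly i = (if i = e then 1 else if i < e then - eis i else 0)"
  by (simp add: eis_poly_def coeff_sum)

lemma degree_eis_poly: "Polynomial.degree eis_poly = e"
  by (intro antisym degree_le le_degree) (auto simp: coeff_eis_poly)

lemma poly_map_eis_poly:
  assumes "field_hom g"
  shows "poly (map_poly g eis_poly) z = z ^ e - (\<Sum>i<e. g (eis i) * z ^ i)"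
proof -
  interpret g: field_hom g by (rule assms)
  have "Polynomial.degree (map_poly g eis_poly) = e" by (simp add: degree_eis_poly)
  then have "poly (map_poly g eis_poly) z = (\<Sum>i\<le>e. g (poly.coeff eis_poly i) * z ^ i)"
    by (simp add: poly_altdef)
  also have "{..e} = insert e {..<e}" by auto
  also have "(\<Sum>i\<in>insert e {..<e}. g (poly.coeff eis_poly i) * z ^ i) = z ^ e + (\<Sum>i<e. - (g (eis i) * z ^ i))"
    by (auto simp: coeff_eis_poly hom_distribs intro!: sum.cong)
  finally show ?thesis by (simp add: sum_negf)
qed

lemma eis_poly_root: "poly eis_poly unif = 0"
proof -
  have "field_hom (\<lambda>x::'a. x)" by unfold_locales auto
  from poly_map_eis_poly[OF this, of unif] show ?thesis using unif_power_e by simp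
qed

definition eis_quot :: "'a poly" where "eis_quot = synthetic_div eis_poly unif"

lemma eis_poly_factor: "eis_poly = [:- unif, 1:] * eis_quot"
  unfolding eis_quot_def using synthetic_div_correct'[of unif eis_poly] eis_poly_root by simp

lemma degree_eis_quot: "Polynomial.degree eis_quot = e - 1"
  by (simp add: eis_quot_def degree_eis_poly degree_synthetic_div)

lemma lead_coeff_eis_quot: "Polynomial.lead_coeff eis_quot = 1"
proof -
  have "Polynomial.lead_coeff eis_poly = 1 * Polynomial.lead_coeff eis_quot"
    unfolding eis_poly_factor lead_coeff_mult by simp
  then show ?thesis by (simp add: degree_eis_poly coeff_eis_poly)
qed

text \<open>
  The uniformizer is a simple root: its image under the derivative is a combination of
  \<open>1, \<dots>, \<pi>\<^sup>e\<^sup>-\<^sup>1\<close> with last coefficient \<open>e\<close>.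
\<close>

lemma eis_quot_unif: "poly eis_quot unif \<noteq> 0"
proof
  assume 0: "poly eis_quot unif = 0"
  have "poly (pderiv eis_poly) unif = 0"
    unfolding eis_poly_factor pderiv_mult by (simp add: pderiv_pCons 0)
  moreover have "poly (pderiv eis_poly) unif = (\<Sum>i<e. poly.coeff (pderiv eis_poly) i * unif ^ i)"
  proof -
    have "{..e - 1} = {..<e}" using e_pos by auto
    then show ?thesis by (simp add: poly_altdef degree_pderiv degree_eis_poly)
  qed
  moreover have "poly.coeff (pderiv eis_poly) i \<in> witt_ring p \<nu>" for i
    using witt_mult[OF witt_of_nat[of "Suc i"]] witt_diff[OF witt_0] eis_witt
    by (auto simp: coeff_pderiv coeff_eis_poly)
  ultimately have "poly.coeff (pderiv eis_poly) (e - 1) = 0"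
    using combination_eq_0[of "poly.coeff (pderiv eis_poly)" "e - 1"] e_pos by simp
  then show False using e_pos by (simp add: coeff_pderiv coeff_eis_poly)
qed

lemma witt_ring_subset_witt_field: "x \<in> witt_ring p \<nu> \<Longrightarrow> x \<in> witt_field p \<nu>"
  unfolding witt_field_def using witt_1 by (metis (mono_tags, lifting) div_by_1 mem_Collect_eq zero_neq_one)

text \<open>
  Elements of the Witt field have integral valuations, so it contains a uniformizer only if \<open>e =
  1\<close>; and then the coordinates of an integral element reduce to one.
\<close>

lemma witt_field_UNIV_iff: "witt_field p \<nu> = UNIV \<longleftrightarrow> e = 1"
proof
  assume "witt_field p \<nu> = UNIV"
  then have "unif \<in> witt_field p \<nu>" by simp
  then obtain x y where xy: "x \<in> witt_ring p \<nu>" "y \<in> witt_ring p \<nu>" "y \<noteq> 0" "unif = x / y"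
    unfolding witt_field_def by blast
  then have "x \<noteq> 0" using unif_neq_0 by auto
  then obtain a :: nat where a: "\<nu> x = ereal (real a)" using witt_val xy by blast
  obtain b :: nat where b: "\<nu> y = ereal (real b)" using witt_val xy by blast
  have "1 / real e = real a - real b"
    using val_unif val_divide[OF xy(3), of x] xy(4) a b by simp
  then have "1 = (real a - real b) * real e"
    using divide_eq_eq[of 1 "real e" "real a - real b"] e_pos by simp
  then have "real_of_int 1 = real_of_int ((int a - int b) * int e)" by simp
  then have "1 = (int a - int b) * int e" by (simp only: of_int_eq_iff)
  then have "int e dvd 1" by (metis dvd_triv_right)
  then show "e = 1" by simp
next
  assume e: "e = 1"
  show "witt_field p \<nu> = UNIV"
  proof (intro equalityI subsetI UNIV_I)
    fix x :: 'a
    obtain N :: nat where N: "0 \<le> \<nu> (of_nat p ^ N * x)"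
    proof (cases "x = 0")
      case False
      then obtain r where r: "\<nu> x = ereal r" by (rule val_real)
      obtain N :: nat where "- r < real N" using reals_Archimedean2 by blast
      then show ?thesis by (intro that[of N]) (simp add: mult r val_p_power)
    qed (use that[of 0] in simp)
    have "of_nat p ^ N * x \<in> witt_ring p \<nu>"
      using coords(1)[OF N, of 0] coords(3)[OF N] e by simp
    moreover have "x = (of_nat p ^ N * x) / of_nat p ^ N" by simp
    moreover have "of_nat p ^ N \<in> witt_ring p \<nu>" "(of_nat p ^ N :: 'a) \<noteq> 0" by (simp_all add: witt_power)
    ultimately show "x \<in> witt_field p \<nu>" unfolding witt_field_def by blast
  qed
qed

lemma M_inv_eq:
  assumes "e \<noteq> 1"
  shows "M_inv p \<nu> = Max {ext_val (to_ac unif - \<sigma> unif) | \<sigma>.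
    \<sigma> \<in> homs_to_closure_over (witt_field p \<nu>) \<and> \<sigma> unif \<noteq> to_ac unif}"
  using assms by (simp add: M_inv_def witt_field_UNIV_iff Let_def extended_valuation_eq flip: unif_def)

text \<open>
  A homomorphism over the Witt field fixes the coefficients of the Eisenstein polynomial, so it maps \<open>\<pi>\<close> to a root.
  Conversely, every root is the image of \<open>\<pi>\<close> under an extension of the inclusion of the Witt ring.
\<close>

lemma conjugates_eq:
  "{ext_val (to_ac unif - \<sigma> unif) | \<sigma>. \<sigma> \<in> homs_to_closure_over (witt_field p \<nu>) \<and> \<sigma> unif \<noteq> to_ac unif}
    = (\<lambda>z. ext_val (to_ac unif - z)) ` {z. poly (map_poly to_ac eis_poly) z = 0 \<and> z \<noteq> to_ac unif}"
proof (intro equalityI subsetI)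
  fix v assume "v \<in> {ext_val (to_ac unif - \<sigma> unif) | \<sigma>.
    \<sigma> \<in> homs_to_closure_over (witt_field p \<nu>) \<and> \<sigma> unif \<noteq> to_ac unif}"
  then obtain \<sigma> where s: "v = ext_val (to_ac unif - \<sigma> unif)" "\<sigma> \<in> field_homs"
    "\<And>x. x \<in> witt_field p \<nu> \<Longrightarrow> \<sigma> x = to_ac x" "\<sigma> unif \<noteq> to_ac unif"
    unfolding homs_to_closure_over_def by blast
  interpret s: field_hom \<sigma> by (rule field_hom_if_in_field_homs[OF s(2)])
  have "\<sigma> (unif ^ e) = (\<Sum>i<e. \<sigma> (eis i) * \<sigma> unif ^ i)"
    by (subst unif_power_e) (simp add: hom_distribs)
  then have "poly (map_poly to_ac eis_poly) (\<sigma> unif) = 0"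
    using s(3) witt_ring_subset_witt_field eis_witt
    by (simp add: poly_map_eis_poly[OF to_ac.field_hom_axioms] hom_distribs)
  then show "v \<in> (\<lambda>z. ext_val (to_ac unif - z)) ` {z. poly (map_poly to_ac eis_poly) z = 0 \<and> z \<noteq> to_ac unif}"
    using s by blast
next
  fix v assume "v \<in> (\<lambda>z. ext_val (to_ac unif - z)) ` {z. poly (map_poly to_ac eis_poly) z = 0 \<and> z \<noteq> to_ac unif}"
  then obtain z where z: "v = ext_val (to_ac unif - z)" "poly (map_poly to_ac eis_poly) z = 0" "z \<noteq> to_ac unif" by blast
  have root: "z ^ e = (\<Sum>i<e. to_ac (eis i) * z ^ i)"
    using z(2) by (simp add: poly_map_eis_poly[OF to_ac.field_hom_axioms])
  obtain \<sigma> where s: "\<sigma> \<in> field_homs" "\<And>x. x \<in> witt_ring p \<nu> \<Longrightarrow> \<sigma> x = to_ac x" "\<sigma> unif = z"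
    by (rule extend_witt_hom[of ext_val to_ac z])
      (use valued_field_ext_val root ext_val_to_ac[of "of_nat p"] in \<open>auto simp: ext_val_to_ac witt_int\<close>)
  interpret s: field_hom \<sigma> by (rule field_hom_if_in_field_homs[OF s(1)])
  have "\<sigma> x = to_ac x" if "x \<in> witt_field p \<nu>" for x
    using that s(2) unfolding witt_field_def by (auto simp: hom_distribs)
  then have "\<sigma> \<in> homs_to_closure_over (witt_field p \<nu>)" using s(1) by (simp add: homs_to_closure_over_def)
  then show "v \<in> {ext_val (to_ac unif - \<sigma> unif) | \<sigma>. \<sigma> \<in> homs_to_closure_over (witt_field p \<nu>) \<and> \<sigma> unif \<noteq> to_ac unif}"
    using z s(3) by blast
qed

lemma finite_roots_eis_poly: "finite {z. poly (map_poly to_ac eis_poly) z = 0 \<and> z \<noteq> to_ac unif}"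
proof -
  have "eis_poly \<noteq> 0" using degree_eis_poly e_pos by auto
  then have "finite {z. poly (map_poly to_ac eis_poly) z = 0}" by (intro poly_roots_finite) simp
  then show ?thesis by (rule rev_finite_subset) blast
qed

lemma eis_root_cases:
  assumes "field_hom g"
  shows "poly (map_poly g eis_poly) z = 0 \<longleftrightarrow> z = g unif \<or> poly (map_poly g eis_quot) z = 0"
proof -
  interpret g: field_hom g by (rule assms)
  interpret gp: map_poly_inj_idom_hom g ..
  have "poly (map_poly g eis_poly) z = (z - g unif) * poly (map_poly g eis_quot) z"
    unfolding eis_poly_factor by (simp add: hom_distribs algebra_simps)
  then show ?thesis by simp
qed

lemma M_inv_ge:
  assumes "poly (map_poly to_ac eis_quot) z = 0" shows "ext_val (to_ac unif - z) \<le> M_inv p \<nu>"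
proof -
  have ne: "z \<noteq> to_ac unif" using assms eis_quot_unif by auto
  have "Polynomial.degree eis_quot \<noteq> 0"
  proof
    assume "Polynomial.degree eis_quot = 0"
    then have "eis_quot = 1" using lead_coeff_eis_quot by (metis degree_0_id one_pCons)
    then show False using assms by simp
  qed
  then have e: "e \<noteq> 1" by (simp add: degree_eis_quot)
  show ?thesis unfolding M_inv_eq[OF e] conjugates_eq
    using finite_roots_eis_poly assms ne eis_root_cases[OF to_ac.field_hom_axioms] by (intro Max_ge) auto
qed

lemma M_inv_real: obtains \<mu> where "0 \<le> \<mu>" "M_inv p \<nu> = ereal \<mu>"
proof (cases "e = 1")
  case True
  then show ?thesis using that[of 0] by (simp add: M_inv_def witt_field_UNIV_iff zero_ereal_def)
next
  case False
  interpret w: valued_field ext_val by (rule valued_field_ext_val)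
  let ?R = "{z. poly (map_poly to_ac eis_poly) z = 0 \<and> z \<noteq> to_ac unif}"
  have "Polynomial.degree (map_poly to_ac eis_quot) > 0" using False e_pos by (simp add: degree_eis_quot)
  then obtain z where z: "poly (map_poly to_ac eis_quot) z = 0" using alg_closed_imp_poly_has_root by blast
  have "z \<noteq> to_ac unif" using z eis_quot_unif by auto
  then have "?R \<noteq> {}" using z eis_root_cases[OF to_ac.field_hom_axioms] by blast
  then have "M_inv p \<nu> \<in> (\<lambda>z. ext_val (to_ac unif - z)) ` ?R"
    unfolding M_inv_eq[OF False] conjugates_eq using finite_roots_eis_poly by (intro Max_in) auto
  then obtain y where y: "y \<in> ?R" "M_inv p \<nu> = ext_val (to_ac unif - y)" by blast
  then obtain \<mu> where mu: "M_inv p \<nu> = ereal \<mu>" using w.val_real[of "to_ac unif - y"] by auto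
  have "0 \<le> ext_val y"
  proof (rule w.root_integral[OF e_pos])
    show "y ^ e = (\<Sum>i<e. to_ac (eis i) * y ^ i)"
      using y(1) by (simp add: poly_map_eis_poly[OF to_ac.field_hom_axioms])
  qed (simp add: ext_val_to_ac witt_int eis_witt)
  then have "0 \<le> ext_val (to_ac unif - y)" by (intro w.ge_diff) (simp_all add: ext_val_to_ac unif_int)
  then show ?thesis using that[OF _ mu] mu y by simp
qed

text \<open>
  Write \<open>y \<cdot> h(y)\<close> for the Eisenstein polynomial at \<open>\<pi> + y\<close>. The roots of \<open>h\<close> in the algebraic
  closure have valuation at most \<open>M\<close>, which bounds the valuations of the coefficients:
  \<open>\<nu>(h\<^sub>0) \<le> \<nu>(h\<^sub>k) + k M\<close>. The coefficients lie in the field itself, so these bounds are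
  carried over by any valuation preserving embedding, and they exclude roots of valuation
  greater than \<open>M\<close>, because the constant term would dominate.
\<close>

lemma conjugates_separated:
  fixes w :: "'c::field_char_0 \<Rightarrow> ereal" and g :: "'a \<Rightarrow> 'c"
  assumes w: "valued_field w" and g: "g \<in> field_homs" and wg: "\<And>x. w (g x) = \<nu> x"
    and root: "poly (map_poly g eis_poly) z = 0" and ne: "z \<noteq> g unif"
  shows "w (z - g unif) \<le> M_inv p \<nu>"
proof (rule ccontr)
  assume gt: "\<not> w (z - g unif) \<le> M_inv p \<nu>"
  obtain \<mu> where mu: "0 \<le> \<mu>" "M_inv p \<nu> = ereal \<mu>" by (rule M_inv_real)
  interpret w: valued_field w by (rule w)
  interpret v: valued_field ext_val by (rule valued_field_ext_val)
  interpret g: field_hom g by (rule field_hom_if_in_field_homs[OF g])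
  define H where "H = pcompose eis_quot [:unif, 1:]"
  have H_map: "poly (map_poly f H) y = poly (map_poly f eis_quot) (y + f unif)" if "field_hom f" for f :: "'a \<Rightarrow> 'd::field" and y
  proof -
    interpret f: field_hom f by (rule that)
    show ?thesis unfolding H_def f.map_poly_pcompose by (simp add: poly_pcompose add.commute)
  qed
  have H0: "poly.coeff H 0 \<noteq> 0"
    using eis_quot_unif by (simp add: H_def poly_pcompose flip: poly_0_coeff_0)
  have "Polynomial.lead_coeff H = 1" unfolding H_def
    by (subst lead_coeff_comp) (simp_all add: lead_coeff_eis_quot)
  then have lcH: "Polynomial.lead_coeff (map_poly to_ac H) = 1" by simp
  then have "map_poly to_ac H \<noteq> 0" by auto
  then obtain A where A: "map_poly to_ac H = Polynomial.smult (Polynomial.lead_coeff (map_poly to_ac H)) (\<Prod>r\<in>#A. [:- r, 1:])"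
    using alg_closed_imp_factorization by blast
  have A': "map_poly to_ac H = (\<Prod>r\<in>#A. [:- r, 1:])" using A unfolding lcH by simp
  have bound: "ext_val (poly.coeff (\<Prod>r\<in>#A. [:-r, 1:]) 0) \<le> ext_val (poly.coeff (\<Prod>r\<in>#A. [:-r, 1:]) k) + ereal (real k * \<mu>)" for k
  proof -
    have "r \<noteq> 0 \<and> ext_val r \<le> ereal \<mu>" if r: "r \<in># A" for r
    proof -
      obtain B where B: "A = add_mset r B" using r by (metis multi_member_split)
      have "poly (map_poly to_ac H) r = 0" unfolding A' B by simp
      then have "poly (map_poly to_ac eis_quot) (r + to_ac unif) = 0"
        using H_map[OF to_ac.field_hom_axioms] by simp
      from M_inv_ge[OF this] have "ext_val r \<le> ereal \<mu>" by (simp add: mu)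
      moreover have "r \<noteq> 0"
        using \<open>poly (map_poly to_ac H) r = 0\<close> H0 by (auto simp: poly_0_coeff_0)
      ultimately show ?thesis by blast
    qed
    then show ?thesis using v.prod_linear_coeff_bound[of A \<mu>] by blast
  qed
  have bound': "\<nu> (poly.coeff H 0) \<le> \<nu> (poly.coeff H k) + ereal (real k * \<mu>)" for k
    using bound[of k] by (simp add: ext_val_to_ac flip: A')
  define y where "y = z - g unif"
  have "y \<noteq> 0" using ne by (simp add: y_def)
  then obtain c where c: "w y = ereal c" by (rule w.val_real)
  have "\<mu> < c" using gt c by (simp add: mu y_def)
  have "poly (map_poly g eis_quot) z = 0"
    using root ne eis_root_cases[OF g.field_hom_axioms] by blast
  then have "0 = poly (map_poly g H) y" using H_map[OF g.field_hom_axioms] by (simp add: y_def)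
  also have "\<dots> = (\<Sum>k\<le>Polynomial.degree H. g (poly.coeff H k) * y ^ k)" by (simp add: poly_altdef)
  also have "{..Polynomial.degree H} = insert 0 {1..Polynomial.degree H}" by auto
  finally have sum0: "g (poly.coeff H 0) + (\<Sum>k\<in>{1..Polynomial.degree H}. g (poly.coeff H k) * y ^ k) = 0" by simp
  obtain a where a: "\<nu> (poly.coeff H 0) = ereal a" using val_real[OF H0] .
  have "w (g (poly.coeff H 0)) < w (\<Sum>k\<in>{1..Polynomial.degree H}. g (poly.coeff H k) * y ^ k)"
  proof (rule w.gt_sum)
    fix k assume "k \<in> {1..Polynomial.degree H}"
    then have "real k * \<mu> < real k * c" using \<open>\<mu> < c\<close> by simp
    then show "w (g (poly.coeff H 0)) < w (g (poly.coeff H k) * y ^ k)"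
      using bound'[of k] by (cases "\<nu> (poly.coeff H k)") (simp_all add: w.mult w.val_power wg a c)
  qed (simp add: wg a)
  from w.val_add_eq[OF this] sum0 show False using wg a by simp
qed

end

section \<open>Homomorphisms of hyperfields\<close>

text \<open>
  The valuation of \<open>x\<^sup>e\<close> is an integer \<open>i - j\<close>, so \<open>x\<^sup>e
  p\<^sup>j\<close> and \<open>p\<^sup>i\<close> have the same valuation, and a comparison can tell this.
\<close>

lemma (in mixed_char_cdvf) val_eq_if_same_comparisons:
  fixes w :: "'b::field_char_0 \<Rightarrow> ereal"
  assumes w: "mixed_char_cdvf w p" and "x \<noteq> 0" "y \<noteq> 0"
    and "\<And>i j. \<nu> (x ^ e * of_nat p ^ j) \<le> \<nu> (of_nat p ^ i) \<longleftrightarrow> w (y ^ e * of_nat p ^ j) \<le> w (of_nat p ^ i)"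
    and "\<And>i j. \<nu> (of_nat p ^ i) \<le> \<nu> (x ^ e * of_nat p ^ j) \<longleftrightarrow> w (of_nat p ^ i) \<le> w (y ^ e * of_nat p ^ j)"
  shows "w y = \<nu> x"
proof -
  interpret w: mixed_char_cdvf w p by (rule w)
  obtain k :: int where k: "\<nu> x = ereal (of_int k / real e)" using val_discrete[OF assms(2)] .
  obtain r where r: "w y = ereal r" using w.val_real[OF assms(3)] .
  obtain i j :: nat where ij: "k = int i - int j" by (rule int_diff_cases)
  have "\<nu> (x ^ e * of_nat p ^ j) = \<nu> (of_nat p ^ i)"
    using e_pos by (simp add: mult val_power k ij val_p_power)
  then have "w (y ^ e * of_nat p ^ j) = w (of_nat p ^ i)" using assms(4)[of j i] assms(5)[of i j] by simp
  then have "real e * r = of_int k" by (simp add: w.mult w.val_power r w.val_p_power ij)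
  then have "r = of_int k / real e" using e_pos by (simp add: nonzero_eq_divide_eq mult.commute)
  then show ?thesis using k r by simp
qed

locale hyper_hom = K1: perfect_cdvf \<nu>\<^sub>1 p + K2: perfect_cdvf \<nu>\<^sub>2 p
  for \<nu>\<^sub>1 :: "'a::field_char_0 \<Rightarrow> ereal" and \<nu>\<^sub>2 :: "'b::field_char_0 \<Rightarrow> ereal" and p :: nat +
  fixes n m :: nat and \<phi> :: "'a set \<Rightarrow> 'b set"
  assumes n: "n \<ge> 1" and m: "m \<ge> 1"
    and \<phi>: "\<phi> \<in> hyperfield_hom_over_p p \<nu>\<^sub>1 n \<nu>\<^sub>2 m"
begin

text \<open>Passing to representatives turns the map of classes into a relation between the two fields.\<close>

definition rep :: "'a \<Rightarrow> 'b \<Rightarrow> bool" where "rep x y \<longleftrightarrow> y \<in> \<phi> (hclass \<nu>\<^sub>1 n x)"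

lemma hclass_in [simp]: "hclass \<nu>\<^sub>1 n x \<in> hyperfield \<nu>\<^sub>1 n" by (simp add: hyperfield_def)

lemma \<phi>_hom: "\<phi> \<in> hyperfield_hom \<nu>\<^sub>1 n \<nu>\<^sub>2 m"
  using \<phi> by (simp add: hyperfield_hom_over_p_def)

lemma \<phi>_hclass: obtains z where "\<phi> (hclass \<nu>\<^sub>1 n x) = hclass \<nu>\<^sub>2 m z"
proof -
  have "\<phi> \<in> hyperfield \<nu>\<^sub>1 n \<rightarrow>\<^sub>E hyperfield \<nu>\<^sub>2 m"
    using \<phi>_hom unfolding hyperfield_hom_def by blast
  from PiE_mem[OF this hclass_in] obtain z where "\<phi> (hclass \<nu>\<^sub>1 n x) = hclass \<nu>\<^sub>2 m z"
    unfolding hyperfield_def by (rule rangeE)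
  then show ?thesis by (rule that)
qed

lemma rep_iff: "rep x y \<longleftrightarrow> \<phi> (hclass \<nu>\<^sub>1 n x) = hclass \<nu>\<^sub>2 m y"
proof
  assume y: "rep x y"
  obtain z where z: "\<phi> (hclass \<nu>\<^sub>1 n x) = hclass \<nu>\<^sub>2 m z" by (rule \<phi>_hclass)
  then show "\<phi> (hclass \<nu>\<^sub>1 n x) = hclass \<nu>\<^sub>2 m y" using y K2.hclass_eq_iff[OF m, of z y] by (simp add: rep_def)
qed (simp add: rep_def)

lemma ex_rep: obtains y where "rep x y"
proof -
  obtain z where z: "\<phi> (hclass \<nu>\<^sub>1 n x) = hclass \<nu>\<^sub>2 m z" by (rule \<phi>_hclass)
  then show ?thesis using that rep_iff by blast
qed

lemma rep_close: "rep x y \<Longrightarrow> rep x z \<longleftrightarrow> z \<in> hclass \<nu>\<^sub>2 m y"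
  by (simp add: rep_iff[of x y] rep_def[of x z])

lemma rep_0: "rep 0 0" and rep_1: "rep 1 1" and rep_p: "rep (of_nat p) (of_nat p)"
  using \<phi> unfolding rep_iff hyperfield_hom_over_p_def hyperfield_hom_def by auto

lemma rep_mult:
  assumes "rep x y" "rep x' y'" shows "rep (x * x') (y * y')"
proof -
  have "\<phi> (hmult \<nu>\<^sub>1 n (hclass \<nu>\<^sub>1 n x) (hclass \<nu>\<^sub>1 n x')) =
    hmult \<nu>\<^sub>2 m (\<phi> (hclass \<nu>\<^sub>1 n x)) (\<phi> (hclass \<nu>\<^sub>1 n x'))"
    using \<phi>_hom hclass_in unfolding hyperfield_hom_def by blast
  then show ?thesis using assms by (simp add: rep_iff K1.hmult_hclass[OF n] K2.hmult_hclass[OF m])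
qed

lemma rep_power: "rep x y \<Longrightarrow> rep (x ^ k) (y ^ k)"
  by (induction k) (auto intro: rep_1 rep_mult)

lemma rep_val_le_iff:
  assumes "rep x y" "rep x' y'" shows "\<nu>\<^sub>1 x \<le> \<nu>\<^sub>1 x' \<longleftrightarrow> \<nu>\<^sub>2 y \<le> \<nu>\<^sub>2 y'"
proof -
  have "hval \<nu>\<^sub>1 n (hclass \<nu>\<^sub>1 n x) \<le> hval \<nu>\<^sub>1 n (hclass \<nu>\<^sub>1 n x') \<longleftrightarrow>
    hval \<nu>\<^sub>2 m (\<phi> (hclass \<nu>\<^sub>1 n x)) \<le> hval \<nu>\<^sub>2 m (\<phi> (hclass \<nu>\<^sub>1 n x'))"
    using \<phi>_hom hclass_in unfolding hyperfield_hom_def by blast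
  then show ?thesis using assms by (simp add: rep_iff K1.hval_hclass[OF n] K2.hval_hclass[OF m])
qed

lemma rep_add:
  assumes "rep x y" "rep x' y'"
  obtains z z' where "rep x z" "rep x' z'" "rep (x + x') (z + z')"
proof -
  have "\<phi> ` hadd \<nu>\<^sub>1 n (hclass \<nu>\<^sub>1 n x) (hclass \<nu>\<^sub>1 n x') \<subseteq>
    hadd \<nu>\<^sub>2 m (\<phi> (hclass \<nu>\<^sub>1 n x)) (\<phi> (hclass \<nu>\<^sub>1 n x'))"
    using \<phi>_hom hclass_in unfolding hyperfield_hom_def by blast
  moreover have "hclass \<nu>\<^sub>1 n (x + x') \<in> hadd \<nu>\<^sub>1 n (hclass \<nu>\<^sub>1 n x) (hclass \<nu>\<^sub>1 n x')"
    unfolding hadd_def by (intro CollectI exI[of _ x] exI[of _ x']) simp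
  ultimately have "\<phi> (hclass \<nu>\<^sub>1 n (x + x')) \<in> hadd \<nu>\<^sub>2 m (\<phi> (hclass \<nu>\<^sub>1 n x)) (\<phi> (hclass \<nu>\<^sub>1 n x'))"
    by blast
  then obtain z z' where "z \<in> \<phi> (hclass \<nu>\<^sub>1 n x)" "z' \<in> \<phi> (hclass \<nu>\<^sub>1 n x')"
    "\<phi> (hclass \<nu>\<^sub>1 n (x + x')) = hclass \<nu>\<^sub>2 m (z + z')" unfolding hadd_def by blast
  then show ?thesis using that rep_iff rep_def by blast
qed

lemma rep_val_same: "rep x y \<Longrightarrow> rep x z \<Longrightarrow> \<nu>\<^sub>2 z = \<nu>\<^sub>2 y"
  using rep_close K2.in_hclass_val[OF m] by blast

text \<open>
  Hyperfield addition only gives a representative of the sum up to a factor \<open>1 + u\<close>. Since \<open>u\<close> lies in the \<open>m\<close>-th power of the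
  maximal ideal, this factor can be moved to the representatives of the summands.
\<close>

lemma rep_sum:
  assumes "finite I"
  shows "\<exists>y. (\<forall>i\<in>I. rep (f i) (y i)) \<and> rep (sum f I) (sum y I)"
  using assms
proof (induction I rule: finite_induct)
  case empty
  show ?case by (simp add: rep_0)
next
  case (insert i I)
  then obtain y where y: "\<And>i. i \<in> I \<Longrightarrow> rep (f i) (y i)" "rep (sum f I) (sum y I)" by blast
  obtain c where "rep (f i) c" by (rule ex_rep)
  then obtain a b where ab: "rep (f i) a" "rep (sum f I) b" "rep (f i + sum f I) (a + b)" using rep_add y(2) by blast
  have "b \<in> hclass \<nu>\<^sub>2 m (sum y I)" using rep_close[OF y(2)] ab(2) by simp
  then obtain u where u: "b = sum y I * (1 + u)" "u \<in> max_ideal_power \<nu>\<^sub>2 m" by (auto simp: hclass_def)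
  define z where "z = (\<lambda>j. if j = i then a else y j * (1 + u))"
  have "rep (f j) (z j)" if "j \<in> insert i I" for j
  proof (cases "j = i")
    case False
    then have "j \<in> I" using that by simp
    moreover have "y j * (1 + u) \<in> hclass \<nu>\<^sub>2 m (y j)" using u(2) by (auto simp: hclass_def)
    ultimately show ?thesis using rep_close[OF y(1)] False by (simp add: z_def)
  qed (simp add: z_def ab)
  moreover have "sum z (insert i I) = a + b"
  proof -
    have "sum z I = (\<Sum>j\<in>I. y j * (1 + u))"
      using insert.hyps by (intro sum.cong) (auto simp: z_def)
    then show ?thesis using insert.hyps by (simp add: z_def u(1) sum_distrib_right)
  qed
  ultimately show ?case using ab(3) insert.hyps by (intro exI[of _ z]) simp
qed

text \<open>
  The map preserves the order of the valuations and fixes \<open>p\<close>, and the value groups are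
  commensurable with the integers. Hence the map preserves the valuations.
\<close>

lemma rep_val:
  assumes "rep x y" shows "\<nu>\<^sub>2 y = \<nu>\<^sub>1 x"
proof (cases "x = 0")
  case True
  then show ?thesis using rep_val_same[OF rep_0] assms by simp
next
  case False
  have neq0: "y \<noteq> 0" if "rep x y" "x \<noteq> 0" for x y
  proof
    assume "y = 0"
    then have "\<nu>\<^sub>1 0 \<le> \<nu>\<^sub>1 x" using rep_val_le_iff[OF rep_0 that(1)] by simp
    then show False using that(2) K1.infinity_iff[of x] by simp
  qed
  show ?thesis
  proof (rule K1.val_eq_if_same_comparisons[OF K2.mixed_char_cdvf_axioms False neq0[OF assms False]])
    fix i j
    have a: "rep (x ^ K1.e * of_nat p ^ j) (y ^ K1.e * of_nat p ^ j)" and b: "rep (of_nat p ^ i) (of_nat p ^ i)"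
      by (intro rep_mult rep_power assms rep_p)+
    show "\<nu>\<^sub>1 (x ^ K1.e * of_nat p ^ j) \<le> \<nu>\<^sub>1 (of_nat p ^ i) \<longleftrightarrow> \<nu>\<^sub>2 (y ^ K1.e * of_nat p ^ j) \<le> \<nu>\<^sub>2 (of_nat p ^ i)"
      "\<nu>\<^sub>1 (of_nat p ^ i) \<le> \<nu>\<^sub>1 (x ^ K1.e * of_nat p ^ j) \<longleftrightarrow> \<nu>\<^sub>2 (of_nat p ^ i) \<le> \<nu>\<^sub>2 (y ^ K1.e * of_nat p ^ j)"
      using rep_val_le_iff a b by blast+
  qed
qed

lemma rep_dist:
  assumes "rep x y" "rep x z" shows "\<nu>\<^sub>1 x + ereal (real m / real K2.e) \<le> \<nu>\<^sub>2 (y - z)"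
  using rep_close[OF assms(1)] assms(2) K2.in_hclass_iff[of z m y] rep_val[OF assms(1)]
  by (simp add: K2.val_minus_commute)

lemma rep_dist_ge:
  assumes "rep x y" "rep x z" "ereal c \<le> \<nu>\<^sub>1 x" shows "ereal (c + real m / real K2.e) \<le> \<nu>\<^sub>2 (y - z)"
proof -
  have "ereal c + ereal (real m / real K2.e) \<le> \<nu>\<^sub>1 x + ereal (real m / real K2.e)"
    by (intro add_mono assms(3)) simp
  then show ?thesis using rep_dist[OF assms(1,2)] by (simp add: order_trans)
qed

lemma rep_res:
  assumes "rep x y" "rep x z" "0 \<le> \<nu>\<^sub>1 x" shows "0 < \<nu>\<^sub>2 (y - z)"
proof (rule K2.ge_imp_pos)
  show "0 + real m / real K2.e > 0" using m K2.e_pos by simp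
  show "ereal (0 + real m / real K2.e) \<le> \<nu>\<^sub>2 (y - z)"
    by (rule rep_dist_ge[OF assms(1,2)]) (use assms(3) in \<open>simp add: zero_ereal_def\<close>)
qed

text \<open>
  Apply the hyperfield sum to \<open>x + (x' - x)\<close>, where the second summand has the larger
  valuation.
\<close>

lemma rep_congruent:
  assumes "rep x y" "rep x' y'" "x \<noteq> 0" and gt: "\<nu>\<^sub>1 x < \<nu>\<^sub>1 (x' - x)"
  shows "\<nu>\<^sub>2 y < \<nu>\<^sub>2 (y' - y)"
proof -
  obtain r where r: "\<nu>\<^sub>1 x = ereal r" using K1.val_real[OF assms(3)] .
  obtain d where d: "rep (x' - x) d" by (rule ex_rep)
  obtain a b where ab: "rep x a" "rep (x' - x) b" "rep (x + (x' - x)) (a + b)" using rep_add[OF assms(1) d] .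
  have x': "\<nu>\<^sub>1 x' = \<nu>\<^sub>1 x" using K1.val_add_eq[OF gt] by simp
  have pos: "0 < real m / real K2.e" using m K2.e_pos by simp
  have 1: "ereal (r + real m / real K2.e) \<le> \<nu>\<^sub>2 (a - y)" by (rule rep_dist_ge[OF ab(1) assms(1)]) (simp add: r)
  have 2: "ereal (r + real m / real K2.e) \<le> \<nu>\<^sub>2 (y' - (a + b))"
    using ab(3) by (intro rep_dist_ge[OF assms(2)]) (simp_all add: r x')
  have 3: "ereal r < \<nu>\<^sub>2 b" using rep_val[OF ab(2)] gt r by simp
  have "ereal r < \<nu>\<^sub>2 ((y' - (a + b)) + (a - y) + b)"
    using 1 2 3 pos by (intro K2.gt_add) (auto intro: less_le_trans[of _ "ereal (r + real m / real K2.e)"])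
  then show ?thesis using rep_val[OF assms(1)] r by simp
qed

text \<open>
  The reduction is well defined because elements with the same class at level \<open>1\<close> have
  congruent representatives.
\<close>

lemma reduction_hclass:
  assumes "rep x y" shows "reduction \<nu>\<^sub>1 n \<nu>\<^sub>2 \<phi> (hclass \<nu>\<^sub>1 1 x) = hclass \<nu>\<^sub>2 1 y"
  unfolding reduction_def
proof (rule the_equality)
  show "\<exists>x' y'. hclass \<nu>\<^sub>1 1 x = hclass \<nu>\<^sub>1 1 x' \<and> y' \<in> \<phi> (hclass \<nu>\<^sub>1 n x') \<and> hclass \<nu>\<^sub>2 1 y = hclass \<nu>\<^sub>2 1 y'"
    using assms unfolding rep_def by blast
next
  fix \<beta> assume "\<exists>x' y'. hclass \<nu>\<^sub>1 1 x = hclass \<nu>\<^sub>1 1 x' \<and> y' \<in> \<phi> (hclass \<nu>\<^sub>1 n x') \<and> \<beta> = hclass \<nu>\<^sub>2 1 y'"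
  then obtain x' y' where x': "hclass \<nu>\<^sub>1 1 x = hclass \<nu>\<^sub>1 1 x'" "rep x' y'" "\<beta> = hclass \<nu>\<^sub>2 1 y'"
    unfolding rep_def by blast
  have mem: "x' \<in> hclass \<nu>\<^sub>1 1 x" using x'(1) K1.hclass_eq_iff[of 1 x x'] by simp
  have "y' \<in> hclass \<nu>\<^sub>2 1 y"
  proof (cases "x = 0")
    case True
    then have "x' = 0" using mem by simp
    then have "\<nu>\<^sub>2 y = \<infinity>" "\<nu>\<^sub>2 y' = \<infinity>" using rep_val[OF assms] rep_val[OF x'(2)] True by simp_all
    then show ?thesis using K2.infinity_iff by simp
  next
    case False
    then obtain r where r: "\<nu>\<^sub>1 x = ereal r" by (rule K1.val_real)
    have "\<nu>\<^sub>1 x < \<nu>\<^sub>1 x + ereal (real 1 / real K1.e)" using r K1.e_pos by simp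
    also have "\<dots> \<le> \<nu>\<^sub>1 (x' - x)" using mem by (simp add: K1.in_hclass_iff)
    finally have gt: "\<nu>\<^sub>2 y < \<nu>\<^sub>2 (y' - y)" by (rule rep_congruent[OF assms x'(2) False])
    have y0: "y \<noteq> 0" using rep_val[OF assms] r by auto
    obtain k :: int where k: "\<nu>\<^sub>2 y = ereal (of_int k / real K2.e)" using K2.val_discrete[OF y0] .
    have "ereal ((of_int k + 1) / real K2.e) \<le> \<nu>\<^sub>2 (y' - y)" using gt k by (intro K2.gt_imp_ge_succ) simp
    then show ?thesis unfolding K2.in_hclass_iff k by (simp add: add_divide_distrib)
  qed
  then show "\<beta> = hclass \<nu>\<^sub>2 1 y" using K2.hclass_eq_iff[of 1 y y'] x'(3) by simp
qed

text \<open>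
  A Teichmueller element has roots of every order \<open>p\<^sup>i\<close>, and raising to the power \<open>p\<^sup>i\<close> contracts
  congruences. So the class of its image contains a Teichmueller element, whatever the level \<open>m\<close>.
\<close>

lemma ex_teich_rep:
  assumes "t \<in> K1.teich" shows "\<exists>!s. s \<in> K2.teich \<and> rep t s"
proof (rule ex_ex1I)
  show "\<exists>s. s \<in> K2.teich \<and> rep t s"
  proof (cases "t = 0")
    case True
    then show ?thesis using rep_0 by (intro exI[of _ 0]) simp
  next
    case False
    obtain s where s: "s \<in> K1.teich" "s ^ (p ^ m) = t" using K1.teich_root[OF assms] .
    have "s \<noteq> 0" using False s K1.p_pos by auto
    then have vs: "\<nu>\<^sub>1 s = 0" using K1.teich_unit s by blast
    obtain y where y: "rep s y" by (rule ex_rep)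
    have vy: "\<nu>\<^sub>2 y = 0" using rep_val[OF y] vs by simp
    obtain r where r: "r \<in> K2.teich" "0 < \<nu>\<^sub>2 (y - r)" using K2.teich_exists[of y] vy by auto
    have ty: "rep t (y ^ (p ^ m))" using rep_power[OF y, of "p ^ m"] s by simp
    have "ereal (real (Suc m) / real K2.e) \<le> \<nu>\<^sub>2 (y ^ (p ^ m) - r ^ (p ^ m))"
      using vy K2.teich_int[OF r(1)] r(2) by (intro K2.frobenius_power_contracts) simp_all
    then have "ereal (real m / real K2.e) \<le> \<nu>\<^sub>2 (y ^ (p ^ m) - r ^ (p ^ m))"
      by (rule order_trans[rotated]) (simp add: divide_right_mono)
    then have "r ^ (p ^ m) \<in> hclass \<nu>\<^sub>2 m (y ^ (p ^ m))"
      by (simp add: K2.in_hclass_iff K2.val_power vy K2.val_minus_commute)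
    then have "rep t (r ^ (p ^ m))" using rep_close[OF ty] by simp
    then show ?thesis using r K2.teich_power by blast
  qed
next
  fix s s' assume "s \<in> K2.teich \<and> rep t s" "s' \<in> K2.teich \<and> rep t s'"
  then show "s = s'" using K2.teich_unique[of s s'] rep_res[of t s s'] K1.teich_int[OF assms] by blast
qed

definition \<kappa> :: "'a \<Rightarrow> 'b" where "\<kappa> t = (THE s. s \<in> K2.teich \<and> rep t s)"

lemma \<kappa>: assumes "t \<in> K1.teich" shows "\<kappa> t \<in> K2.teich" "rep t (\<kappa> t)"
  using theI'[OF ex_teich_rep[OF assms]] unfolding \<kappa>_def by auto

lemma \<kappa>_eq: "t \<in> K1.teich \<Longrightarrow> s \<in> K2.teich \<Longrightarrow> rep t s \<Longrightarrow> \<kappa> t = s"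
  unfolding \<kappa>_def using ex_teich_rep by (intro the1_equality) auto

sublocale witt_pair \<nu>\<^sub>1 \<nu>\<^sub>2 p \<kappa>
proof
  show "\<kappa> t \<in> K2.teich" if "t \<in> K1.teich" for t using \<kappa>[OF that] by simp
  show "\<kappa> (s * t) = \<kappa> s * \<kappa> t" if "s \<in> K1.teich" "t \<in> K1.teich" for s t
    using that \<kappa> by (intro \<kappa>_eq K1.teich_mult K2.teich_mult rep_mult)
  show "\<kappa> 0 = 0" "\<kappa> 1 = 1" by (intro \<kappa>_eq; simp add: rep_0 rep_1)+
  fix s t u assume T: "s \<in> K1.teich" "t \<in> K1.teich" "u \<in> K1.teich" and gt: "0 < \<nu>\<^sub>1 (s + t - u)"
  obtain a b where ab: "rep s a" "rep t b" "rep (s + t) (a + b)" using rep_add[OF \<kappa>(2)[OF T(1)] \<kappa>(2)[OF T(2)]] .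
  obtain d where "rep (s + t - u) d" by (rule ex_rep)
  then obtain a' b' where ab': "rep u a'" "rep (s + t - u) b'" "rep (u + (s + t - u)) (a' + b')"
    using rep_add[OF \<kappa>(2)[OF T(3)]] by blast
  have "0 < \<nu>\<^sub>2 (\<kappa> s - a)" "0 < \<nu>\<^sub>2 (\<kappa> t - b)" "0 < \<nu>\<^sub>2 (a' - \<kappa> u)"
    using rep_res[OF \<kappa>(2)[OF T(1)] ab(1)] rep_res[OF \<kappa>(2)[OF T(2)] ab(2)] rep_res[OF ab'(1) \<kappa>(2)[OF T(3)]]
      K1.teich_int T by auto
  moreover have "0 < \<nu>\<^sub>2 ((a + b) - (a' + b'))"
    using ab(3) ab'(3) T K1.teich_int by (intro rep_res[of "s + t"] K1.ge_add) auto
  moreover have "0 < \<nu>\<^sub>2 b'" using rep_val[OF ab'(2)] gt by simp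
  ultimately have "0 < \<nu>\<^sub>2 ((\<kappa> s - a) + (\<kappa> t - b) + ((a + b) - (a' + b')) + b' + (a' - \<kappa> u))"
    by (intro K2.gt_add)
  then show "0 < \<nu>\<^sub>2 (\<kappa> s + \<kappa> t - \<kappa> u)" by (simp add: algebra_simps)
qed

end

lemma (in valued_field) val_prod_linear_le:
  assumes "\<And>r. r \<in># A \<Longrightarrow> \<nu> (x - r) \<le> ereal c"
  shows "\<nu> (poly (\<Prod>r\<in>#A. [:-r, 1:]) x) \<le> ereal (real (size A) * c)"
  using assms
proof (induction A)
  case empty
  then show ?case by (simp add: zero_ereal_def)
next
  case (add r A)
  have "\<nu> (x - r) + \<nu> (poly (\<Prod>r\<in>#A. [:-r, 1:]) x) \<le> ereal c + ereal (real (size A) * c)"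
    using add by (intro add_mono) auto
  then show ?case by (simp add: mult algebra_simps flip: mult)
qed

section \<open>Existence of the lifting\<close>

text \<open>
  The hypothesis on \<open>m\<close>, with \<open>\<mu>\<close> the real number
  \<open>M(K\<^sub>1)\<close>.
\<close>

locale precise_hyper_hom = hyper_hom +
  fixes \<mu> :: real
  assumes M: "M_inv p \<nu>\<^sub>1 = ereal \<mu>" and \<mu>_nonneg: "0 \<le> \<mu>"
    and precise: "\<mu> * real K1.e < real m / real K2.e"
begin

lemma \<mu>_less: "\<mu> < real m / real K2.e"
proof -
  have "\<mu> * 1 \<le> \<mu> * real K1.e" using K1.e_pos \<mu>_nonneg by (intro mult_left_mono) auto
  then show ?thesis using precise by simp
qed

lemma witt_map_of_nat: "witt_map (of_nat k) = of_nat k"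
  by (rule witt_map_eq[OF graph_of_nat])

text \<open>
  The relation \<open>\<pi>\<^sup>e = p \<Sum> c\<^sub>i \<pi>\<^sup>i\<close> is a sum of terms \<open>p\<^sup>j\<^sup>+\<^sup>1 t \<pi>\<^sup>i\<close> with Teichmueller elements \<open>t\<close>, whose
  classes have known images. All terms have valuation at least \<open>1\<close>, so the relation holds for the
  representative \<open>b\<close> up to an error of valuation at least \<open>1 + m/e\<^sub>2\<close>.
\<close>

lemma eis_relation_approx:
  assumes b: "rep K1.unif b"
  shows "ereal (1 + real m / real K2.e) \<le> \<nu>\<^sub>2 (b ^ K1.e - (\<Sum>i<K1.e. witt_map (K1.eis i) * b ^ i))"
proof -
  define C where "C = 1 + real m / real K2.e"
  have C: "C \<le> real (Suc m)" "0 \<le> C"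
  proof -
    have "real m / real K2.e \<le> real m / 1" using K2.e_pos by (intro divide_left_mono) auto
    then show "C \<le> real (Suc m)" by (simp add: C_def)
  qed (simp add: C_def)
  have b_int: "0 \<le> \<nu>\<^sub>2 b" using rep_val[OF b] K1.unif_int by simp
  define c where "c = K1.coords (K1.unif ^ K1.e / of_nat p)"
  have c: "c i \<in> witt_ring p \<nu>\<^sub>1" for i unfolding c_def by (rule K1.coords(1)[OF K1.unif_power_e_int])
  have eis: "K1.eis i = of_nat p * c i" for i by (simp add: K1.eis_def c_def)
  define Q where "Q = (\<lambda>i t x' y'. (\<forall>j. t j \<in> K1.teich) \<and> 0 \<le> \<nu>\<^sub>1 x' \<and> 0 \<le> \<nu>\<^sub>2 y' \<and>
    c i = (\<Sum>j<m. of_nat p ^ j * t j) + of_nat p ^ m * x' \<and>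
    witt_map (c i) = (\<Sum>j<m. of_nat p ^ j * \<kappa> (t j)) + of_nat p ^ m * y')"
  have "\<exists>t x' y'. Q i t x' y'" for i
  proof (rule graph_expansion[OF graph_witt_map[OF c[of i]]])
    fix t :: "nat \<Rightarrow> 'a"
    assume t: "\<And>i. t i \<in> K1.teich" "\<And>N. \<exists>x' y'. graph x' y' \<and> c i = (\<Sum>i<N. of_nat p ^ i * t i) + of_nat p ^ N * x'
        \<and> witt_map (c i) = (\<Sum>i<N. of_nat p ^ i * \<kappa> (t i)) + of_nat p ^ N * y'"
    obtain x' y' where xy: "graph x' y'" "c i = (\<Sum>j<m. of_nat p ^ j * t j) + of_nat p ^ m * x'"
      "witt_map (c i) = (\<Sum>j<m. of_nat p ^ j * \<kappa> (t j)) + of_nat p ^ m * y'" using t(2)[of m] by blast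
    show ?thesis unfolding Q_def using t(1) xy(2,3) graph_int[OF xy(1)] by blast
  qed
  then obtain t x' y' where "\<And>i. Q i (t i) (x' i) (y' i)" by metis
  then have t: "\<And>i j. t i j \<in> K1.teich" and x': "\<And>i. 0 \<le> \<nu>\<^sub>1 (x' i)" and y': "\<And>i. 0 \<le> \<nu>\<^sub>2 (y' i)"
    and ct: "\<And>i. c i = (\<Sum>j<m. of_nat p ^ j * t i j) + of_nat p ^ m * x' i"
    and wt: "\<And>i. witt_map (c i) = (\<Sum>j<m. of_nat p ^ j * \<kappa> (t i j)) + of_nat p ^ m * y' i"
    unfolding Q_def by blast+
  define I where "I = {..<K1.e} \<times> {..<m}"
  define f where "f = (\<lambda>(i, j). of_nat p ^ Suc j * t i j * K1.unif ^ i)"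
  define f' where "f' = (\<lambda>(i, j). of_nat p ^ Suc j * \<kappa> (t i j) * b ^ i)"
  define r where "r = of_nat p ^ Suc m * (\<Sum>i<K1.e. x' i * K1.unif ^ i)"
  define r' where "r' = of_nat p ^ Suc m * (\<Sum>i<K1.e. y' i * b ^ i)"
  have expand: "of_nat p * ((\<Sum>j<m. of_nat p ^ j * s j) + of_nat p ^ m * a) * z
    = (\<Sum>j<m. of_nat p ^ Suc j * s j * z) + of_nat p ^ Suc m * (a * z)" for s a and z :: "'c::comm_ring_1"
    by (simp only: distrib_left distrib_right sum_distrib_left sum_distrib_right power_Suc mult.assoc)
  have dec: "K1.unif ^ K1.e = sum f I + r"
  proof -
    have "K1.unif ^ K1.e = (\<Sum>i<K1.e. (\<Sum>j<m. of_nat p ^ Suc j * t i j * K1.unif ^ i) + of_nat p ^ Suc m * (x' i * K1.unif ^ i))"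
      unfolding K1.unif_power_e eis ct expand ..
    then show ?thesis
      by (simp add: sum.distrib I_def f_def r_def sum_distrib_left sum.cartesian_product)
  qed
  have dec': "(\<Sum>i<K1.e. witt_map (K1.eis i) * b ^ i) = sum f' I + r'"
  proof -
    have weis: "witt_map (K1.eis i) = of_nat p * witt_map (c i)" for i
      unfolding eis by (simp add: witt_map_mult c K1.witt_of_nat witt_map_of_nat)
    have "(\<Sum>i<K1.e. witt_map (K1.eis i) * b ^ i) =
      (\<Sum>i<K1.e. (\<Sum>j<m. of_nat p ^ Suc j * \<kappa> (t i j) * b ^ i) + of_nat p ^ Suc m * (y' i * b ^ i))"
      unfolding weis wt expand ..
    then show ?thesis
      by (simp add: sum.distrib I_def f'_def r'_def sum_distrib_left sum.cartesian_product)
  qed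
  have vf: "ereal 1 \<le> \<nu>\<^sub>1 (f k)" for k
  proof -
    obtain i j where k: "k = (i, j)" by (cases k)
    have "ereal 1 \<le> \<nu>\<^sub>1 (of_nat p ^ Suc j)" by (simp add: K1.val_p_power del: power_Suc)
    then show ?thesis unfolding k f_def prod.case
      by (intro K1.ge_mult_int K1.int_power K1.unif_int K1.teich_int t)
  qed
  have repf: "rep (f k) (f' k)" for k
    unfolding f_def f'_def by (cases k) (auto intro!: rep_mult rep_power rep_p b \<kappa>(2) t simp del: power_Suc)
  \<comment> \<open>The sum of the \<open>f k\<close> plus \<open>r\<close> is a hyperfield sum. The errors of all representatives are bounded separately.\<close>
  obtain y where y: "\<And>k. k \<in> I \<Longrightarrow> rep (f k) (y k)" "rep (sum f I) (sum y I)"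
    using rep_sum[of I f] by (auto simp: I_def)
  obtain z where "rep r z" by (rule ex_rep)
  then obtain u v where uv: "rep (sum f I) u" "rep r v" "rep (K1.unif ^ K1.e) (u + v)"
    using rep_add[OF y(2)] dec by metis
  have vr: "ereal C \<le> \<nu>\<^sub>1 r" unfolding r_def
    by (rule K1.ge_mult_int) (use C(1) in \<open>auto intro!: K1.ge_sum K1.int_mult K1.int_power K1.unif_int x'
      simp: K1.val_p_power simp del: power_Suc\<close>)
  have vr': "ereal C \<le> \<nu>\<^sub>2 r'" unfolding r'_def
    by (rule K2.ge_mult_int) (use C(1) in \<open>auto intro!: K2.ge_sum K2.int_mult K2.int_power b_int y'
      simp: K2.val_p_power simp del: power_Suc\<close>)
  have 1: "ereal C \<le> \<nu>\<^sub>2 (b ^ K1.e - (u + v))" unfolding C_def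
    by (rule rep_dist_ge[OF rep_power[OF b] uv(3)]) (use K1.e_pos in \<open>simp add: K1.val_unif_power\<close>)
  have 2: "ereal C \<le> \<nu>\<^sub>2 v" using rep_val[OF uv(2)] vr by simp
  have 3: "ereal C \<le> \<nu>\<^sub>2 (u - sum y I)" unfolding C_def
    by (rule rep_dist_ge[OF uv(1) y(2)]) (rule K1.ge_sum[OF vf])
  have 4: "ereal C \<le> \<nu>\<^sub>2 (sum y I - sum f' I)"
    by (rule K2.val_diff_sum) (unfold C_def, rule rep_dist_ge[OF y(1) repf vf])
  have "ereal C \<le> \<nu>\<^sub>2 ((b ^ K1.e - (u + v)) + v + (u - sum y I) + (sum y I - sum f' I) - r')"
    by (intro K2.ge_diff K2.ge_add 1 2 3 4 vr')
  then show ?thesis unfolding dec' C_def by (simp add: algebra_simps)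
qed

text \<open>
  The transported Eisenstein polynomial is small at \<open>b\<close>, so it has a root \<open>\<beta>\<close> in the algebraic closure such that
  \<open>b - \<beta>\<close> has valuation greater than \<open>M + 1/e\<^sub>1\<close>. By Krasner's argument \<open>\<beta>\<close> is rational: for a further
  conjugate \<open>\<gamma>\<close> the valuation of \<open>b - \<gamma>\<close> would not be smaller, so \<open>\<gamma> - \<beta>\<close> would have valuation greater than \<open>M\<close>.
\<close>

lemma ex_root_near_rep:
  assumes b: "rep K1.unif b"
  obtains \<beta> where "\<beta> ^ K1.e = (\<Sum>i<K1.e. witt_map (K1.eis i) * \<beta> ^ i)"
    "ereal (\<mu> + 1 / real K1.e) < \<nu>\<^sub>2 (\<beta> - b)"
proof -
  define c where "c = \<mu> + 1 / real K1.e"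
  interpret w: valued_field K2.ext_val by (rule K2.valued_field_ext_val)
  define P where "P = Polynomial.monom 1 K1.e - (\<Sum>i<K1.e. Polynomial.monom (witt_map (K1.eis i)) i)"
  have cP: "poly.coeff P i = (if i = K1.e then 1 else if i < K1.e then - witt_map (K1.eis i) else 0)" for i
    by (simp add: P_def coeff_sum)
  have degP: "Polynomial.degree P = K1.e"
    by (intro antisym degree_le le_degree) (auto simp: cP)
  have P_map: "poly (map_poly to_ac P) z = z ^ K1.e - (\<Sum>i<K1.e. to_ac (witt_map (K1.eis i)) * z ^ i)" for z
  proof -
    have "poly (map_poly to_ac P) z = (\<Sum>i\<le>K1.e. to_ac (poly.coeff P i) * z ^ i)"
      by (simp add: poly_altdef degP)
    also have "{..K1.e} = insert K1.e {..<K1.e}" by auto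
    also have "(\<Sum>i\<in>insert K1.e {..<K1.e}. to_ac (poly.coeff P i) * z ^ i) =
      z ^ K1.e + (\<Sum>i<K1.e. - (to_ac (witt_map (K1.eis i)) * z ^ i))"
      by (auto simp: cP intro!: sum.cong)
    finally show ?thesis by (simp add: sum_negf)
  qed
  have lc: "Polynomial.lead_coeff (map_poly to_ac P) = 1" by (simp add: degP cP)
  then have "map_poly to_ac P \<noteq> 0" by auto
  then obtain A where A: "size A = Polynomial.degree (map_poly to_ac P)"
    "map_poly to_ac P = Polynomial.smult (Polynomial.lead_coeff (map_poly to_ac P)) (\<Prod>r\<in>#A. [:- r, 1:])"
    using alg_closed_imp_factorization by blast
  have A': "size A = K1.e" "map_poly to_ac P = (\<Prod>r\<in>#A. [:- r, 1:])"
    using A(1) degP apply simp using A(2) unfolding lc by simp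
  have "\<exists>\<beta>. \<beta> \<in># A \<and> ereal c < K2.ext_val (to_ac b - \<beta>)"
  proof (rule ccontr)
    assume "\<not> ?thesis"
    then have "\<And>r. r \<in># A \<Longrightarrow> K2.ext_val (to_ac b - r) \<le> ereal c" by (meson not_less)
    from w.val_prod_linear_le[of A "to_ac b" c, OF this]
    have "K2.ext_val (poly (map_poly to_ac P) (to_ac b)) \<le> ereal (real K1.e * c)" by (simp add: A')
    also have "poly (map_poly to_ac P) (to_ac b) = to_ac (b ^ K1.e - (\<Sum>i<K1.e. witt_map (K1.eis i) * b ^ i))"
      unfolding P_map by (simp add: to_ac_sum)
    finally have "\<nu>\<^sub>2 (b ^ K1.e - (\<Sum>i<K1.e. witt_map (K1.eis i) * b ^ i)) \<le> ereal (real K1.e * c)"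
      by (simp only: K2.ext_val_to_ac)
    then have "ereal (1 + real m / real K2.e) \<le> ereal (real K1.e * c)"
      by (rule order_trans[OF eis_relation_approx[OF b]])
    then have "1 + real m / real K2.e \<le> real K1.e * c" by (simp only: ereal_less_eq)
    also have "real K1.e * c = \<mu> * real K1.e + 1" using K1.e_pos by (simp add: c_def distrib_left mult.commute)
    finally show False using precise by simp
  qed
  then obtain \<beta> where \<beta>: "\<beta> \<in># A" "ereal c < K2.ext_val (to_ac b - \<beta>)" by blast
  then obtain B where "A = add_mset \<beta> B" by (metis multi_member_split)
  then have root: "poly (map_poly to_ac P) \<beta> = 0" unfolding A' by simp
  have \<beta>_eq: "\<beta> ^ K1.e = (\<Sum>i<K1.e. to_ac (witt_map (K1.eis i)) * \<beta> ^ i)" using root by (simp add: P_map)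
  obtain g where g: "g \<in> field_homs" "\<And>x. x \<in> witt_ring p \<nu>\<^sub>1 \<Longrightarrow> g x = to_ac (witt_map x)" "g K1.unif = \<beta>"
    "\<And>x. K2.ext_val (g x) = \<nu>\<^sub>1 x"
  proof (rule K1.extend_witt_hom[of K2.ext_val "\<lambda>x. to_ac (witt_map x)" \<beta>])
    show "K2.ext_val (of_nat p) = 1" using K2.ext_val_to_ac[of "of_nat p"] by simp
  qed (simp_all add: K2.valued_field_ext_val witt_map_add witt_map_mult witt_map_1 K2.ext_val_to_ac witt_map_int \<beta>_eq)
  \<comment> \<open>Krasner: a conjugate of \<open>\<beta>\<close> over the second field would be too close to \<open>\<beta>\<close>.\<close>
  have "\<beta> \<in> range to_ac"
  proof (rule ccontr)
    assume "\<beta> \<notin> range to_ac"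
    then obtain \<gamma> where \<gamma>: "\<gamma> \<noteq> \<beta>" "\<And>R. poly (map_poly to_ac R) \<beta> = 0 \<Longrightarrow> poly (map_poly to_ac R) \<gamma> = 0"
      by (rule K2.ex_conjugate) blast
    have "K2.ext_val (\<beta> - to_ac b) \<le> K2.ext_val (\<gamma> - to_ac b)"
    proof (rule K2.ext_val_conjugate_le)
      fix R :: "'b poly"
      have shift: "poly (map_poly to_ac (pcompose R [:- b, 1:])) z = poly (map_poly to_ac R) (z - to_ac b)" for z
        by (subst to_ac.map_poly_pcompose) (simp add: poly_pcompose)
      show "poly (map_poly to_ac R) (\<beta> - to_ac b) = 0 \<Longrightarrow> poly (map_poly to_ac R) (\<gamma> - to_ac b) = 0"
        using \<gamma>(2)[of "pcompose R [:- b, 1:]"] by (simp only: shift)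
    qed
    then have "ereal c < K2.ext_val (\<gamma> - to_ac b)"
      using \<beta>(2) by (simp add: w.val_minus_commute less_le_trans)
    then have "ereal c < K2.ext_val (\<gamma> - \<beta>)" using \<beta>(2) by (rule w.gt_trans)
    moreover have "poly (map_poly g K1.eis_poly) \<gamma> = 0"
      using \<gamma>(2)[OF root] by (simp add: P_map K1.poly_map_eis_poly[OF field_hom_if_in_field_homs[OF g(1)]] g(2) K1.eis_witt)
    then have "K2.ext_val (\<gamma> - \<beta>) \<le> ereal \<mu>"
      using K1.conjugates_separated[OF K2.valued_field_ext_val g(1,4)] \<gamma>(1) by (simp add: g(3) M)
    ultimately have "ereal c < ereal \<mu>" by (rule less_le_trans)
    then show False using K1.e_pos by (simp add: c_def)
  qed
  then obtain \<beta>0 where \<beta>0: "\<beta> = to_ac \<beta>0" by blast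
  have "to_ac (\<beta>0 ^ K1.e) = to_ac (\<Sum>i<K1.e. witt_map (K1.eis i) * \<beta>0 ^ i)"
    using \<beta>_eq by (simp add: \<beta>0 to_ac_sum)
  then have "\<beta>0 ^ K1.e = (\<Sum>i<K1.e. witt_map (K1.eis i) * \<beta>0 ^ i)" by (simp only: to_ac_eq_iff)
  moreover have "ereal c < \<nu>\<^sub>2 (\<beta>0 - b)"
    using \<beta>(2) K2.ext_val_to_ac[of "b - \<beta>0"] by (simp add: \<beta>0 K2.val_minus_commute)
  ultimately show ?thesis using that by (simp add: c_def)
qed

lemma valued_field_homD:
  assumes "g \<in> valued_field_hom \<nu>\<^sub>1 \<nu>\<^sub>2"
  shows "g \<in> field_homs" "\<nu>\<^sub>2 (g x) = \<nu>\<^sub>1 x"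
proof -
  show gh: "g \<in> field_homs" using assms by (simp add: valued_field_hom_def)
  interpret g: field_hom g by (rule field_hom_if_in_field_homs[OF gh])
  have iff: "\<nu>\<^sub>1 a \<le> \<nu>\<^sub>1 b \<longleftrightarrow> \<nu>\<^sub>2 (g a) \<le> \<nu>\<^sub>2 (g b)" for a b
    using assms unfolding valued_field_hom_def by (auto simp flip: not_less)
  have gp: "g (of_nat p) = of_nat p" by (simp add: hom_distribs)
  show "\<nu>\<^sub>2 (g x) = \<nu>\<^sub>1 x"
  proof (cases "x = 0")
    case False
    show ?thesis
    proof (rule K1.val_eq_if_same_comparisons[OF K2.mixed_char_cdvf_axioms False])
      show "g x \<noteq> 0" using False by simp
      fix i j
      show "\<nu>\<^sub>1 (x ^ K1.e * of_nat p ^ j) \<le> \<nu>\<^sub>1 (of_nat p ^ i) \<longleftrightarrow> \<nu>\<^sub>2 (g x ^ K1.e * of_nat p ^ j) \<le> \<nu>\<^sub>2 (of_nat p ^ i)"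
        "\<nu>\<^sub>1 (of_nat p ^ i) \<le> \<nu>\<^sub>1 (x ^ K1.e * of_nat p ^ j) \<longleftrightarrow> \<nu>\<^sub>2 (of_nat p ^ i) \<le> \<nu>\<^sub>2 (g x ^ K1.e * of_nat p ^ j)"
        using iff[of "x ^ K1.e * of_nat p ^ j" "of_nat p ^ i"] iff[of "of_nat p ^ i" "x ^ K1.e * of_nat p ^ j"]
        by (simp_all add: hom_distribs gp)
    qed
  qed simp
qed

text \<open>The first order congruence \<open>g(x)/y \<equiv> 1\<close> for a representative \<open>y\<close> of the image of the class of \<open>x\<close>.\<close>

definition agrees :: "('a \<Rightarrow> 'b) \<Rightarrow> 'a \<Rightarrow> bool" where
  "agrees g x \<longleftrightarrow> (\<exists>y v. rep x y \<and> g x = y * (1 + v) \<and> 0 < \<nu>\<^sub>2 v)"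

lemma agrees_mult:
  assumes "g \<in> field_homs" "agrees g x" "agrees g x'" shows "agrees g (x * x')"
proof -
  obtain y v where y: "rep x y" "g x = y * (1 + v)" "0 < \<nu>\<^sub>2 v" using assms(2) unfolding agrees_def by blast
  obtain y' v' where y': "rep x' y'" "g x' = y' * (1 + v')" "0 < \<nu>\<^sub>2 v'" using assms(3) unfolding agrees_def by blast
  have "g (x * x') = g x * g x'" using assms(1) by (simp add: field_homs_iff)
  then have "g (x * x') = y * y' * (1 + (v + v' + v * v'))" using y y' by (simp add: algebra_simps)
  moreover have "0 < \<nu>\<^sub>2 (v + v' + v * v')"
    using y(3) y'(3) by (intro K2.gt_add K2.gt_mult_int) auto
  ultimately show ?thesis using rep_mult[OF y(1) y'(1)] unfolding agrees_def by blast
qed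

lemma agrees_power: "g \<in> field_homs \<Longrightarrow> agrees g x \<Longrightarrow> agrees g (x ^ k)"
proof (induction k)
  case 0
  then show ?case unfolding agrees_def
    by (intro exI[of _ 1] exI[of _ 0]) (simp add: rep_1 field_homs_iff)
qed (simp add: agrees_mult)

text \<open>
  The congruence is multiplicative, and the field is generated multiplicatively by \<open>\<pi>\<close>, the Teichmueller elements, the
  principal units and \<open>p\<^sup>-\<^sup>1\<close>. Closeness of \<open>g \<pi>\<close> to \<open>b\<close> beyond the valuation \<open>1/e\<^sub>1\<close> of \<open>b\<close> is the congruence for \<open>\<pi>\<close>.
\<close>

lemma agrees_all:
  assumes gh: "g \<in> field_homs" and gv: "\<And>x. \<nu>\<^sub>2 (g x) = \<nu>\<^sub>1 x"
    and gt: "\<And>t. t \<in> K1.teich \<Longrightarrow> g t = \<kappa> t"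
    and b: "rep K1.unif b" and gb: "ereal (1 / real K1.e) < \<nu>\<^sub>2 (g K1.unif - b)"
  shows "agrees g x"
proof -
  interpret g: field_hom g by (rule field_hom_if_in_field_homs[OF gh])
  show ?thesis
  proof (cases "x = 0")
    case True
    then show ?thesis unfolding agrees_def by (intro exI[of _ 0]) (simp add: rep_0 exI[of _ 0])
  next
    case False
    have vb: "\<nu>\<^sub>2 b = ereal (1 / real K1.e)" using rep_val[OF b] K1.val_unif by simp
    then have b0: "b \<noteq> 0" by auto
    have unif: "agrees g K1.unif" unfolding agrees_def
    proof (intro exI conjI)
      show "g K1.unif = b * (1 + (g K1.unif - b) / b)" using b0 by (simp add: field_simps)
      show "0 < \<nu>\<^sub>2 ((g K1.unif - b) / b)"
        using gb vb by (cases "\<nu>\<^sub>2 (g K1.unif - b)") (simp_all add: K2.val_divide b0)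
    qed (rule b)
    have teich: "agrees g t" if "t \<in> K1.teich" for t
      unfolding agrees_def using \<kappa>(2)[OF that] gt[OF that] by (intro exI[of _ "\<kappa> t"] exI[of _ 0]) simp
    have one: "agrees g (1 + d)" if d: "0 < \<nu>\<^sub>1 d" for d
    proof -
      obtain y where y: "rep (1 + d) y" by (rule ex_rep)
      have "\<nu>\<^sub>2 1 < \<nu>\<^sub>2 (y - 1)" by (rule rep_congruent[OF rep_1 y]) (use d in simp_all)
      then have y1: "0 < \<nu>\<^sub>2 (y - 1)" by simp
      have vy: "\<nu>\<^sub>2 y = 0" using K2.val_add_eq[of 1 "y - 1"] y1 by simp
      then have y0: "y \<noteq> 0" by auto
      have "g (1 + d) - y = g d - (y - 1)" by (simp add: hom_distribs)
      moreover have "0 < \<nu>\<^sub>2 (g d - (y - 1))" by (rule K2.gt_diff) (use gv[of d] d y1 in simp_all)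
      ultimately have "0 < \<nu>\<^sub>2 (g (1 + d) - y)" by (simp only:)
      then have "0 < \<nu>\<^sub>2 ((g (1 + d) - y) / y)" by (simp add: K2.val_divide[OF y0] vy)
      moreover have "g (1 + d) = y * (1 + (g (1 + d) - y) / y)" using y0 by (simp add: field_simps)
      ultimately show ?thesis using y unfolding agrees_def by blast
    qed
    have inv_p: "agrees g (inverse (of_nat p))"
    proof -
      obtain z where z: "rep (inverse (of_nat p)) z" by (rule ex_rep)
      have "rep 1 (of_nat p * z)" using rep_mult[OF rep_p z] K1.p_neq_0 by simp
      then have pz: "0 < \<nu>\<^sub>2 (1 - of_nat p * z)" by (intro rep_res[OF rep_1]) simp_all
      have vpz: "\<nu>\<^sub>2 (of_nat p * z) = 0"
        using rep_val[OF \<open>rep 1 (of_nat p * z)\<close>] by simp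
      then have pz0: "of_nat p * z \<noteq> 0" by auto
      have "0 < \<nu>\<^sub>2 ((1 - of_nat p * z) / (of_nat p * z))" using pz by (simp add: K2.val_divide[OF pz0] vpz)
      moreover have "g (inverse (of_nat p)) = z * (1 + (1 - of_nat p * z) / (of_nat p * z))"
        using pz0 by (simp add: hom_distribs field_simps)
      ultimately show ?thesis using z unfolding agrees_def by blast
    qed
    have nonneg: "agrees g x" if x: "0 \<le> \<nu>\<^sub>1 x" "x \<noteq> 0" for x
    proof -
      obtain k :: int where k: "\<nu>\<^sub>1 x = ereal (of_int k / real K1.e)" using K1.val_discrete[OF x(2)] .
      then have "0 \<le> (of_int k :: real)" using x K1.e_pos by (simp add: zero_le_divide_iff)
      then obtain j :: nat where j: "k = int j" by (metis of_int_0_le_iff nonneg_int_cases)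
      define u where "u = x / K1.unif ^ j"
      have vu: "\<nu>\<^sub>1 u = 0" by (simp add: u_def K1.val_divide K1.val_unif_power k j)
      obtain t where t: "t \<in> K1.teich" "0 < \<nu>\<^sub>1 (u - t)" using K1.teich_exists[of u] vu by auto
      have vt: "\<nu>\<^sub>1 t = 0" using K1.val_eqI[of u t] t vu by simp
      then have t0: "t \<noteq> 0" by auto
      have "0 < \<nu>\<^sub>1 ((u - t) / t)" using t by (simp add: K1.val_divide[OF t0] vt)
      then have "agrees g (K1.unif ^ j * t * (1 + (u - t) / t))"
        by (intro agrees_mult agrees_power gh unif teich one t)
      moreover have "K1.unif ^ j * t * (1 + (u - t) / t) = x" using t0 by (simp add: u_def field_simps)
      ultimately show ?thesis by simp
    qed
    obtain r where r: "\<nu>\<^sub>1 x = ereal r" using K1.val_real[OF False] .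
    obtain N :: nat where "- r < real N" using reals_Archimedean2 by blast
    then have "0 \<le> \<nu>\<^sub>1 (of_nat p ^ N * x)" by (simp add: K1.mult r K1.val_p_power)
    then have "agrees g (inverse (of_nat p) ^ N * (of_nat p ^ N * x))"
      using False by (intro agrees_mult agrees_power gh inv_p nonneg) simp_all
    then show ?thesis by (simp add: field_simps)
  qed
qed

lemma ex_lifting: obtains g where "is_lifting p \<nu>\<^sub>1 n \<nu>\<^sub>2 \<phi> g"
proof -
  obtain b where b: "rep K1.unif b" by (rule ex_rep)
  obtain \<beta> where \<beta>: "\<beta> ^ K1.e = (\<Sum>i<K1.e. witt_map (K1.eis i) * \<beta> ^ i)"
    "ereal (\<mu> + 1 / real K1.e) < \<nu>\<^sub>2 (\<beta> - b)" using ex_root_near_rep[OF b] .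
  obtain g where g: "g \<in> field_homs" "\<And>x. x \<in> witt_ring p \<nu>\<^sub>1 \<Longrightarrow> g x = witt_map x" "g K1.unif = \<beta>"
    "\<And>x. \<nu>\<^sub>2 (g x) = \<nu>\<^sub>1 x"
    by (rule K1.extend_witt_hom[of \<nu>\<^sub>2 witt_map \<beta>])
      (simp_all add: K2.valued_field_axioms witt_map_add witt_map_mult witt_map_1 witt_map_int \<beta>(1))
  have gb: "ereal (1 / real K1.e) < \<nu>\<^sub>2 (g K1.unif - b)" "ereal \<mu> < \<nu>\<^sub>2 (g K1.unif - b)"
    using \<beta>(2) \<mu>_nonneg unfolding g(3)
    by (auto intro!: le_less_trans[of _ "ereal (\<mu> + 1 / real K1.e)"])
  have "is_lifting p \<nu>\<^sub>1 n \<nu>\<^sub>2 \<phi> g" unfolding is_lifting_def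
  proof (intro conjI allI)
    show "g \<in> valued_field_hom \<nu>\<^sub>1 \<nu>\<^sub>2" using g(1) by (simp add: valued_field_hom_def g(4))
    show "\<exists>\<pi>\<^sub>1. uniformizer \<nu>\<^sub>1 \<pi>\<^sub>1 \<and> (\<exists>b\<in>\<phi> (hclass \<nu>\<^sub>1 n \<pi>\<^sub>1). M_inv p \<nu>\<^sub>1 < \<nu>\<^sub>2 (g \<pi>\<^sub>1 - b))"
      using K1.uniformizer_unif b gb(2) unfolding M rep_def by blast
    fix x
    have "g t = \<kappa> t" if "t \<in> K1.teich" for t
      using g(2)[OF K1.witt_teich[OF that]] witt_map_teich[OF that] by simp
    then have "agrees g x" using agrees_all[OF g(1,4) _ b gb(1)] by blast
    then obtain y v where y: "rep x y" "g x = y * (1 + v)" "0 < \<nu>\<^sub>2 v" unfolding agrees_def by blast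
    have "g x \<in> hclass \<nu>\<^sub>2 1 y"
      unfolding hclass_def K2.max_ideal_power_eq y(2) using K2.pos_imp_ge[OF y(3)] by auto
    then have "hclass \<nu>\<^sub>2 1 y = hclass \<nu>\<^sub>2 1 (g x)" using K2.hclass_eq_iff[of 1 y "g x"] by simp
    then show "reduction \<nu>\<^sub>1 n \<nu>\<^sub>2 \<phi> (hclass \<nu>\<^sub>1 1 x) = hclass \<nu>\<^sub>2 1 (g x)"
      using reduction_hclass[OF y(1)] by simp
  qed
  then show ?thesis by (rule that)
qed

section \<open>Uniqueness of the lifting\<close>

text \<open>
  A field homomorphism carries \<open>p\<^sup>i\<close>-th roots along, so it maps Teichmueller elements to
  Teichmueller elements, which are determined by their residues.
\<close>

lemma lifting_teich:
  assumes g: "is_lifting p \<nu>\<^sub>1 n \<nu>\<^sub>2 \<phi> g" and t: "t \<in> K1.teich" shows "g t = \<kappa> t"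
proof -
  have gv: "g \<in> valued_field_hom \<nu>\<^sub>1 \<nu>\<^sub>2"
    and red: "reduction \<nu>\<^sub>1 n \<nu>\<^sub>2 \<phi> (hclass \<nu>\<^sub>1 1 t) = hclass \<nu>\<^sub>2 1 (g t)"
    using g by (auto simp: is_lifting_def)
  note gh = valued_field_homD(1)[OF gv] and v = valued_field_homD(2)[OF gv]
  interpret g: field_hom g by (rule field_hom_if_in_field_homs[OF gh])
  have "g t \<in> K2.teich" unfolding K2.teich_def
  proof (intro CollectI allI)
    fix i
    obtain y where "0 \<le> \<nu>\<^sub>1 y" "y ^ (p ^ i) = t" using t unfolding K1.teich_def by blast
    then show "\<exists>y. 0 \<le> \<nu>\<^sub>2 y \<and> y ^ (p ^ i) = g t" using v[of y] by (intro exI[of _ "g y"]) (auto simp: hom_distribs)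
  qed
  moreover have "0 < \<nu>\<^sub>2 (g t - \<kappa> t)"
  proof -
    have "hclass \<nu>\<^sub>2 1 (\<kappa> t) = hclass \<nu>\<^sub>2 1 (g t)" using red reduction_hclass[OF \<kappa>(2)[OF t]] by simp
    then have "g t \<in> hclass \<nu>\<^sub>2 1 (\<kappa> t)"
      using K2.hclass_eq_iff[OF order_refl[of 1]] by blast
    then have "\<nu>\<^sub>2 (\<kappa> t) + ereal (real 1 / real K2.e) \<le> \<nu>\<^sub>2 (g t - \<kappa> t)"
      by (simp only: K2.in_hclass_iff)
    moreover have "ereal (1 / real K2.e) \<le> \<nu>\<^sub>2 (\<kappa> t) + ereal (real 1 / real K2.e)"
      using K2.teich_int[OF \<kappa>(1)[OF t]] by (cases "\<nu>\<^sub>2 (\<kappa> t)") auto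
    ultimately show ?thesis using K2.e_pos by (intro K2.ge_imp_pos[of "1 / real K2.e"]) (auto intro: order_trans)
  qed
  ultimately show ?thesis using K2.teich_unique \<kappa>(1)[OF t] by blast
qed

text \<open>
  The lifting is continuous, and it agrees with \<^const>\<open>witt_map\<close> on the dense span of the
  Teichmueller elements.
\<close>

lemma lifting_witt:
  assumes g: "is_lifting p \<nu>\<^sub>1 n \<nu>\<^sub>2 \<phi> g" and x: "x \<in> witt_ring p \<nu>\<^sub>1" shows "g x = witt_map x"
proof -
  have gv: "g \<in> valued_field_hom \<nu>\<^sub>1 \<nu>\<^sub>2" using g by (simp add: is_lifting_def)
  note gh = valued_field_homD(1)[OF gv] and v = valued_field_homD(2)[OF gv]
  interpret g: field_hom g by (rule field_hom_if_in_field_homs[OF gh])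
  have sp: "g x = y" if "span x y" for x y
    using that by induction (simp_all add: hom_distribs lifting_teich[OF g])
  have "g x - witt_map x = 0"
  proof (rule K2.eq_0_if_val_unbounded)
    fix N
    obtain x' y' where x': "span x' y'" "ereal (real N) \<le> \<nu>\<^sub>1 (x - x')" "ereal (real N) \<le> \<nu>\<^sub>2 (witt_map x - y')"
      using graphE[OF graph_witt_map[OF x]] .
    have "ereal (real N) \<le> \<nu>\<^sub>2 (g x - g x')" using x'(2) v[of "x - x'"] by (simp add: hom_distribs)
    then show "ereal (real N) \<le> \<nu>\<^sub>2 (g x - witt_map x)"
      using x'(3) sp[OF x'(1)] K2.ge_trans[of _ "g x" y' "witt_map x"] by (simp add: K2.val_minus_commute)
  qed
  then show ?thesis by simp
qed

text \<open>
  The closeness condition of a lifting is independent of the uniformizer: expand the given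
  uniformizer in the one of the lifting condition, with Teichmueller coefficients.
\<close>

lemma lifting_near_rep:
  assumes g: "is_lifting p \<nu>\<^sub>1 n \<nu>\<^sub>2 \<phi> g" and b: "rep K1.unif b"
  shows "ereal \<mu> < \<nu>\<^sub>2 (g K1.unif - b)"
proof -
  obtain \<pi> c where \<pi>: "uniformizer \<nu>\<^sub>1 \<pi>" "rep \<pi> c" "ereal \<mu> < \<nu>\<^sub>2 (g \<pi> - c)"
    using g unfolding is_lifting_def M rep_def by blast
  have gv: "g \<in> valued_field_hom \<nu>\<^sub>1 \<nu>\<^sub>2" using g by (simp add: is_lifting_def)
  note gh = valued_field_homD(1)[OF gv] and v = valued_field_homD(2)[OF gv]
  interpret g: field_hom g by (rule field_hom_if_in_field_homs[OF gh])
  have \<pi>_int: "0 \<le> \<nu>\<^sub>1 \<pi>" using \<pi>(1) by (auto simp: uniformizer_def)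
  have c_int: "0 \<le> \<nu>\<^sub>2 c" using rep_val[OF \<pi>(2)] \<pi>_int by simp
  define k where "k = K1.e * m"
  have k: "real k / real K1.e = real m" using K1.e_pos by (simp add: k_def)
  have small: "ereal \<mu> < ereal (0 + real m / real K2.e)" using \<mu>_less by simp
  have m_ge: "ereal (0 + real m / real K2.e) \<le> ereal (real m)"
    using K2.e_pos divide_left_mono[of 1 "real K2.e" "real m"] by simp
  obtain t where t: "\<And>i. t i \<in> K1.teich" "ereal (real m) \<le> \<nu>\<^sub>1 (K1.unif - (\<Sum>i<k. t i * \<pi> ^ i))"
    using K1.teich_expansion[OF \<pi>(1) K1.unif_int, of k] unfolding k by blast
  define r where "r = K1.unif - (\<Sum>i<k. t i * \<pi> ^ i)"
  have dec: "K1.unif = (\<Sum>i<k. t i * \<pi> ^ i) + r" by (simp add: r_def)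
  obtain y where y: "\<And>i. i < k \<Longrightarrow> rep (t i * \<pi> ^ i) (y i)" "rep (\<Sum>i<k. t i * \<pi> ^ i) (\<Sum>i<k. y i)"
    using rep_sum[of "{..<k}" "\<lambda>i. t i * \<pi> ^ i"] by auto
  obtain z where "rep r z" by (rule ex_rep)
  then obtain a d where ad: "rep (\<Sum>i<k. t i * \<pi> ^ i) a" "rep r d" "rep K1.unif (a + d)"
    using rep_add[OF y(2)] dec by metis
  have int: "ereal 0 \<le> \<nu>\<^sub>1 (t i * \<pi> ^ i)" for i
    using K1.int_mult[OF K1.teich_int[OF t(1)] K1.int_power[OF \<pi>_int]] by (simp add: zero_ereal_def)
  have 1: "ereal \<mu> < \<nu>\<^sub>2 (g r - d)"
  proof -
    have "ereal (real m) \<le> \<nu>\<^sub>2 (g r - d)"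
      using t(2) v[of r] rep_val[OF ad(2)] unfolding r_def[symmetric] by (intro K2.ge_diff) simp_all
    then show ?thesis using small m_ge by (meson less_le_trans)
  qed
  have 2: "ereal \<mu> < \<nu>\<^sub>2 (a + d - b)"
    using small rep_dist_ge[OF ad(3) b, of 0] K1.unif_int
    by (intro less_le_trans[OF small]) (simp add: zero_ereal_def)
  have 3: "ereal \<mu> < \<nu>\<^sub>2 ((\<Sum>i<k. y i) - a)"
  proof -
    have "ereal (0 + real m / real K2.e) \<le> \<nu>\<^sub>2 ((\<Sum>i<k. y i) - a)"
      by (rule rep_dist_ge[OF y(2) ad(1)]) (rule K1.ge_sum[OF int])
    then show ?thesis using small by (rule less_le_trans[rotated])
  qed
  have 4: "ereal \<mu> < \<nu>\<^sub>2 (\<Sum>i<k. g (t i * \<pi> ^ i) - y i)"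
  proof (rule K2.gt_sum)
    fix i assume "i \<in> {..<k}"
    then have i: "i < k" by simp
    have "rep (t i * \<pi> ^ i) (\<kappa> (t i) * c ^ i)" by (intro rep_mult rep_power \<kappa>(2) t \<pi>)
    from rep_dist_ge[OF this y(1)[OF i] int] small
    have A: "ereal \<mu> < \<nu>\<^sub>2 (\<kappa> (t i) * c ^ i - y i)" by (rule less_le_trans[rotated])
    have "\<nu>\<^sub>2 (g \<pi> - c) \<le> \<nu>\<^sub>2 (g \<pi> ^ i - c ^ i)"
      by (rule K2.val_diff_power) (use c_int \<pi>_int v[of \<pi>] in simp_all)
    then have "\<nu>\<^sub>2 (g \<pi> - c) \<le> \<nu>\<^sub>2 (\<kappa> (t i) * (g \<pi> ^ i - c ^ i))"
      by (rule K2.ge_mult_int'[OF K2.teich_int[OF \<kappa>(1)[OF t(1)]]])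
    then have B: "ereal \<mu> < \<nu>\<^sub>2 (\<kappa> (t i) * (g \<pi> ^ i - c ^ i))" using \<pi>(3) by (rule less_le_trans[rotated])
    have "ereal \<mu> < \<nu>\<^sub>2 (\<kappa> (t i) * (g \<pi> ^ i - c ^ i) + (\<kappa> (t i) * c ^ i - y i))" by (rule K2.gt_add[OF B A])
    then show "ereal \<mu> < \<nu>\<^sub>2 (g (t i * \<pi> ^ i) - y i)"
      using lifting_teich[OF g t(1)] by (simp add: hom_distribs right_diff_distrib)
  qed simp
  have "g K1.unif = (\<Sum>i<k. g (t i * \<pi> ^ i)) + g r" by (subst dec) (simp add: hom_distribs)
  then have "g K1.unif - b = (g r - d) + (a + d - b) + ((\<Sum>i<k. y i) - a) + (\<Sum>i<k. g (t i * \<pi> ^ i) - y i)"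
    by (simp add: sum_subtractf)
  then show ?thesis using 1 2 3 4 by (metis K2.gt_add)
qed

text \<open>
  Two liftings map \<open>\<pi>\<close> to roots of the same transported polynomial. Both differ from \<open>b\<close> by an element of valuation
  greater than \<open>M\<close>, hence also from each other, so the roots coincide.
\<close>

lemma lifting_unique:
  assumes g: "is_lifting p \<nu>\<^sub>1 n \<nu>\<^sub>2 \<phi> g" and h: "is_lifting p \<nu>\<^sub>1 n \<nu>\<^sub>2 \<phi> h" shows "g = h"
proof -
  have gv: "g \<in> valued_field_hom \<nu>\<^sub>1 \<nu>\<^sub>2" using g by (simp add: is_lifting_def)
  have hv: "h \<in> valued_field_hom \<nu>\<^sub>1 \<nu>\<^sub>2" using h by (simp add: is_lifting_def)
  note gh = valued_field_homD(1)[OF gv] and hh = valued_field_homD(1)[OF hv]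
  interpret g: field_hom g by (rule field_hom_if_in_field_homs[OF gh])
  interpret h: field_hom h by (rule field_hom_if_in_field_homs[OF hh])
  have W: "g x = h x" if "x \<in> witt_ring p \<nu>\<^sub>1" for x
    using lifting_witt[OF g that] lifting_witt[OF h that] by simp
  have unif: "h K1.unif = g K1.unif"
  proof (rule ccontr)
    assume ne: "h K1.unif \<noteq> g K1.unif"
    obtain b where b: "rep K1.unif b" by (rule ex_rep)
    have "h K1.unif ^ K1.e = (\<Sum>i<K1.e. g (K1.eis i) * h K1.unif ^ i)"
      using arg_cong[OF K1.unif_power_e, of h] W[OF K1.eis_witt] by (simp add: hom_distribs)
    then have "poly (map_poly g K1.eis_poly) (h K1.unif) = 0"
      by (simp add: K1.poly_map_eis_poly[OF g.field_hom_axioms])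
    then have "\<nu>\<^sub>2 (h K1.unif - g K1.unif) \<le> ereal \<mu>"
      using K1.conjugates_separated[OF K2.valued_field_axioms gh valued_field_homD(2)[OF gv] _ ne] M by simp
    moreover have "ereal \<mu> < \<nu>\<^sub>2 (h K1.unif - g K1.unif)"
      using K2.gt_trans[OF lifting_near_rep[OF h b]] lifting_near_rep[OF g b] K2.val_minus_commute by metis
    ultimately show False by simp
  qed
  have O: "g x = h x" if "0 \<le> \<nu>\<^sub>1 x" for x
  proof -
    have "g (\<Sum>i<K1.e. K1.coords x i * K1.unif ^ i) = h (\<Sum>i<K1.e. K1.coords x i * K1.unif ^ i)"
      using W[OF K1.coords(1)[OF that]] unif by (simp add: hom_distribs)
    then show ?thesis using K1.coords(3)[OF that] by simp
  qed
  show ?thesis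
  proof
    fix x
    show "g x = h x"
    proof (cases "0 \<le> \<nu>\<^sub>1 x")
      case False
      then have x0: "x \<noteq> 0" by auto
      then obtain r where "\<nu>\<^sub>1 x = ereal r" by (rule K1.val_real)
      then have "0 \<le> \<nu>\<^sub>1 (inverse x)" using False x0 by (simp add: K1.val_inverse)
      from O[OF this] show ?thesis by (simp add: hom_distribs)
    qed (rule O)
  qed
qed

end

section \<open>The lifting map\<close>

theorem theorem3p18:
  fixes p n m e\<^sub>1 e\<^sub>2 :: nat
    and \<nu>\<^sub>1 :: "'a::field_char_0 \<Rightarrow> ereal"
    and \<nu>\<^sub>2 :: "'b::field_char_0 \<Rightarrow> ereal"
  assumes "prime p"
    and "mixed_char_cdvf \<nu>\<^sub>1 p" and "mixed_char_cdvf \<nu>\<^sub>2 p"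
    and "perfect_residue_field p \<nu>\<^sub>1" and "perfect_residue_field p \<nu>\<^sub>2"
    and "e\<^sub>1 = ramification_index \<nu>\<^sub>1" and "e\<^sub>2 = ramification_index \<nu>\<^sub>2"
    and "n \<ge> 1" and "m \<ge> 1"
    and "ereal (real m) > M_inv p \<nu>\<^sub>1 * ereal (real e\<^sub>1) * ereal (real e\<^sub>2)"
  shows "\<exists>!L. L \<in> hyperfield_hom_over_p p \<nu>\<^sub>1 n \<nu>\<^sub>2 m \<rightarrow>\<^sub>E valued_field_hom \<nu>\<^sub>1 \<nu>\<^sub>2 \<and>
           (\<forall>\<phi> \<in> hyperfield_hom_over_p p \<nu>\<^sub>1 n \<nu>\<^sub>2 m. is_lifting p \<nu>\<^sub>1 n \<nu>\<^sub>2 \<phi> (L \<phi>))"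
proof -
  interpret K1: mixed_char_cdvf \<nu>\<^sub>1 p by fact
  interpret K2: mixed_char_cdvf \<nu>\<^sub>2 p by fact
  interpret K1: perfect_cdvf \<nu>\<^sub>1 p by unfold_locales fact
  interpret K2: perfect_cdvf \<nu>\<^sub>2 p by unfold_locales fact
  obtain \<mu> where \<mu>: "0 \<le> \<mu>" "M_inv p \<nu>\<^sub>1 = ereal \<mu>" by (rule K1.M_inv_real)
  have "\<mu> * real K1.e * real K2.e < real m"
    using assms(6,7,10) by (simp add: \<mu> K1.e_def K2.e_def)
  then have precise: "\<mu> * real K1.e < real m / real K2.e" using K2.e_pos by (simp add: pos_less_divide_eq)
  let ?H = "hyperfield_hom_over_p p \<nu>\<^sub>1 n \<nu>\<^sub>2 m"
  have ex1: "\<exists>!g. is_lifting p \<nu>\<^sub>1 n \<nu>\<^sub>2 \<phi> g" if "\<phi> \<in> ?H" for \<phi>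
  proof -
    interpret precise_hyper_hom \<nu>\<^sub>1 \<nu>\<^sub>2 p n m \<phi> \<mu>
      using assms(8,9) that \<mu> precise by unfold_locales
    obtain g where g: "is_lifting p \<nu>\<^sub>1 n \<nu>\<^sub>2 \<phi> g" by (rule ex_lifting)
    show ?thesis
    proof (rule ex1I)
      show "is_lifting p \<nu>\<^sub>1 n \<nu>\<^sub>2 \<phi> g" by (rule g)
    qed (rule lifting_unique[OF _ g])
  qed
  show ?thesis
  proof (rule ex1I[of _ "\<lambda>\<phi>\<in>?H. THE g. is_lifting p \<nu>\<^sub>1 n \<nu>\<^sub>2 \<phi> g"])
    have the: "is_lifting p \<nu>\<^sub>1 n \<nu>\<^sub>2 \<phi> (THE g. is_lifting p \<nu>\<^sub>1 n \<nu>\<^sub>2 \<phi> g)" if "\<phi> \<in> ?H" for \<phi>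
      by (rule theI'[OF ex1[OF that]])
    show "(\<lambda>\<phi>\<in>?H. THE g. is_lifting p \<nu>\<^sub>1 n \<nu>\<^sub>2 \<phi> g) \<in> ?H \<rightarrow>\<^sub>E valued_field_hom \<nu>\<^sub>1 \<nu>\<^sub>2 \<and>
      (\<forall>\<phi>\<in>?H. is_lifting p \<nu>\<^sub>1 n \<nu>\<^sub>2 \<phi> ((\<lambda>\<phi>\<in>?H. THE g. is_lifting p \<nu>\<^sub>1 n \<nu>\<^sub>2 \<phi> g) \<phi>))"
    proof (intro conjI ballI restrict_PiE_iff[THEN iffD2])
      fix \<phi> assume phi: "\<phi> \<in> ?H"
      show "(THE g. is_lifting p \<nu>\<^sub>1 n \<nu>\<^sub>2 \<phi> g) \<in> valued_field_hom \<nu>\<^sub>1 \<nu>\<^sub>2"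
        using the[OF phi] unfolding is_lifting_def by blast
      show "is_lifting p \<nu>\<^sub>1 n \<nu>\<^sub>2 \<phi> ((\<lambda>\<phi>\<in>?H. THE g. is_lifting p \<nu>\<^sub>1 n \<nu>\<^sub>2 \<phi> g) \<phi>)"
        using the[OF phi] phi by simp
    qed
    fix L assume L: "L \<in> ?H \<rightarrow>\<^sub>E valued_field_hom \<nu>\<^sub>1 \<nu>\<^sub>2 \<and> (\<forall>\<phi>\<in>?H. is_lifting p \<nu>\<^sub>1 n \<nu>\<^sub>2 \<phi> (L \<phi>))"
    show "L = (\<lambda>\<phi>\<in>?H. THE g. is_lifting p \<nu>\<^sub>1 n \<nu>\<^sub>2 \<phi> g)"
    proof (rule extensionalityI[of _ ?H])
      show "L \<in> extensional ?H" using L by (auto simp: PiE_def)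
      fix \<phi> assume phi: "\<phi> \<in> ?H"
      then have "is_lifting p \<nu>\<^sub>1 n \<nu>\<^sub>2 \<phi> (L \<phi>)" using L by blast
      then show "L \<phi> = (\<lambda>\<phi>\<in>?H. THE g. is_lifting p \<nu>\<^sub>1 n \<nu>\<^sub>2 \<phi> g) \<phi>"
        using the1_equality[OF ex1[OF phi]] phi by simp
    qed simp
  qed
qed

end
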